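(* Let $m\ge 1$ and let $M$ be a $2m$-dimensional compact proper pointwise slant submanifold of a $(2n+1)$-dimensional cosymplectic manifold $(N,\phi,\xi,\eta,g)$ such that $\xi$ is normal to $M$. Let $\Omega$ be the (closed) $2$-form on $M$ given by $\Omega(X,Y):=g(X,TY)$ for $X,Y\in\Gamma(TM)$. Then the de Rham cohomology class $[\Omega]\in H^2(M,\mathbb{R})$ is non-vanishing.
   Context: An almost contact metric manifold $(N,\phi,\xi,\eta,g)$ is a smooth manifold $N$ of dimension $2n+1$ with a tensor field $\phi$ of type $(1,1)$, a vector field $\xi$, a $1$-form $\eta$ and a Riemannian metric $g$ such that $\phi^2=-I+\eta\otimes\xi$, $\eta(\xi)=1$ and $g(\phi X,\phi Y)=g(X,Y)-\eta(X)\eta(Y)$ for all vector fields $X,Y$ (hence $\phi\xi=0$, $\eta\circ\phi=0$, $\eta(X)=g(X,\xi)$). It is cosymplectic if and only if $\overline{\nabla}\phi=0$, where $\overline{\nabla}$ is the Levi-Civita connection of $(N,g)$; in that case also $\overline{\nabla}\eta=0$ and $\overline{\nabla}\xi=0$. For a submanifold $M$ of $N$ and $p\in M$ put $M_p:=\{X\in T_pM\mid g(X,\xi(p))=0\}$. $M$ is a pointwise slant submanifold if at each given point $p\in M$ the angle $\theta=\theta(X)$ between $\phi X$ and $M_p$ is constant for nonzero $X\in M_p$; the function $\theta$ on $M$ is the slant function. $M$ is proper if $\theta$ takes values in $[0,\frac{\pi}{2})$. For $X$ tangent to $M$ write $\phi X=TX+FX$, with $TX$ tangent to $M$ and $FX$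 normal to $M$. *)

theory Defs
  imports "HOL-Analysis.Analysis"
begin

section \<open>Smooth maps between Euclidean spaces\<close>

text \<open>These predicates are only used for open \<open>S\<close>.\<close>

primrec Ck_on ::
  "nat \<Rightarrow> 'e::euclidean_space set \<Rightarrow> ('e \<Rightarrow> 'b::real_normed_vector) \<Rightarrow> bool" where
  "Ck_on 0 S f \<longleftrightarrow> continuous_on S f"
| "Ck_on (Suc k) S f \<longleftrightarrow>
     (\<forall>x\<in>S. f differentiable (at x)) \<and> (\<forall>v. Ck_on k S (\<lambda>x. frechet_derivative f (at x) v))"

definition smooth_on :: "'e::euclidean_space set \<Rightarrow> ('e \<Rightarrow> 'b::real_normed_vector) \<Rightarrow> bool" where
  "smooth_on S f \<longleftrightarrow> (\<forall>k. Ck_on k S f)"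


section \<open>Smooth manifolds\<close>

text \<open>A chart is a pair of its domain and its coordinate map into the model space \<open>'e\<close>;
  the values of the coordinate map outside the domain are irrelevant. An atlas need not be
  maximal.\<close>

type_synonym ('a, 'e) chart = "'a set \<times> ('a \<Rightarrow> 'e)"

record ('a, 'e) manifold =
  mtop :: "'a topology"
  atlas :: "('a, 'e) chart set"

abbreviation points :: "('a, 'e) manifold \<Rightarrow> 'a set" where
  "points M \<equiv> topspace (mtop M)"

definition chart_image :: "('a, 'e) chart \<Rightarrow> 'e set" where
  "chart_image c = snd c ` fst c"

definition chart_inv :: "('a, 'e) chart \<Rightarrow> 'e \<Rightarrow> 'a" where
  "chart_inv c = inv_into (fst c) (snd c)"

definition is_chart :: "'a topology \<Rightarrow> ('a, 'e::euclidean_space) chart \<Rightarrow> bool" where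
  "is_chart X c \<longleftrightarrow> openin X (fst c) \<and> open (chart_image c) \<and>
     homeomorphic_map (subtopology X (fst c)) (top_of_set (chart_image c)) (snd c)"

definition second_countable_space :: "'a topology \<Rightarrow> bool" where
  "second_countable_space X \<longleftrightarrow>
     (\<exists>B. countable B \<and> (\<forall>V\<in>B. openin X V) \<and>
          (\<forall>U x. openin X U \<and> x \<in> U \<longrightarrow> (\<exists>V\<in>B. x \<in> V \<and> V \<subseteq> U)))"

text \<open>Manifolds have no boundary, are nonempty, and have dimension \<open>DIM('e)\<close>.\<close>

definition smooth_manifold :: "('a, 'e::euclidean_space) manifold \<Rightarrow> bool" where
  "smooth_manifold M \<longleftrightarrow>
     points M \<noteq> {} \<and> Hausdorff_space (mtop M) \<and> second_countable_space (mtop M) \<and>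
     (\<forall>c\<in>atlas M. is_chart (mtop M) c) \<and> (\<Union>c\<in>atlas M. fst c) = points M \<and>
     (\<forall>c\<in>atlas M. \<forall>d\<in>atlas M. smooth_on (snd c ` (fst c \<inter> fst d)) (snd d \<circ> chart_inv c))"

definition smooth_map ::
  "('a, 'e::euclidean_space) manifold \<Rightarrow> ('b, 'f::euclidean_space) manifold \<Rightarrow> ('a \<Rightarrow> 'b) \<Rightarrow> bool"
  where
  "smooth_map M N f \<longleftrightarrow> continuous_map (mtop M) (mtop N) f \<and>
     (\<forall>c\<in>atlas M. \<forall>d\<in>atlas N.
        smooth_on (snd c ` (fst c \<inter> f -` fst d)) (snd d \<circ> f \<circ> chart_inv c))"

definition smooth_fun :: "('a, 'e::euclidean_space) manifold \<Rightarrow> ('a \<Rightarrow> real) \<Rightarrow> bool" where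
  "smooth_fun M f \<longleftrightarrow> (\<forall>c\<in>atlas M. smooth_on (chart_image c) (f \<circ> chart_inv c))"


section \<open>Tangent vectors\<close>

text \<open>At each point \<open>p\<close> a preferred chart \<open>chart_at M p\<close> is fixed, and the tangent space at \<open>p\<close> is
  identified with the model space \<open>'e\<close> by means of it. Thus every \<open>v :: 'e\<close> is a tangent vector
  at \<open>p\<close>, and its coordinates in another chart \<open>c\<close> around \<open>p\<close> are obtained with the derivative of
  the transition map from \<open>chart_at M p\<close> to \<open>c\<close>. As \<open>chart_at M p\<close> need not depend continuously
  on \<open>p\<close>, smoothness of fields is always expressed by means of the coordinates in fixed charts.\<close>

definition chart_at :: "('a, 'e) manifold \<Rightarrow> 'a \<Rightarrow> ('a, 'e) chart" where
  "chart_at M p = (SOME c. c \<in> atlas M \<and> p \<in> fst c)"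

text \<open>\<open>coords M c p v\<close> are the coordinates in \<open>c\<close> of the tangent vector \<open>v\<close> at \<open>p\<close>, and
  \<open>tvec M c p w\<close> is the tangent vector at \<open>p\<close> with coordinates \<open>w\<close> in \<open>c\<close>.\<close>

definition coords ::
  "('a, 'e::euclidean_space) manifold \<Rightarrow> ('a, 'e) chart \<Rightarrow> 'a \<Rightarrow> 'e \<Rightarrow> 'e" where
  "coords M c p v =
     frechet_derivative (snd c \<circ> chart_inv (chart_at M p)) (at (snd (chart_at M p) p)) v"

definition tvec ::
  "('a, 'e::euclidean_space) manifold \<Rightarrow> ('a, 'e) chart \<Rightarrow> 'a \<Rightarrow> 'e \<Rightarrow> 'e" where
  "tvec M c p w = frechet_derivative (snd (chart_at M p) \<circ> chart_inv c) (at (snd c p)) w"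

definition tangent_map ::
  "('a, 'e::euclidean_space) manifold \<Rightarrow> ('b, 'f::euclidean_space) manifold \<Rightarrow>
   ('a \<Rightarrow> 'b) \<Rightarrow> 'a \<Rightarrow> 'e \<Rightarrow> 'f" where
  "tangent_map M N f p v =
     frechet_derivative (snd (chart_at N (f p)) \<circ> f \<circ> chart_inv (chart_at M p))
       (at (snd (chart_at M p) p)) v"

text \<open>The derivative \<open>v(f)\<close> of a real function in the direction of a tangent vector at \<open>p\<close>.\<close>

definition dir_deriv ::
  "('a, 'e::euclidean_space) manifold \<Rightarrow> ('a \<Rightarrow> real) \<Rightarrow> 'a \<Rightarrow> 'e \<Rightarrow> real" where
  "dir_deriv M f p v =
     frechet_derivative (f \<circ> chart_inv (chart_at M p)) (at (snd (chart_at M p) p)) v"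

definition vector_fields :: "('a, 'e::euclidean_space) manifold \<Rightarrow> ('a \<Rightarrow> 'e) set" where
  "vector_fields M =
     {X. \<forall>c\<in>atlas M. smooth_on (chart_image c)
           (\<lambda>x. coords M c (chart_inv c x) (X (chart_inv c x)))}"


section \<open>Riemannian metrics and the Levi-Civita connection\<close>

definition riemannian_metric ::
  "('a, 'e::euclidean_space) manifold \<Rightarrow> ('a \<Rightarrow> 'e \<Rightarrow> 'e \<Rightarrow> real) \<Rightarrow> bool" where
  "riemannian_metric M g \<longleftrightarrow>
     (\<forall>p\<in>points M. bilinear (g p) \<and> (\<forall>u v. g p u v = g p v u) \<and> (\<forall>v. v \<noteq> 0 \<longrightarrow> g p v v > 0)) \<and>
     (\<forall>c\<in>atlas M. \<forall>v w. smooth_on (chart_image c)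
        (\<lambda>x. let q = chart_inv c x in g q (tvec M c q v) (tvec M c q w)))"

text \<open>A connection maps vector fields \<open>X\<close>, \<open>Y\<close> to the vector field \<open>nab X Y\<close>, the covariant
  derivative of \<open>Y\<close> along \<open>X\<close>.\<close>

definition affine_connection ::
  "('a, 'e::euclidean_space) manifold \<Rightarrow> (('a \<Rightarrow> 'e) \<Rightarrow> ('a \<Rightarrow> 'e) \<Rightarrow> ('a \<Rightarrow> 'e)) \<Rightarrow> bool" where
  "affine_connection M nab \<longleftrightarrow>
     (\<forall>X\<in>vector_fields M. \<forall>Y\<in>vector_fields M. nab X Y \<in> vector_fields M) \<and>
     (\<forall>X\<in>vector_fields M. \<forall>Y\<in>vector_fields M. \<forall>Z\<in>vector_fields M. \<forall>p\<in>points M.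
        nab (\<lambda>q. X q + Y q) Z p = nab X Z p + nab Y Z p \<and>
        nab X (\<lambda>q. Y q + Z q) p = nab X Y p + nab X Z p) \<and>
     (\<forall>f. smooth_fun M f \<longrightarrow>
        (\<forall>X\<in>vector_fields M. \<forall>Y\<in>vector_fields M. \<forall>p\<in>points M.
          nab (\<lambda>q. f q *\<^sub>R X q) Y p = f p *\<^sub>R nab X Y p \<and>
          nab X (\<lambda>q. f q *\<^sub>R Y q) p = dir_deriv M f p (X p) *\<^sub>R Y p + f p *\<^sub>R nab X Y p))"

text \<open>Computed in the chart \<open>chart_at M p\<close>, in which tangent vectors at \<open>p\<close> are their own
  coordinates.\<close>

definition lie_bracket ::
  "('a, 'e::euclidean_space) manifold \<Rightarrow> ('a \<Rightarrow> 'e) \<Rightarrow> ('a \<Rightarrow> 'e) \<Rightarrow> 'a \<Rightarrow> 'e" where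
  "lie_bracket M X Y p =
     (let c = chart_at M p;
          rep = (\<lambda>Z x. coords M c (chart_inv c x) (Z (chart_inv c x)))
      in frechet_derivative (rep Y) (at (snd c p)) (X p)
         - frechet_derivative (rep X) (at (snd c p)) (Y p))"

text \<open>On a Riemannian manifold there is exactly one such connection, up to the irrelevant values
  outside \<open>points M\<close>.\<close>

definition levi_civita ::
  "('a, 'e::euclidean_space) manifold \<Rightarrow> ('a \<Rightarrow> 'e \<Rightarrow> 'e \<Rightarrow> real) \<Rightarrow>
   (('a \<Rightarrow> 'e) \<Rightarrow> ('a \<Rightarrow> 'e) \<Rightarrow> ('a \<Rightarrow> 'e)) \<Rightarrow> bool" where
  "levi_civita M g nab \<longleftrightarrow> affine_connection M nab \<and>
     (\<forall>X\<in>vector_fields M. \<forall>Y\<in>vector_fields M. \<forall>p\<in>points M.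
        nab X Y p - nab Y X p = lie_bracket M X Y p) \<and>
     (\<forall>X\<in>vector_fields M. \<forall>Y\<in>vector_fields M. \<forall>Z\<in>vector_fields M. \<forall>p\<in>points M.
        dir_deriv M (\<lambda>q. g q (Y q) (Z q)) p (X p)
          = g p (nab X Y p) (Z p) + g p (Y p) (nab X Z p))"


section \<open>Almost contact metric and cosymplectic manifolds\<close>

definition almost_contact_metric_manifold ::
  "('a, 'e::euclidean_space) manifold \<Rightarrow> ('a \<Rightarrow> 'e \<Rightarrow> 'e) \<Rightarrow> ('a \<Rightarrow> 'e) \<Rightarrow> ('a \<Rightarrow> 'e \<Rightarrow> real) \<Rightarrow>
   ('a \<Rightarrow> 'e \<Rightarrow> 'e \<Rightarrow> real) \<Rightarrow> bool" where
  "almost_contact_metric_manifold N \<phi> \<xi> \<eta> g \<longleftrightarrow>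
     smooth_manifold N \<and> riemannian_metric N g \<and> \<xi> \<in> vector_fields N \<and>
     (\<forall>p\<in>points N. linear (\<phi> p) \<and> linear (\<eta> p)) \<and>
     (\<forall>c\<in>atlas N. \<forall>v. smooth_on (chart_image c)
        (\<lambda>x. let q = chart_inv c x in coords N c q (\<phi> q (tvec N c q v)))) \<and>
     (\<forall>c\<in>atlas N. \<forall>v. smooth_on (chart_image c)
        (\<lambda>x. let q = chart_inv c x in \<eta> q (tvec N c q v))) \<and>
     (\<exists>n. DIM('e) = 2 * n + 1) \<and>
     (\<forall>p\<in>points N.
        (\<forall>v. \<phi> p (\<phi> p v) = - v + \<eta> p v *\<^sub>R \<xi> p) \<and> \<eta> p (\<xi> p) = 1 \<and>
        (\<forall>u v. g p (\<phi> p u) (\<phi> p v) = g p u v - \<eta> p u * \<eta> p v))"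

text \<open>The last conjunct says that \<open>(\<nabla>\<^sub>X \<phi>) Y = \<nabla>\<^sub>X (\<phi> Y) - \<phi> (\<nabla>\<^sub>X Y)\<close> vanishes.\<close>

definition cosymplectic_manifold ::
  "('a, 'e::euclidean_space) manifold \<Rightarrow> ('a \<Rightarrow> 'e \<Rightarrow> 'e) \<Rightarrow> ('a \<Rightarrow> 'e) \<Rightarrow> ('a \<Rightarrow> 'e \<Rightarrow> real) \<Rightarrow>
   ('a \<Rightarrow> 'e \<Rightarrow> 'e \<Rightarrow> real) \<Rightarrow> bool" where
  "cosymplectic_manifold N \<phi> \<xi> \<eta> g \<longleftrightarrow> almost_contact_metric_manifold N \<phi> \<xi> \<eta> g \<and>
     (\<exists>nab. levi_civita N g nab \<and>
        (\<forall>X\<in>vector_fields N. \<forall>Y\<in>vector_fields N. \<forall>p\<in>points N.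
           nab X (\<lambda>q. \<phi> q (Y q)) p - \<phi> p (nab X Y p) = 0))"


section \<open>Pointwise slant submanifolds\<close>

text \<open>The underlying set of a submanifold is a subset of the ambient manifold, and the inclusion is
  a smooth immersion. Its topology is not required to be the subspace topology; this is automatic
  if the submanifold is compact.\<close>

definition submanifold ::
  "('a, 'f::euclidean_space) manifold \<Rightarrow> ('a, 'e::euclidean_space) manifold \<Rightarrow> bool" where
  "submanifold M N \<longleftrightarrow> smooth_manifold M \<and> smooth_manifold N \<and> points M \<subseteq> points N \<and>
     smooth_map M N (\<lambda>p. p) \<and> (\<forall>p\<in>points M. inj (tangent_map M N (\<lambda>p. p) p))"

text \<open>The inclusion of the tangent space of \<open>M\<close> at \<open>p\<close> into that of \<open>N\<close>, and its image.\<close>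

abbreviation tincl ::
  "('a, 'f::euclidean_space) manifold \<Rightarrow> ('a, 'e::euclidean_space) manifold \<Rightarrow> 'a \<Rightarrow> 'f \<Rightarrow> 'e" where
  "tincl M N p \<equiv> tangent_map M N (\<lambda>p. p) p"

definition tangent_space ::
  "('a, 'f::euclidean_space) manifold \<Rightarrow> ('a, 'e::euclidean_space) manifold \<Rightarrow> 'a \<Rightarrow> 'e set" where
  "tangent_space M N p = range (tincl M N p)"

definition normal_to ::
  "('a, 'f::euclidean_space) manifold \<Rightarrow> ('a, 'e::euclidean_space) manifold \<Rightarrow>
   ('a \<Rightarrow> 'e \<Rightarrow> 'e \<Rightarrow> real) \<Rightarrow> ('a \<Rightarrow> 'e) \<Rightarrow> bool" where
  "normal_to M N g Z \<longleftrightarrow> (\<forall>p\<in>points M. \<forall>u\<in>tangent_space M N p. g p u (Z p) = 0)"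

text \<open>The space \<open>M\<^sub>p\<close>.\<close>

definition xi_orth_space ::
  "('a, 'f::euclidean_space) manifold \<Rightarrow> ('a, 'e::euclidean_space) manifold \<Rightarrow>
   ('a \<Rightarrow> 'e \<Rightarrow> 'e \<Rightarrow> real) \<Rightarrow> ('a \<Rightarrow> 'e) \<Rightarrow> 'a \<Rightarrow> 'e set" where
  "xi_orth_space M N g \<xi> p = {u \<in> tangent_space M N p. g p u (\<xi> p) = 0}"

text \<open>Orthogonal projection onto a subspace \<open>W\<close> with respect to an inner product \<open>h\<close>, and the
  angle between a nonzero vector \<open>v\<close> and \<open>W\<close>, that is, the number in \<open>[0, pi/2]\<close> whose cosine is
  the ratio of the lengths of the projection of \<open>v\<close> and of \<open>v\<close>.\<close>

definition orth_proj ::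
  "('e::real_vector \<Rightarrow> 'e \<Rightarrow> real) \<Rightarrow> 'e set \<Rightarrow> 'e \<Rightarrow> 'e" where
  "orth_proj h W v = (THE w. w \<in> W \<and> (\<forall>u\<in>W. h (v - w) u = 0))"

definition angle_to_subspace ::
  "('e::real_vector \<Rightarrow> 'e \<Rightarrow> real) \<Rightarrow> 'e \<Rightarrow> 'e set \<Rightarrow> real" where
  "angle_to_subspace h v W =
     (let w = orth_proj h W v in arccos (sqrt (h w w) / sqrt (h v v)))"

definition is_slant_function ::
  "('a, 'f::euclidean_space) manifold \<Rightarrow> ('a, 'e::euclidean_space) manifold \<Rightarrow>
   ('a \<Rightarrow> 'e \<Rightarrow> 'e) \<Rightarrow> ('a \<Rightarrow> 'e) \<Rightarrow> ('a \<Rightarrow> 'e \<Rightarrow> 'e \<Rightarrow> real) \<Rightarrow> ('a \<Rightarrow> real) \<Rightarrow> bool" where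
  "is_slant_function M N \<phi> \<xi> g \<theta> \<longleftrightarrow>
     (\<forall>p\<in>points M. \<forall>u\<in>xi_orth_space M N g \<xi> p.
        u \<noteq> 0 \<longrightarrow> angle_to_subspace (g p) (\<phi> p u) (xi_orth_space M N g \<xi> p) = \<theta> p)"

definition proper_pointwise_slant_submanifold ::
  "('a, 'f::euclidean_space) manifold \<Rightarrow> ('a, 'e::euclidean_space) manifold \<Rightarrow>
   ('a \<Rightarrow> 'e \<Rightarrow> 'e) \<Rightarrow> ('a \<Rightarrow> 'e) \<Rightarrow> ('a \<Rightarrow> 'e \<Rightarrow> 'e \<Rightarrow> real) \<Rightarrow> bool" where
  "proper_pointwise_slant_submanifold M N \<phi> \<xi> g \<longleftrightarrow> submanifold M N \<and>
     (\<exists>\<theta>. is_slant_function M N \<phi> \<xi> g \<theta> \<and> (\<forall>p\<in>points M. 0 \<le> \<theta> p \<and> \<theta> p < pi / 2))"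

text \<open>\<open>T u\<close>, where \<open>\<phi> u = T u + F u\<close> with \<open>T u\<close> tangent and \<open>F u\<close> normal to \<open>M\<close>.\<close>

definition tan_part ::
  "('a, 'f::euclidean_space) manifold \<Rightarrow> ('a, 'e::euclidean_space) manifold \<Rightarrow>
   ('a \<Rightarrow> 'e \<Rightarrow> 'e) \<Rightarrow> ('a \<Rightarrow> 'e \<Rightarrow> 'e \<Rightarrow> real) \<Rightarrow> 'a \<Rightarrow> 'e \<Rightarrow> 'e" where
  "tan_part M N \<phi> g p u = orth_proj (g p) (tangent_space M N p) (\<phi> p u)"


section \<open>Differential forms and de Rham cohomology\<close>

text \<open>The arguments of a \<open>k\<close>-form at a point are given as a list of length \<open>k\<close>. All other values
  are 0, so that equality of forms is equality of functions.\<close>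

type_synonym ('a, 'e) form = "'a \<Rightarrow> 'e list \<Rightarrow> real"

definition chart_form ::
  "('a, 'e::euclidean_space) manifold \<Rightarrow> ('a, 'e) chart \<Rightarrow> ('a, 'e) form \<Rightarrow> 'e \<Rightarrow> 'e list \<Rightarrow> real"
  where
  "chart_form M c \<omega> x ws = \<omega> (chart_inv c x) (map (tvec M c (chart_inv c x)) ws)"

definition diff_forms :: "('a, 'e::euclidean_space) manifold \<Rightarrow> nat \<Rightarrow> ('a, 'e) form set" where
  "diff_forms M k = {\<omega>.
     (\<forall>p vs. p \<notin> points M \<or> length vs \<noteq> k \<longrightarrow> \<omega> p vs = 0) \<and>
     (\<forall>p\<in>points M. \<forall>vs. length vs = k \<longrightarrow>
        (\<forall>i<k. linear (\<lambda>v. \<omega> p (vs[i := v]))) \<and>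
        (\<forall>i<k. \<forall>j<k. i \<noteq> j \<and> vs ! i = vs ! j \<longrightarrow> \<omega> p vs = 0)) \<and>
     (\<forall>c\<in>atlas M. \<forall>ws. length ws = k \<longrightarrow>
        smooth_on (chart_image c) (\<lambda>x. chart_form M c \<omega> x ws))}"

text \<open>\<open>is_ext_deriv M k \<omega> \<tau>\<close> says that \<open>\<tau>\<close> is the exterior derivative of the \<open>k\<close>-form \<open>\<omega>\<close>: in
  every chart, \<open>\<tau>(w\<^sub>0, \<dots>, w\<^sub>k)\<close> is the sum over \<open>i\<close> of \<open>(-1)^i\<close> times the derivative in direction
  \<open>w\<^sub>i\<close> of \<open>\<omega>(w\<^sub>0, \<dots>, w\<^sub>k)\<close> with \<open>w\<^sub>i\<close> omitted, for constant coordinate vectors \<open>w\<^sub>j\<close>.\<close>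

definition is_ext_deriv ::
  "('a, 'e::euclidean_space) manifold \<Rightarrow> nat \<Rightarrow> ('a, 'e) form \<Rightarrow> ('a, 'e) form \<Rightarrow> bool" where
  "is_ext_deriv M k \<omega> \<tau> \<longleftrightarrow>
     (\<forall>c\<in>atlas M. \<forall>x\<in>chart_image c. \<forall>ws. length ws = Suc k \<longrightarrow>
        chart_form M c \<tau> x ws =
          (\<Sum>i\<le>k. (-1) ^ i *
             frechet_derivative (\<lambda>y. chart_form M c \<omega> y (take i ws @ drop (Suc i) ws))
               (at x) (ws ! i)))"

abbreviation zero_form :: "('a, 'e) form" where
  "zero_form \<equiv> (\<lambda>p vs. 0)"

definition closed_forms :: "('a, 'e::euclidean_space) manifold \<Rightarrow> nat \<Rightarrow> ('a, 'e) form set" where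
  "closed_forms M k = {\<omega> \<in> diff_forms M k. is_ext_deriv M k \<omega> zero_form}"

definition exact_forms :: "('a, 'e::euclidean_space) manifold \<Rightarrow> nat \<Rightarrow> ('a, 'e) form set" where
  "exact_forms M k =
     (case k of 0 \<Rightarrow> {zero_form}
      | Suc j \<Rightarrow> {\<omega> \<in> diff_forms M k. \<exists>\<alpha>\<in>diff_forms M j. is_ext_deriv M j \<alpha> \<omega>})"

definition cohomologous ::
  "('a, 'e::euclidean_space) manifold \<Rightarrow> nat \<Rightarrow> (('a, 'e) form \<times> ('a, 'e) form) set" where
  "cohomologous M k = {(\<omega>, \<omega>'). \<omega> \<in> closed_forms M k \<and> \<omega>' \<in> closed_forms M k \<and>
     (\<lambda>p vs. \<omega> p vs - \<omega>' p vs) \<in> exact_forms M k}"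

definition deRham_cohomology ::
  "('a, 'e::euclidean_space) manifold \<Rightarrow> nat \<Rightarrow> ('a, 'e) form set set" where
  "deRham_cohomology M k = closed_forms M k // cohomologous M k"

text \<open>For closed \<open>\<omega>\<close> this is the cohomology class of \<open>\<omega>\<close>; for other \<open>\<omega>\<close> it is empty and hence
  not an element of \<open>deRham_cohomology M k\<close>.\<close>

definition deRham_class ::
  "('a, 'e::euclidean_space) manifold \<Rightarrow> nat \<Rightarrow> ('a, 'e) form \<Rightarrow> ('a, 'e) form set" where
  "deRham_class M k \<omega> = cohomologous M k `` {\<omega>}"

text \<open>The 2-form \<open>\<Omega>(X, Y) = g(X, T Y)\<close> on \<open>M\<close>.\<close>

definition slant_form ::
  "('a, 'f::euclidean_space) manifold \<Rightarrow> ('a, 'e::euclidean_space) manifold \<Rightarrow>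
   ('a \<Rightarrow> 'e \<Rightarrow> 'e) \<Rightarrow> ('a \<Rightarrow> 'e \<Rightarrow> 'e \<Rightarrow> real) \<Rightarrow> ('a, 'f) form" where
  "slant_form M N \<phi> g p vs =
     (if p \<in> points M \<and> length vs = 2
      then g p (tincl M N p (vs ! 0)) (tan_part M N \<phi> g p (tincl M N p (vs ! 1)))
      else 0)"

end

theory Submission
  imports Defs
begin

text \<open>Since \<open>\<nabla>\<phi> = 0\<close>, the 2-form \<open>\<Phi>(X, Y) = g(X, \<phi> Y)\<close> on \<open>N\<close> is closed, and \<open>\<Omega>\<close> is its pullback to \<open>M\<close>;
  it is nondegenerate because \<open>\<theta> < pi / 2\<close> forces \<open>T X \<noteq> 0\<close> for \<open>X \<noteq> 0\<close>. If \<open>\<Omega> = d\<alpha>\<close>, let \<open>V\<close> be the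
  Liouville field, \<open>i\<^sub>V \<Omega> = \<alpha>\<close>. Its divergence with respect to the density \<open>\<rho> = \<bar>det \<Omega>\<bar>\<^bsup>1/2\<^esup>\<close> is the
  positive constant \<open>dim M / 2\<close>, whereas the integral of a divergence over a compact manifold vanishes.
  Working with the density \<open>\<rho>\<close> instead of the volume form \<open>\<Omega>\<^sup>m\<close> avoids wedge products and Stokes' theorem:
  the divergence theorem follows from translation invariance of the Lebesgue measure, the change of
  variables formula and a partition of unity.\<close>

section \<open>Calculus of smooth functions\<close>

text \<open>The value of the divergence comes from Cartan's formula: \<Omega> is closed, so its Lie
  derivative along V is d\<alpha> = \<Omega>. The density is the absolute value of the Pfaffian of
  \<Omega>, hence homogeneous of degree \<open>dim M / 2\<close> in \<Omega>, and V expands it at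
  the rate \<open>dim M / 2\<close>. In coordinates, Jacobi's formula for the derivative of a
  determinant takes the place of flows and Lie derivatives. Compactness is the obstruction: on
  Euclidean space the standard symplectic form is exact, and its radial Liouville field expands
  volume without contradiction. Two features of the setting shape the details. Tangent vectors at a
  point are read in a preferred chart that may jump from point to point, so every smoothness claim
  is about coordinate expressions in fixed charts. And no integral over M is defined: only functions
  supported in one chart are integrated, and a finite double sum over a partition of unity replaces
  the global integral. The absolute value in the density matches the one in the change of variables
  formula, so no orientation enters.\<close>

lemma Ck_on_cong:
  assumes "open S" "\<And>x. x \<in> S \<Longrightarrow> f x = g x" "Ck_on k S f"
  shows "Ck_on k S g"
  using assms(2,3)
proof (induction k arbitrary: f g)
  case 0
  then show ?case by (auto cong: continuous_on_cong)
next
  case (Suc k)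
  have d: "(g has_derivative frechet_derivative f (at x)) (at x)" if "x \<in> S" for x
    by (rule has_derivative_transform_within_open[OF _ \<open>open S\<close> that Suc.prems(1)])
       (use Suc.prems(2) that frechet_derivative_works in auto)
  then have eq: "frechet_derivative g (at x) = frechet_derivative f (at x)" if "x \<in> S" for x
    using frechet_derivative_at that by metis
  have "Ck_on k S (\<lambda>x. frechet_derivative g (at x) v)" for v
    using Suc.prems(2) by (intro Suc.IH[OF eq[THEN fun_cong, symmetric]]) auto
  then show ?case
    using d by (auto simp: differentiable_def)
qed

text \<open>Derivatives of concrete functions come as explicit formulas rather than as
  \<open>frechet_derivative\<close>. With this rule each closure property below is an induction on
  the order, in which only the formula for the derivative has to be treated.\<close>

lemma Ck_on_SucI:
  assumes "open S" "\<And>x. x \<in> S \<Longrightarrow> (f has_derivative f' x) (at x)" "\<And>v. Ck_on k S (\<lambda>x. f' x v)"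
  shows "Ck_on (Suc k) S f"
proof -
  have "frechet_derivative f (at x) = f' x" if "x \<in> S" for x
    using assms(2)[OF that] frechet_derivative_at by metis
  then have "Ck_on k S (\<lambda>x. frechet_derivative f (at x) v)" for v
    by - (rule Ck_on_cong[OF assms(1) _ assms(3)], simp)
  then show ?thesis
    using assms(2) by (auto simp: differentiable_def)
qed

lemma Ck_on_SucD:
  assumes "Ck_on (Suc k) S f" "x \<in> S"
  shows "(f has_derivative frechet_derivative f (at x)) (at x)"
  using assms frechet_derivative_works by auto

lemma Ck_on_Suc_le: "Ck_on (Suc k) S f \<Longrightarrow> Ck_on k S f"
  by (induction k arbitrary: f)
     (auto intro!: continuous_at_imp_continuous_on differentiable_imp_continuous_within)

lemma Ck_on_imp_continuous_on: "Ck_on k S f \<Longrightarrow> continuous_on S f"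
proof (induction k)
  case (Suc k)
  then show ?case using Ck_on_Suc_le by blast
qed simp

text \<open>Differentiability is local, so different neighbourhoods may use different arguments:
  this glues functions extended by zero, and forms on a submanifold that are computed in varying
  ambient charts.\<close>

lemma Ck_on_local:
  assumes "\<And>x. x \<in> S \<Longrightarrow> \<exists>U. open U \<and> x \<in> U \<and> Ck_on k U f"
  shows "Ck_on k S f"
  using assms
proof (induction k arbitrary: f)
  case 0
  then show ?case
    by (metis Ck_on.simps(1) continuous_at_imp_continuous_on continuous_on_eq_continuous_at)
next
  case (Suc k)
  show ?case
    unfolding Ck_on.simps
  proof (intro conjI ballI allI)
    fix x assume "x \<in> S"
    then show "f differentiable (at x)"
      using Suc.prems by force
  next
    fix v
    show "Ck_on k S (\<lambda>x. frechet_derivative f (at x) v)"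
      by (rule Suc.IH) (use Suc.prems in force)
  qed
qed

lemma Ck_on_const: "open S \<Longrightarrow> Ck_on k S (\<lambda>x. c)"
proof (induction k arbitrary: c)
  case (Suc k)
  then show ?case by (intro Ck_on_SucI[where f' = "\<lambda>x v. 0"]) auto
qed simp

lemma Ck_on_bounded_linear:
  assumes "open S" "bounded_linear L" "Ck_on k S f"
  shows "Ck_on k S (\<lambda>x. L (f x))"
  using assms(3)
proof (induction k arbitrary: f)
  case 0
  then show ?case
    using assms(2) by (auto intro: bounded_linear.continuous_on)
next
  case (Suc k)
  show ?case
    by (rule Ck_on_SucI[where f' = "\<lambda>x v. L (frechet_derivative f (at x) v)", OF assms(1)])
       (use Suc bounded_linear.has_derivative[OF assms(2) Ck_on_SucD[OF Suc.prems]] in auto)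
qed

lemma Ck_on_id: "open S \<Longrightarrow> Ck_on k S (\<lambda>x. x)"
  by (cases k) (simp, blast intro: Ck_on_SucI[where f' = "\<lambda>x v. v"] Ck_on_const has_derivative_ident)

lemma Ck_on_add:
  assumes "open S" "Ck_on k S f" "Ck_on k S g"
  shows "Ck_on k S (\<lambda>x. f x + g x)"
  using assms(2,3)
proof (induction k arbitrary: f g)
  case 0
  then show ?case by (simp add: continuous_on_add continuous_on_real_sqrt)
next
  case (Suc k)
  show ?case
    by (rule Ck_on_SucI[OF assms(1)])
       (use Suc has_derivative_add[OF Ck_on_SucD[OF Suc.prems(1)] Ck_on_SucD[OF Suc.prems(2)]]
        in auto)
qed

lemma Ck_on_bounded_bilinear:
  assumes "open S" "bounded_bilinear B" "Ck_on k S f" "Ck_on k S g"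
  shows "Ck_on k S (\<lambda>x. B (f x) (g x))"
  using assms(3,4)
proof (induction k arbitrary: f g)
  case 0
  then show ?case
    using assms(2) by (auto intro: bounded_bilinear.continuous_on)
next
  case (Suc k)
  show ?case
    by (rule Ck_on_SucI[OF assms(1) bounded_bilinear.FDERIV[OF assms(2)
            Ck_on_SucD[OF Suc.prems(1)] Ck_on_SucD[OF Suc.prems(2)]]])
       (use Suc Ck_on_Suc_le[OF Suc.prems(1)] Ck_on_Suc_le[OF Suc.prems(2)]
         in \<open>auto intro!: Ck_on_add assms(1)\<close>)
qed

lemma Ck_on_sum:
  assumes "open S" "\<And>i. i \<in> I \<Longrightarrow> Ck_on k S (f i)"
  shows "Ck_on k S (\<lambda>x. \<Sum>i\<in>I. f i x)"
  using assms(2)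
  by (induction I rule: infinite_finite_induct) (auto intro: Ck_on_add Ck_on_const assms(1))

lemma Ck_on_prod:
  fixes f :: "'i \<Rightarrow> 'e::euclidean_space \<Rightarrow> real"
  assumes "open S" "\<And>i. i \<in> I \<Longrightarrow> Ck_on k S (f i)"
  shows "Ck_on k S (\<lambda>x. \<Prod>i\<in>I. f i x)"
  using assms(2)
  by (induction I rule: infinite_finite_induct)
     (auto intro: Ck_on_bounded_bilinear[OF assms(1) bounded_bilinear_mult] Ck_on_const assms(1))

lemma linear_basis_expansion:
  fixes L :: "'b::euclidean_space \<Rightarrow> 'c::real_vector"
  assumes "linear L"
  shows "L w = (\<Sum>i\<in>Basis. (w \<bullet> i) *\<^sub>R L i)"
proof -
  have "L w = L (\<Sum>i\<in>Basis. (w \<bullet> i) *\<^sub>R i)"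
    by (simp add: euclidean_representation)
  also have "\<dots> = (\<Sum>i\<in>Basis. (w \<bullet> i) *\<^sub>R L i)"
    by (simp add: linear_sum[OF assms] linear_scale[OF assms])
  finally show ?thesis .
qed

text \<open>In the chain rule the direction fed into the derivative of \<open>g\<close> varies with
  the point, whereas \<open>Ck_on\<close> speaks of fixed directions. Expanding that direction in
  the standard basis yields a sum of products, to which the induction hypothesis applies.\<close>

lemma Ck_on_compose:
  fixes g :: "'b::euclidean_space \<Rightarrow> 'c::real_normed_vector"
  assumes "open S" "open T" "f ` S \<subseteq> T" "Ck_on k S f" "Ck_on k T g"
  shows "Ck_on k S (\<lambda>x. g (f x))"
  using assms(4,5)
proof (induction k arbitrary: g)
  case 0
  then show ?case
    using assms(3) by (auto intro: continuous_on_compose2)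
next
  case (Suc k)
  let ?Df = "\<lambda>x. frechet_derivative f (at x)" and ?Dg = "\<lambda>x. frechet_derivative g (at x)"
  have "((\<lambda>x. g (f x)) has_derivative (\<lambda>v. \<Sum>i\<in>Basis. (?Df x v \<bullet> i) *\<^sub>R ?Dg (f x) i)) (at x)"
    if "x \<in> S" for x
  proof -
    have g: "(g has_derivative ?Dg (f x)) (at (f x))"
      using Ck_on_SucD[OF Suc.prems(2)] that assms(3) by blast
    have eq: "(\<lambda>v. ?Dg (f x) (?Df x v)) = (\<lambda>v. \<Sum>i\<in>Basis. (?Df x v \<bullet> i) *\<^sub>R ?Dg (f x) i)"
      by (rule ext) (rule linear_basis_expansion[OF has_derivative_linear[OF g]])
    show ?thesis
      using has_derivative_compose[OF Ck_on_SucD[OF Suc.prems(1) that] g] unfolding eq .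
  qed
  moreover have "Ck_on k S (\<lambda>x. \<Sum>i\<in>Basis. (?Df x v \<bullet> i) *\<^sub>R ?Dg (f x) i)" for v
    using Suc.prems Suc.IH[OF Ck_on_Suc_le[OF Suc.prems(1)], of "\<lambda>y. ?Dg y i" for i]
    by (intro Ck_on_sum Ck_on_bounded_bilinear[OF _ bounded_bilinear_scaleR]
        Ck_on_bounded_linear[OF _ bounded_linear_inner_left]) (simp_all add: assms(1))
  ultimately show ?case
    by (rule Ck_on_SucI[OF assms(1)])
qed

lemma Ck_on_mult:
  fixes f g :: "'e::euclidean_space \<Rightarrow> real"
  assumes "open S" "Ck_on k S f" "Ck_on k S g"
  shows "Ck_on k S (\<lambda>x. f x * g x)"
  by (rule Ck_on_bounded_bilinear[OF assms(1) bounded_bilinear_mult assms(2,3)])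

lemma Ck_on_scaleR:
  assumes "open S" "Ck_on k S f" "Ck_on k S g"
  shows "Ck_on k S (\<lambda>x. f x *\<^sub>R g x)"
  by (rule Ck_on_bounded_bilinear[OF assms(1) bounded_bilinear_scaleR assms(2,3)])

lemma Ck_on_inner_const:
  assumes "open S" "Ck_on k S f"
  shows "Ck_on k S (\<lambda>x. f x \<bullet> i)"
  by (rule Ck_on_bounded_linear[OF assms(1) bounded_linear_inner_left assms(2)])

text \<open>The derivative contains \<open>inverse (f x)\<close> again, but only one order less is
  asked of it, so the induction closes. The square root below is treated in the same way.\<close>

lemma Ck_on_inverse:
  fixes f :: "'e::euclidean_space \<Rightarrow> real"
  assumes "open S" "Ck_on k S f" "\<And>x. x \<in> S \<Longrightarrow> f x \<noteq> 0"
  shows "Ck_on k S (\<lambda>x. inverse (f x))"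
  using assms(2)
proof (induction k)
  case 0
  then show ?case using assms(3) by (simp add: continuous_on_inverse)
next
  case (Suc k)
  have "((\<lambda>x. inverse (f x)) has_derivative
        (\<lambda>v. - (inverse (f x) * frechet_derivative f (at x) v * inverse (f x)))) (at x)"
    if "x \<in> S" for x
    by (rule Deriv.has_derivative_inverse[OF assms(3)[OF that] Ck_on_SucD[OF Suc.prems that]])
  moreover have "Ck_on k S (\<lambda>x. - (inverse (f x) * frechet_derivative f (at x) v * inverse (f x)))"
    for v
    using Suc Ck_on_Suc_le[OF Suc.prems]
    by (intro Ck_on_bounded_linear[OF assms(1) bounded_linear_minus[OF bounded_linear_ident]]
        Ck_on_mult assms(1)) auto
  ultimately show ?case
    by (rule Ck_on_SucI[OF assms(1)])
qed

lemma Ck_on_sqrt: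
  fixes f :: "'e::euclidean_space \<Rightarrow> real"
  assumes "open S" "Ck_on k S f" "\<And>x. x \<in> S \<Longrightarrow> 0 < f x"
  shows "Ck_on k S (\<lambda>x. sqrt (f x))"
  using assms(2)
proof (induction k)
  case 0
  then show ?case by (simp add: continuous_on_add continuous_on_real_sqrt)
next
  case (Suc k)
  have "((\<lambda>x. sqrt (f x)) has_derivative
        (\<lambda>v. frechet_derivative f (at x) v * (inverse (sqrt (f x)) / 2))) (at x)"
    if "x \<in> S" for x
    using DERIV_compose_FDERIV[OF DERIV_real_sqrt[OF assms(3)[OF that]] Ck_on_SucD[OF Suc.prems that]] .
  moreover have "Ck_on k S (\<lambda>x. frechet_derivative f (at x) v * (inverse (sqrt (f x)) / 2))"
    for v
    unfolding divide_inverse using Suc Ck_on_Suc_le[OF Suc.prems] assms(3)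
    by (intro Ck_on_mult Ck_on_inverse Ck_on_const assms(1)) (auto simp: less_imp_neq[symmetric])
  ultimately show ?case
    by (rule Ck_on_SucI[OF assms(1)])
qed

section \<open>Smooth maps, order by order\<close>

lemma smooth_on_cong:
  "open S \<Longrightarrow> (\<And>x. x \<in> S \<Longrightarrow> f x = g x) \<Longrightarrow> smooth_on S f \<Longrightarrow> smooth_on S g"
  unfolding smooth_on_def using Ck_on_cong by metis

lemma smooth_on_local:
  "(\<And>x. x \<in> S \<Longrightarrow> \<exists>U. open U \<and> x \<in> U \<and> smooth_on U f) \<Longrightarrow> smooth_on S f"
  unfolding smooth_on_def by (intro allI Ck_on_local) blast

lemma smooth_on_has_derivative:
  "smooth_on S f \<Longrightarrow> x \<in> S \<Longrightarrow> (f has_derivative frechet_derivative f (at x)) (at x)"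
  unfolding smooth_on_def using Ck_on_SucD by blast

lemma smooth_on_deriv: "smooth_on S f \<Longrightarrow> smooth_on S (\<lambda>x. frechet_derivative f (at x) v)"
  unfolding smooth_on_def
proof
  fix k assume "\<forall>k. Ck_on k S f"
  then have "Ck_on (Suc k) S f" ..
  then show "Ck_on k S (\<lambda>x. frechet_derivative f (at x) v)" by simp
qed

lemma smooth_on_continuous_on: "smooth_on S f \<Longrightarrow> continuous_on S f"
  unfolding smooth_on_def using Ck_on_imp_continuous_on by blast

lemma smooth_on_const: "open S \<Longrightarrow> smooth_on S (\<lambda>x. c)"
  unfolding smooth_on_def using Ck_on_const by blast

lemma smooth_on_mult:
  fixes f g :: "'e::euclidean_space \<Rightarrow> real"
  shows "open S \<Longrightarrow> smooth_on S f \<Longrightarrow> smooth_on S g \<Longrightarrow> smooth_on S (\<lambda>x. f x * g x)"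
  unfolding smooth_on_def using Ck_on_mult by blast

lemma smooth_on_scaleR:
  "open S \<Longrightarrow> smooth_on S f \<Longrightarrow> smooth_on S g \<Longrightarrow> smooth_on S (\<lambda>x. f x *\<^sub>R g x)"
  unfolding smooth_on_def using Ck_on_scaleR by blast

lemma smooth_on_inner_const: "open S \<Longrightarrow> smooth_on S f \<Longrightarrow> smooth_on S (\<lambda>x. f x \<bullet> i)"
  unfolding smooth_on_def using Ck_on_inner_const by blast

lemma smooth_on_sum:
  "open S \<Longrightarrow> (\<And>i. i \<in> I \<Longrightarrow> smooth_on S (f i)) \<Longrightarrow> smooth_on S (\<lambda>x. \<Sum>i\<in>I. f i x)"
  unfolding smooth_on_def by (auto intro!: Ck_on_sum)

lemma smooth_on_compose:
  fixes g :: "'b::euclidean_space \<Rightarrow> 'c::real_normed_vector"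
  shows "open S \<Longrightarrow> open T \<Longrightarrow> f ` S \<subseteq> T \<Longrightarrow> smooth_on S f \<Longrightarrow> smooth_on T g
    \<Longrightarrow> smooth_on S (\<lambda>x. g (f x))"
  unfolding smooth_on_def by (auto intro: Ck_on_compose)

subsection \<open>A bump function\<close>

text \<open>\<open>flat 0\<close> is the classical function \<open>exp (- 1 / t)\<close> glued to
  zero. The extra powers of \<open>1 / t\<close> make the family closed, up to linear combinations,
  under differentiation, so that smoothness becomes one induction over all \<open>n\<close> at
  once.\<close>

definition flat :: "nat \<Rightarrow> real \<Rightarrow> real" where
  "flat n t = (if t > 0 then (1 / t) ^ n * exp (- (1 / t)) else 0)"

lemma flat_tendsto_0: "(flat n \<longlongrightarrow> 0) (at_right 0)"
proof -
  have "((\<lambda>s::real. s ^ n / exp s) \<longlongrightarrow> 0) at_top"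
    by (rule tendsto_power_div_exp_0)
  then have "((\<lambda>t::real. inverse t ^ n / exp (inverse t)) \<longlongrightarrow> 0) (at_right 0)"
    by (rule filterlim_compose[OF _ filterlim_inverse_at_top_right])
  moreover have "\<forall>\<^sub>F t in at_right 0. inverse t ^ n / exp (inverse t) = flat n t"
    unfolding flat_def eventually_at_right_field
    by (auto simp: exp_minus field_simps intro!: exI[of _ 1])
  ultimately show ?thesis
    using tendsto_cong by fastforce
qed

text \<open>Only \<open>t = 0\<close> is delicate: the right difference quotient of
  \<open>flat n\<close> there is \<open>flat (Suc n)\<close>, which tends to 0 since exponential
  decay beats every power, and the left one is 0.\<close>

lemma flat_deriv: "(flat n has_real_derivative flat (n + 2) t - real n * flat (n + 1) t) (at t)"
proof -
  consider "t > 0" | "t < 0" | "t = 0" by linarith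
  then show ?thesis
  proof cases
    case 1
    have "((\<lambda>t. (1 / t) ^ n * exp (- (1 / t))) has_real_derivative
        flat (n + 2) t - real n * flat (n + 1) t) (at t)"
    proof -
      have "((\<lambda>t. 1 / t) has_real_derivative - ((1 / t)\<^sup>2)) (at t)"
        using 1 by (auto intro!: derivative_eq_intros simp: field_simps power2_eq_square)
      moreover have "((\<lambda>s. s ^ n * exp (- s)) has_real_derivative
          real n * s ^ (n - 1) * exp (- s) - s ^ n * exp (- s)) (at s)" for s :: real
        by (auto intro!: derivative_eq_intros)
      ultimately have "((\<lambda>t. (1 / t) ^ n * exp (- (1 / t))) has_real_derivative
          (real n * (1 / t) ^ (n - 1) * exp (- (1 / t)) - (1 / t) ^ n * exp (- (1 / t)))
            * - ((1 / t)\<^sup>2)) (at t)"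
        using DERIV_chain2 by fast
      moreover have "(real n * s ^ (n - 1) * e - s ^ n * e) * - (s\<^sup>2)
          = s ^ (n + 2) * e - real n * (s ^ (n + 1) * e)" for s e :: real
        by (cases n) (simp_all add: algebra_simps power2_eq_square)
      ultimately show ?thesis
        using 1 by (simp add: flat_def)
    qed
    then show ?thesis
      by (rule has_field_derivative_transform_within_open[where S = "{0<..}"])
         (use 1 in \<open>auto simp: flat_def\<close>)
  next
    case 2
    have "((\<lambda>t. 0) has_real_derivative flat (n + 2) t - real n * flat (n + 1) t) (at t)"
      using 2 by (auto simp: flat_def)
    then show ?thesis
      by (rule has_field_derivative_transform_within_open[where S = "{..<0}"])
         (use 2 in \<open>auto simp: flat_def\<close>)
  next
    case 3
    have "((\<lambda>h. (flat n (0 + h) - flat n 0) / h) \<longlongrightarrow> 0) (at_right 0)"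
    proof (rule Lim_transform_eventually[OF flat_tendsto_0[of "Suc n"]])
      show "\<forall>\<^sub>F t in at_right 0. flat (Suc n) t = (flat n (0 + t) - flat n 0) / t"
        unfolding flat_def eventually_at_right_field
        by (auto simp: field_simps intro!: exI[of _ 1])
    qed
    moreover have "((\<lambda>h. (flat n (0 + h) - flat n 0) / h) \<longlongrightarrow> 0) (at_left 0)"
    proof (rule Lim_transform_eventually[OF tendsto_const])
      show "\<forall>\<^sub>F t in at_left 0. 0 = (flat n (0 + t) - flat n 0) / t"
        unfolding flat_def eventually_at_left_field
        by (auto intro!: exI[of _ "-1"])
    qed
    ultimately show ?thesis
      using 3 by (auto simp: DERIV_def flat_def filterlim_split_at)
  qed
qed

lemma flat_smooth: "smooth_on UNIV (flat n)"
proof -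
  have "Ck_on k UNIV (flat n)" for k
  proof (induction k arbitrary: n)
    case 0
    show ?case
      using flat_deriv by (auto intro!: continuous_at_imp_continuous_on DERIV_isCont)
  next
    case (Suc k)
    show ?case
    proof (rule Ck_on_SucI)
      show "(flat n has_derivative (*) (flat (n + 2) t - real n * flat (n + 1) t)) (at t)" for t
        using flat_deriv has_field_derivative_imp_has_derivative by blast
      have "Ck_on k UNIV (\<lambda>t. (flat (n + 2) t + (- real n) * flat (n + 1) t) * v)" for v
        by (intro Ck_on_mult Ck_on_add Ck_on_const open_UNIV Suc.IH)
      then show "Ck_on k UNIV (\<lambda>t. (flat (n + 2) t - real n * flat (n + 1) t) * v)" for v
        by simp
    qed simp
  qed
  then show ?thesis
    by (simp add: smooth_on_def)
qed

text \<open>The bump is \<open>flat 0\<close> of \<open>r^2 - |x - a|^2\<close>, normalised at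
  \<open>a\<close>. This inner function has a critical point at \<open>a\<close>, so multiplication
  by the bump changes neither values nor first derivatives at \<open>a\<close>; that suffices for
  the pointwise computations with a connection.\<close>

lemma bump_function_exists:
  fixes a :: "'e::euclidean_space"
  assumes "r > 0"
  obtains b :: "'e \<Rightarrow> real" where "smooth_on UNIV b" "b a = 1" "(b has_derivative (\<lambda>v. 0)) (at a)"
    "\<And>x. b x \<ge> 0" "\<And>x. x \<in> ball a r \<Longrightarrow> b x > 0" "\<And>x. x \<notin> ball a r \<Longrightarrow> b x = 0"
proof -
  let ?q = "\<lambda>x. r\<^sup>2 - (x - a) \<bullet> (x - a)"
  define b where "b = (\<lambda>x. flat 0 (?q x) * (1 / flat 0 (r\<^sup>2)))"
  have pos: "flat 0 t > 0 \<longleftrightarrow> t > 0" "flat 0 t \<ge> 0" for t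
    by (auto simp: flat_def)
  have iff: "x \<in> ball a r \<longleftrightarrow> ?q x > 0" for x
  proof -
    have "x \<in> ball a r \<longleftrightarrow> norm (x - a) < r"
      by (simp add: dist_norm norm_minus_commute)
    also have "\<dots> \<longleftrightarrow> (norm (x - a))\<^sup>2 < r\<^sup>2"
      using assms by (meson less_imp_le norm_ge_zero pos2 power2_less_imp_less power_strict_mono)
    finally show ?thesis
      by (simp add: power2_norm_eq_inner)
  qed
  have b0: "b a = 1" using assms pos(1)[of "r\<^sup>2"] by (simp add: b_def)
  have b1: "b x \<ge> 0" for x using pos(2) by (simp add: b_def)
  have b2: "b x > 0" if "x \<in> ball a r" for x
    using that assms iff[of x] pos(1)[of "r\<^sup>2"] pos(1)[of "?q x"] by (simp add: b_def)
  have b3: "b x = 0" if "x \<notin> ball a r" for x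
    using that iff[of x] by (simp add: b_def flat_def)
  have "Ck_on k UNIV (\<lambda>x. x + (- a))" for k
    by (intro Ck_on_add Ck_on_id Ck_on_const open_UNIV)
  then have "Ck_on k UNIV (\<lambda>x. r\<^sup>2 + (- ((x + (- a)) \<bullet> (x + (- a)))))" for k
    by (intro Ck_on_add[of _ _ "\<lambda>x. r\<^sup>2"] Ck_on_const open_UNIV
        Ck_on_bounded_linear[OF _ bounded_linear_minus[OF bounded_linear_ident]]
        Ck_on_bounded_bilinear[OF _ bounded_bilinear_inner])
  then have q: "smooth_on UNIV ?q"
    by (simp add: smooth_on_def)
  have b4: "smooth_on UNIV b"
    unfolding b_def
    by (intro smooth_on_mult smooth_on_const open_UNIV
        smooth_on_compose[OF open_UNIV open_UNIV _ q flat_smooth]) auto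
  have "(?q has_derivative (\<lambda>v. 0)) (at a)"
    by (auto intro!: derivative_eq_intros)
  from DERIV_compose_FDERIV[OF flat_deriv this]
  have "((\<lambda>x. flat 0 (?q x)) has_derivative (\<lambda>v. 0)) (at a)"
    by simp
  from has_derivative_mult_left[OF this, of "1 / flat 0 (r\<^sup>2)"]
  have b5: "(b has_derivative (\<lambda>v. 0)) (at a)"
    by (simp add: b_def)
  show thesis
    by (rule that[of b, OF b4 b0 b5 b1 b2 b3])
qed

section \<open>Charts and tangent vectors\<close>

lemma chart_inv_in: "x \<in> chart_image c \<Longrightarrow> chart_inv c x \<in> fst c"
  and chart_of_inv: "x \<in> chart_image c \<Longrightarrow> snd c (chart_inv c x) = x"
  unfolding chart_image_def chart_inv_def by (auto intro: inv_into_into f_inv_into_f)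

lemma chart_in_image: "p \<in> fst c \<Longrightarrow> snd c p \<in> chart_image c"
  by (simp add: chart_image_def)

text \<open>The two charts may have different model spaces. One notation thus covers the transition
  maps within a manifold and the inclusion of a submanifold, read in a chart of each.\<close>

definition tder :: "('a, 'e::euclidean_space) chart \<Rightarrow> ('a, 'f::euclidean_space) chart \<Rightarrow> 'a \<Rightarrow> 'e \<Rightarrow> 'f" where
  "tder c d p = frechet_derivative (snd d \<circ> chart_inv c) (at (snd c p))"

lemma coords_tder: "coords M c p v = tder (chart_at M p) c p v"
  and tvec_tder: "tvec M c p w = tder c (chart_at M p) p w"
  by (simp_all add: coords_def tvec_def tder_def)

locale smooth_mfd =
  fixes M :: "('a, 'f::euclidean_space) manifold"
  assumes smooth_manifold: "smooth_manifold M"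
begin

lemma is_chart: "c \<in> atlas M \<Longrightarrow> is_chart (mtop M) c"
  using smooth_manifold by (simp add: smooth_manifold_def)

lemma Hausdorff: "Hausdorff_space (mtop M)"
  using smooth_manifold by (simp add: smooth_manifold_def)

lemma openin_chart_domain: "c \<in> atlas M \<Longrightarrow> openin (mtop M) (fst c)"
  using is_chart by (simp add: is_chart_def)

lemma chart_domain_subset: "c \<in> atlas M \<Longrightarrow> fst c \<subseteq> points M"
  using openin_chart_domain openin_subset by blast

lemma open_chart_image: "c \<in> atlas M \<Longrightarrow> open (chart_image c)"
  using is_chart by (simp add: is_chart_def)

lemma topspace_chart: "c \<in> atlas M \<Longrightarrow> topspace (subtopology (mtop M) (fst c)) = fst c"
  by (simp add: Int_absorb1 chart_domain_subset)

lemma chart_homeo: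
  "c \<in> atlas M \<Longrightarrow> homeomorphic_map (subtopology (mtop M) (fst c)) (top_of_set (chart_image c)) (snd c)"
  using is_chart by (simp add: is_chart_def)

lemma chart_inv_of:
  assumes "c \<in> atlas M" "p \<in> fst c"
  shows "chart_inv c (snd c p) = p"
  using homeomorphic_imp_injective_map[OF chart_homeo[OF assms(1)], unfolded topspace_chart[OF assms(1)]] assms
  by (simp add: chart_inv_def)

lemma open_chart_of:
  assumes "c \<in> atlas M" "openin (mtop M) U" "U \<subseteq> fst c"
  shows "open (snd c ` U)"
proof -
  have "openin (subtopology (mtop M) (fst c)) U"
    using assms by (simp add: openin_open_subtopology openin_chart_domain)
  then have "openin (top_of_set (chart_image c)) (snd c ` U)"
    using homeomorphic_imp_open_map[OF chart_homeo[OF assms(1)]] by (simp add: open_map_def)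
  then show ?thesis
    using open_chart_image[OF assms(1)] by (simp add: openin_open_eq)
qed

lemma continuous_map_chart_inv:
  assumes "c \<in> atlas M"
  shows "continuous_map (top_of_set (chart_image c)) (mtop M) (chart_inv c)"
  unfolding continuous_map_def
proof (intro conjI allI impI)
  show "chart_inv c \<in> topspace (top_of_set (chart_image c)) \<rightarrow> topspace (mtop M)"
    using chart_inv_in[of _ c] chart_domain_subset[OF assms] by auto
next
  fix U assume "openin (mtop M) U"
  then have "open (snd c ` (U \<inter> fst c))"
    by (intro open_chart_of assms openin_Int openin_chart_domain) auto
  moreover have "{x \<in> topspace (top_of_set (chart_image c)). chart_inv c x \<in> U} = snd c ` (U \<inter> fst c)"
  proof (intro equalityI subsetI)
    fix x assume "x \<in> {x \<in> topspace (top_of_set (chart_image c)). chart_inv c x \<in> U}"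
    then show "x \<in> snd c ` (U \<inter> fst c)"
      using chart_inv_in[of x c] chart_of_inv[of x c] by (metis (no_types, lifting) IntI imageI mem_Collect_eq topspace_euclidean_subtopology)
  qed (use chart_inv_of[OF assms] chart_in_image[of _ c] in auto)
  ultimately show "openin (top_of_set (chart_image c)) {x \<in> topspace (top_of_set (chart_image c)). chart_inv c x \<in> U}"
    using open_subset[of "snd c ` (U \<inter> fst c)" "chart_image c"] chart_in_image[of _ c] by auto
qed

lemma chart_inv_image_eq:
  assumes "c \<in> atlas M" "V \<subseteq> chart_image c"
  shows "chart_inv c ` V = {p \<in> fst c. snd c p \<in> V}"
proof (intro equalityI subsetI)
  fix p assume "p \<in> chart_inv c ` V"
  then obtain x where "x \<in> V" "p = chart_inv c x" by blast
  then show "p \<in> {p \<in> fst c. snd c p \<in> V}"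
    using assms(2) chart_inv_in[of x c] chart_of_inv[of x c] by auto
next
  fix p assume "p \<in> {p \<in> fst c. snd c p \<in> V}"
  then have "p = chart_inv c (snd c p)" "snd c p \<in> V"
    using chart_inv_of[OF assms(1)] by auto
  then show "p \<in> chart_inv c ` V" by (rule image_eqI)
qed

lemma openin_chart_inv_image:
  assumes "c \<in> atlas M" "open V" "V \<subseteq> chart_image c"
  shows "openin (mtop M) (chart_inv c ` V)"
proof -
  have "openin (top_of_set (chart_image c)) V"
    using assms by (simp add: open_chart_image openin_open_eq)
  then have "openin (subtopology (mtop M) (fst c)) {p \<in> fst c. snd c p \<in> V}"
    using openin_continuous_map_preimage[OF homeomorphic_imp_continuous_map[OF chart_homeo[OF assms(1)]]]
    unfolding topspace_chart[OF assms(1)] by blast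
  then show ?thesis
    using assms chart_inv_image_eq by (metis openin_open_subtopology openin_chart_domain)
qed

lemma closedin_chart_inv_compact:
  assumes "c \<in> atlas M" "compact K" "K \<subseteq> chart_image c"
  shows "closedin (mtop M) (chart_inv c ` K)"
proof -
  have "compactin (top_of_set (chart_image c)) K"
    using assms by (simp add: compactin_subtopology)
  then show ?thesis
    by (intro compactin_imp_closedin[OF Hausdorff]
        image_compactin[OF _ continuous_map_chart_inv[OF assms(1)]])
qed

lemma open_overlap:
  "c \<in> atlas M \<Longrightarrow> d \<in> atlas M \<Longrightarrow> open (snd c ` (fst c \<inter> fst d))"
  by (intro open_chart_of openin_Int openin_chart_domain) auto

lemma chart_at:
  assumes "p \<in> points M"
  shows "chart_at M p \<in> atlas M" "p \<in> fst (chart_at M p)"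
proof -
  have "\<exists>c. c \<in> atlas M \<and> p \<in> fst c"
    using smooth_manifold assms unfolding smooth_manifold_def by blast
  then have "chart_at M p \<in> atlas M \<and> p \<in> fst (chart_at M p)"
    unfolding chart_at_def by (rule someI_ex)
  then show "chart_at M p \<in> atlas M" "p \<in> fst (chart_at M p)" by auto
qed

section \<open>Transition maps and change of coordinates for tangent vectors\<close>

lemma transition_smooth:
  "c \<in> atlas M \<Longrightarrow> d \<in> atlas M \<Longrightarrow> smooth_on (snd c ` (fst c \<inter> fst d)) (snd d \<circ> chart_inv c)"
  using smooth_manifold by (simp add: smooth_manifold_def)

lemma tder_has_derivative:
  assumes "c \<in> atlas M" "d \<in> atlas M" "p \<in> fst c" "p \<in> fst d"
  shows "(snd d \<circ> chart_inv c has_derivative tder c d p) (at (snd c p))"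
  unfolding tder_def
  by (rule smooth_on_has_derivative[OF transition_smooth[OF assms(1,2)]]) (use assms in auto)

lemma tder_linear:
  assumes "c \<in> atlas M" "d \<in> atlas M" "p \<in> fst c" "p \<in> fst d"
  shows "linear (tder c d p)"
  using tder_has_derivative[OF assms] has_derivative_linear by blast

lemma has_derivative_in_chart:
  fixes f :: "'a \<Rightarrow> 'b::real_normed_vector"
  assumes "c \<in> atlas M" "d \<in> atlas M" "p \<in> fst c" "p \<in> fst d"
    and f: "((\<lambda>x. f (chart_inv d x)) has_derivative f') (at (snd d p))"
  shows "((\<lambda>x. f (chart_inv c x)) has_derivative (\<lambda>v. f' (tder c d p v))) (at (snd c p))"
proof -
  have "(snd d \<circ> chart_inv c) (snd c p) = snd d p"
    by (simp add: chart_inv_of assms)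
  then have "((\<lambda>x. f (chart_inv d ((snd d \<circ> chart_inv c) x))) has_derivative (\<lambda>v. f' (tder c d p v))) (at (snd c p))"
    using has_derivative_compose[OF tder_has_derivative[OF assms(1-4)]] f by simp
  then show ?thesis
    by (rule has_derivative_transform_within_open[OF _ open_overlap[OF assms(1,2)]])
       (use assms in \<open>auto simp: chart_inv_of\<close>)
qed

text \<open>\<open>e\<close> may be a chart of another manifold; in \<open>tincl_tvec\<close> it is
  a chart of the ambient one. This is why differentiability of the last map is an assumption rather
  than a consequence of \<open>e\<close> being in the atlas.\<close>

lemma tder_comp:
  assumes "c \<in> atlas M" "d \<in> atlas M" "p \<in> fst c" "p \<in> fst d"
    and e: "(snd e \<circ> chart_inv d) differentiable (at (snd d p))"
  shows "tder d e p (tder c d p v) = tder c e p v"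
proof -
  have "((\<lambda>x. snd e (chart_inv d x)) has_derivative tder d e p) (at (snd d p))"
    using e frechet_derivative_works unfolding tder_def o_def by blast
  from has_derivative_in_chart[OF assms(1-4) this]
  have "((snd e \<circ> chart_inv c) has_derivative (\<lambda>v. tder d e p (tder c d p v))) (at (snd c p))"
    by (simp add: o_def)
  then show ?thesis
    unfolding tder_def using frechet_derivative_at by metis
qed

lemma tder_trans:
  assumes "c \<in> atlas M" "d \<in> atlas M" "e \<in> atlas M" "p \<in> fst c" "p \<in> fst d" "p \<in> fst e"
  shows "tder d e p (tder c d p v) = tder c e p v"
  using tder_comp tder_has_derivative differentiable_def assms by metis

lemma tder_self:
  assumes "c \<in> atlas M" "p \<in> fst c"
  shows "tder c c p v = v"
proof -
  have "(snd c \<circ> chart_inv c has_derivative (\<lambda>v. v)) (at (snd c p))"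
    by (rule has_derivative_transform_within_open[OF has_derivative_ident open_chart_image[OF assms(1)]])
       (simp_all add: assms chart_in_image chart_of_inv)
  then show ?thesis
    unfolding tder_def using frechet_derivative_at by metis
qed

lemma tder_smooth:
  assumes "c \<in> atlas M" "d \<in> atlas M"
  shows "smooth_on (snd c ` (fst c \<inter> fst d)) (\<lambda>x. tder c d (chart_inv c x) v)"
  by (rule smooth_on_cong[OF open_overlap[OF assms] _ smooth_on_deriv[OF transition_smooth[OF assms], of v]])
     (use assms in \<open>auto simp: tder_def chart_inv_of\<close>)

lemma tvec_change:
  assumes "c \<in> atlas M" "d \<in> atlas M" "p \<in> fst c" "p \<in> fst d"
  shows "tvec M c p w = tvec M d p (tder c d p w)"
proof -
  have p: "p \<in> points M"
    using chart_domain_subset[OF assms(1)] assms by blast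
  show ?thesis
    unfolding tvec_tder using tder_trans[OF assms(1,2) chart_at(1)[OF p] assms(3,4) chart_at(2)[OF p]] by simp
qed

lemma coords_tvec:
  assumes "c \<in> atlas M" "d \<in> atlas M" "p \<in> fst c" "p \<in> fst d"
  shows "coords M d p (tvec M c p w) = tder c d p w"
proof -
  have p: "p \<in> points M"
    using chart_domain_subset[OF assms(1)] assms by blast
  show ?thesis
    unfolding coords_tder tvec_tder
  using tder_trans[OF assms(1) chart_at(1)[OF p] assms(2,3) chart_at(2)[OF p] assms(4)] .
qed

lemma tvec_coords:
  assumes "c \<in> atlas M" "p \<in> fst c"
  shows "tvec M c p (coords M c p v) = v"
proof -
  have p: "p \<in> points M"
    using chart_domain_subset[OF assms(1)] assms by blast
  show ?thesis
    unfolding coords_tder tvec_tder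
  using tder_trans[OF chart_at(1)[OF p] assms(1) chart_at(1)[OF p] chart_at(2)[OF p] assms(2) chart_at(2)[OF p]]
    tder_self[OF chart_at[OF p]] by simp
qed

lemma linear_tvec:
  assumes "c \<in> atlas M" "p \<in> fst c"
  shows "linear (tvec M c p)"
proof -
  have p: "p \<in> points M"
    using chart_domain_subset[OF assms(1)] assms by blast
  show ?thesis
    using tder_linear[OF assms(1) chart_at(1)[OF p] assms(2) chart_at(2)[OF p]]
    by (simp add: tvec_tder[abs_def] eta_contract_eq)
qed

lemma linear_coords:
  assumes "c \<in> atlas M" "p \<in> fst c"
  shows "linear (coords M c p)"
proof -
  have p: "p \<in> points M"
    using chart_domain_subset[OF assms(1)] assms by blast
  show ?thesis
    using tder_linear[OF chart_at(1)[OF p] assms(1) chart_at(2)[OF p] assms(2)]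
    by (simp add: coords_tder[abs_def] eta_contract_eq)
qed

lemma tvec_chart_at: "p \<in> points M \<Longrightarrow> tvec M (chart_at M p) p v = v"
  unfolding tvec_tder by (auto intro!: tder_self chart_at)

text \<open>Compact subsets of a Hausdorff space are closed, so data supported in a compact subset of a
  chart domain extend by zero.\<close>

lemma Ck_on_extend_zero:
  assumes "c \<in> atlas M" "d \<in> atlas M" "compact K" "K \<subseteq> chart_image c"
    and g: "Ck_on k (snd d ` (fst d \<inter> fst c)) g"
    and zero: "\<And>y. y \<in> chart_image d \<Longrightarrow> chart_inv d y \<notin> chart_inv c ` K \<Longrightarrow> g y = 0"
  shows "Ck_on k (chart_image d) g"
proof (rule Ck_on_local)
  fix x assume x: "x \<in> chart_image d"
  show "\<exists>U. open U \<and> x \<in> U \<and> Ck_on k U g"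
  proof (cases "chart_inv d x \<in> fst c")
    case True
    then have "x \<in> snd d ` (fst d \<inter> fst c)"
      using chart_inv_in[OF x] chart_of_inv[OF x] by (metis IntI imageI)
    then show ?thesis
      using g open_overlap[OF assms(2,1)] by blast
  next
    case False
    let ?V = "fst d - chart_inv c ` K"
    have "openin (mtop M) ?V"
      by (intro openin_diff openin_chart_domain closedin_chart_inv_compact assms)
    then have o: "open (snd d ` ?V)"
      by (intro open_chart_of assms) auto
    have "chart_inv d x \<notin> chart_inv c ` K"
      using False by (simp add: chart_inv_image_eq[OF assms(1,4)])
    then have "x \<in> snd d ` ?V"
      using chart_inv_in[OF x] chart_of_inv[OF x] by (metis DiffI imageI)
    moreover have "Ck_on k (snd d ` ?V) g"
      by (rule Ck_on_cong[OF o _ Ck_on_const[OF o, of _ 0]])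
         (use zero chart_inv_of[OF assms(2)] chart_in_image[of _ d] in force)
    ultimately show ?thesis
      using o by blast
  qed
qed

lemma smooth_on_extend_zero:
  assumes "c \<in> atlas M" "d \<in> atlas M" "compact K" "K \<subseteq> chart_image c"
    and "smooth_on (snd d ` (fst d \<inter> fst c)) g"
    and "\<And>y. y \<in> chart_image d \<Longrightarrow> chart_inv d y \<notin> chart_inv c ` K \<Longrightarrow> g y = 0"
  shows "smooth_on (chart_image d) g"
  using assms unfolding smooth_on_def by (auto intro!: Ck_on_extend_zero)

lemma chart_bump_exists:
  assumes "c \<in> atlas M" "p \<in> fst c"
  obtains b :: "'f \<Rightarrow> real" and K where "smooth_on UNIV b" "b (snd c p) = 1"
    "(b has_derivative (\<lambda>v. 0)) (at (snd c p))" "\<And>x. b x \<ge> 0"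
    "compact K" "K \<subseteq> chart_image c" "\<And>x. x \<notin> K \<Longrightarrow> b x = 0" "open {x. b x > 0}"
proof -
  obtain r where r: "r > 0" "cball (snd c p) r \<subseteq> chart_image c"
    using open_chart_image[OF assms(1)] chart_in_image[OF assms(2)] open_contains_cball by metis
  obtain b :: "'f \<Rightarrow> real" where b: "smooth_on UNIV b" "b (snd c p) = 1"
    "(b has_derivative (\<lambda>v. 0)) (at (snd c p))" "\<And>x. b x \<ge> 0"
    "\<And>x. x \<in> ball (snd c p) r \<Longrightarrow> b x > 0" "\<And>x. x \<notin> ball (snd c p) r \<Longrightarrow> b x = 0"
    using bump_function_exists[OF r(1)] by metis
  have "{x. b x > 0} = ball (snd c p) r"
    using b(5,6) by (metis (no_types, lifting) Collect_cong less_irrefl mem_Collect_eq Collect_mem_eq)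
  then have "open {x. b x > 0}" by simp
  moreover have "b x = 0" if "x \<notin> cball (snd c p) r" for x
    using that b(6)[of x] by auto
  ultimately show thesis
    using that[OF b(1-4) compact_cball r(2)] by blast
qed

lemma smooth_on_bump_chart:
  assumes "c \<in> atlas M" "d \<in> atlas M" "smooth_on UNIV b"
  shows "smooth_on (snd d ` (fst d \<inter> fst c)) (\<lambda>y. b (snd c (chart_inv d y)))"
  using smooth_on_compose[OF open_overlap[OF assms(2,1)] open_UNIV _ transition_smooth[OF assms(2,1)] assms(3)]
  by simp

text \<open>Connections act on globally smooth fields only. The coordinate fields of a chart
  therefore have to be cut off before a connection can be evaluated on them.\<close>

lemma vector_field_extension:
  assumes "c \<in> atlas M" "smooth_on UNIV b" "compact K" "K \<subseteq> chart_image c" "\<And>x. x \<notin> K \<Longrightarrow> b x = 0"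
  shows "(\<lambda>q. if q \<in> fst c then b (snd c q) *\<^sub>R tvec M c q v else 0) \<in> vector_fields M"
    (is "?X \<in> _")
  unfolding vector_fields_def
proof (intro CollectI ballI)
  fix d assume d: "d \<in> atlas M"
  let ?g = "\<lambda>x. coords M d (chart_inv d x) (?X (chart_inv d x))"
  let ?S = "snd d ` (fst d \<inter> fst c)"
  show "smooth_on (chart_image d) ?g"
  proof (rule smooth_on_extend_zero[OF assms(1) d assms(3,4)])
    have "smooth_on ?S (\<lambda>y. b (snd c (chart_inv d y)) *\<^sub>R coords M d (chart_inv d y) (tvec M c (chart_inv d y) v))"
    proof (intro smooth_on_scaleR smooth_on_bump_chart open_overlap assms d)
      have o: "open (snd c ` (fst c \<inter> fst d))"
        by (rule open_overlap[OF assms(1) d])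
      have "smooth_on ?S (\<lambda>y. tder c d (chart_inv c ((snd c \<circ> chart_inv d) y)) v)"
        using d by (intro smooth_on_compose[OF _ o _ _ tder_smooth] open_overlap transition_smooth assms)
            (auto simp: chart_inv_of)
      then show "smooth_on ?S (\<lambda>y. coords M d (chart_inv d y) (tvec M c (chart_inv d y) v))"
        by (rule smooth_on_cong[rotated 2])
           (use assms d in \<open>auto simp: chart_inv_of coords_tvec open_overlap\<close>)
    qed
    then show "smooth_on ?S ?g"
      by (rule smooth_on_cong[rotated 2])
         (use assms(1) d in \<open>auto simp: chart_inv_of linear_scale[OF linear_coords] open_overlap\<close>)
  next
    fix y assume y: "y \<in> chart_image d" "chart_inv d y \<notin> chart_inv c ` K"
    have "?X (chart_inv d y) = 0"
      using y(2) assms(5) by (auto simp: chart_inv_image_eq[OF assms(1,4)])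
    then show "?g y = 0"
      using linear_0[OF linear_coords[OF d chart_inv_in[OF y(1)]]] by simp
  qed
qed

end

section \<open>Symmetry of second derivatives and pullbacks of closed 2-forms\<close>

lemma has_real_derivative_along_line:
  fixes f :: "'e::real_normed_vector \<Rightarrow> real"
  assumes "(f has_derivative f') (at (y + t *\<^sub>R a))"
  shows "((\<lambda>t. f (y + t *\<^sub>R a)) has_real_derivative f' a) (at t)"
proof -
  have "((\<lambda>t. y + t *\<^sub>R a) has_derivative (\<lambda>h. h *\<^sub>R a)) (at t)"
    by (auto intro!: derivative_eq_intros)
  from has_derivative_compose[OF this assms]
  have "((\<lambda>t. f (y + t *\<^sub>R a)) has_derivative (\<lambda>h. f' (h *\<^sub>R a))) (at t)" .
  moreover have "f' (h *\<^sub>R a) = f' a * h" for h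
    using linear_scale[OF has_derivative_linear[OF assms]] by simp
  ultimately show ?thesis
    by (simp add: has_field_derivative_def)
qed

text \<open>The mean value theorem is applied once in each direction. The second difference on the
  left is symmetric in \<open>a\<close> and \<open>b\<close>, while the mixed derivative on the
  right is not visibly so; this mismatch is what gives the symmetry of second derivatives.\<close>

lemma second_difference:
  fixes f :: "'e::euclidean_space \<Rightarrow> real"
  assumes f: "smooth_on U f" and "s > 0"
    and U: "\<And>\<sigma> \<tau>. 0 \<le> \<sigma> \<Longrightarrow> \<sigma> \<le> s \<Longrightarrow> 0 \<le> \<tau> \<Longrightarrow> \<tau> \<le> s \<Longrightarrow> x + \<sigma> *\<^sub>R a + \<tau> *\<^sub>R b \<in> U"
  obtains \<sigma> \<tau> where "0 \<le> \<sigma>" "\<sigma> \<le> s" "0 \<le> \<tau>" "\<tau> \<le> s"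
    "f (x + s *\<^sub>R a + s *\<^sub>R b) - f (x + s *\<^sub>R a) - f (x + s *\<^sub>R b) + f x
      = s * s * frechet_derivative (\<lambda>y. frechet_derivative f (at y) a) (at (x + \<sigma> *\<^sub>R a + \<tau> *\<^sub>R b)) b"
proof -
  let ?D = "\<lambda>y. frechet_derivative f (at y) a"
  have d: "(f has_derivative frechet_derivative f (at y)) (at y)"
    "(?D has_derivative frechet_derivative ?D (at y)) (at y)" if "y \<in> U" for y
    using smooth_on_has_derivative that f smooth_on_deriv[OF f, of a] by blast+
  \<comment> \<open>\<open>G\<close> is the difference of \<open>f\<close> in direction
    \<open>b\<close>; the second difference of \<open>f\<close> is then the first difference
    \<open>G s - G 0\<close> in direction \<open>a\<close>.\<close>
  define G where "G = (\<lambda>u. f ((x + s *\<^sub>R b) + u *\<^sub>R a) - f (x + u *\<^sub>R a))"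
  have "(G has_real_derivative ?D ((x + s *\<^sub>R b) + u *\<^sub>R a) - ?D (x + u *\<^sub>R a)) (at u)"
    if "0 \<le> u" "u \<le> s" for u
    unfolding G_def
    using U[of u s] U[of u 0] that assms(2)
    by (intro DERIV_diff has_real_derivative_along_line d) (simp_all add: algebra_simps)
  from MVT2[OF \<open>s > 0\<close> this]
  obtain \<sigma> where \<sigma>: "0 < \<sigma>" "\<sigma> < s"
    "G s - G 0 = (s - 0) * (?D ((x + s *\<^sub>R b) + \<sigma> *\<^sub>R a) - ?D (x + \<sigma> *\<^sub>R a))"
    by blast
  have "((\<lambda>t. ?D ((x + \<sigma> *\<^sub>R a) + t *\<^sub>R b)) has_real_derivative
      frechet_derivative ?D (at ((x + \<sigma> *\<^sub>R a) + t *\<^sub>R b)) b) (at t)"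
    if "0 \<le> t" "t \<le> s" for t
    using U[of \<sigma> t] \<sigma> that by (intro has_real_derivative_along_line d) simp
  from MVT2[OF \<open>s > 0\<close> this]
  obtain \<tau> where \<tau>: "0 < \<tau>" "\<tau> < s"
    "?D ((x + \<sigma> *\<^sub>R a) + s *\<^sub>R b) - ?D ((x + \<sigma> *\<^sub>R a) + 0 *\<^sub>R b)
      = (s - 0) * frechet_derivative ?D (at ((x + \<sigma> *\<^sub>R a) + \<tau> *\<^sub>R b)) b"
    by blast
  have eqs: "(x + s *\<^sub>R b) + \<sigma> *\<^sub>R a = (x + \<sigma> *\<^sub>R a) + s *\<^sub>R b" "(x + s *\<^sub>R b) + s *\<^sub>R a = x + s *\<^sub>R a + s *\<^sub>R b"
    by simp_all
  have "f (x + s *\<^sub>R a + s *\<^sub>R b) - f (x + s *\<^sub>R a) - f (x + s *\<^sub>R b) + f x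
      = s * (s * frechet_derivative ?D (at (x + \<sigma> *\<^sub>R a + \<tau> *\<^sub>R b)) b)"
    using \<sigma>(3) \<tau>(3) unfolding G_def eqs by simp
  with \<sigma> \<tau> show thesis
    by (intro that[of \<sigma> \<tau>]) (auto simp: mult.assoc)
qed

lemma second_derivative_symmetric_real:
  fixes f :: "'e::euclidean_space \<Rightarrow> real"
  assumes f: "smooth_on U f" and "open U" "x \<in> U"
  shows "frechet_derivative (\<lambda>y. frechet_derivative f (at y) a) (at x) b
       = frechet_derivative (\<lambda>y. frechet_derivative f (at y) b) (at x) a"
proof (rule ccontr)
  define H where "H = (\<lambda>a b y. frechet_derivative (\<lambda>y. frechet_derivative f (at y) a) (at y) b)"
  assume "\<not> ?thesis"
  \<comment> \<open>Half the gap: the two mixed derivatives agree at suitable points near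
    \<open>x\<close>, and each stays within this distance of its value at \<open>x\<close>.\<close>
  then have e: "\<bar>H a b x - H b a x\<bar> / 2 > 0" (is "?e > 0")
    by (simp add: H_def)
  have "continuous_on U (H a b)" for a b
    unfolding H_def by (intro smooth_on_continuous_on smooth_on_deriv f)
  then have "isCont (H a b) x" for a b
    using assms continuous_on_eq_continuous_at by blast
  then have "\<exists>d>0. \<forall>y. dist y x < d \<longrightarrow> dist (H a b y) (H a b x) < ?e"
    "\<exists>d>0. \<forall>y. dist y x < d \<longrightarrow> dist (H b a y) (H b a x) < ?e"
    using e unfolding continuous_at_eps_delta by blast+
  then obtain d1 d2 where d12: "d1 > 0" "d2 > 0"
    "\<And>y. dist y x < d1 \<Longrightarrow> dist (H a b y) (H a b x) < ?e"
    "\<And>y. dist y x < d2 \<Longrightarrow> dist (H b a y) (H b a x) < ?e"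
    by blast
  obtain r where r: "r > 0" "ball x r \<subseteq> U"
    using assms open_contains_ball by blast
  define d where "d = min r (min d1 d2)"
  have d: "d > 0" using r d12 by (simp add: d_def)
  \<comment> \<open>With this side length the whole parallelogram spanned by \<open>s a\<close> and
    \<open>s b\<close> stays within \<open>d\<close> of \<open>x\<close>; the summand 1 covers
    \<open>a = b = 0\<close>.\<close>
  define s where "s = d / (norm a + norm b + 1)"
  have n: "norm a + norm b + 1 > 0"
    by (smt (verit) norm_ge_zero)
  then have s: "s > 0" using d by (simp add: s_def)
  have near: "dist (x + \<sigma> *\<^sub>R a + \<tau> *\<^sub>R b) x < d"
    if "0 \<le> \<sigma>" "\<sigma> \<le> s" "0 \<le> \<tau>" "\<tau> \<le> s" for \<sigma> \<tau>
  proof -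
    have "dist (x + \<sigma> *\<^sub>R a + \<tau> *\<^sub>R b) x = norm (\<sigma> *\<^sub>R a + \<tau> *\<^sub>R b)"
      by (simp add: dist_norm algebra_simps)
    also have "\<dots> \<le> \<sigma> * norm a + \<tau> * norm b"
      using norm_triangle_ineq[of "\<sigma> *\<^sub>R a" "\<tau> *\<^sub>R b"] that by simp
    also have "\<dots> \<le> s * norm a + s * norm b"
      using that by (intro add_mono mult_right_mono) auto
    also have "\<dots> < s * (norm a + norm b + 1)"
      using s by (simp add: algebra_simps)
    also have "\<dots> = d"
      using n by (simp add: s_def)
    finally show ?thesis .
  qed
  have U: "x + \<sigma> *\<^sub>R a + \<tau> *\<^sub>R b \<in> U"
    if "0 \<le> \<sigma>" "\<sigma> \<le> s" "0 \<le> \<tau>" "\<tau> \<le> s" for \<sigma> \<tau>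
    using near[OF that] r(2) by (auto simp: d_def dist_commute)
  obtain \<sigma> \<tau> where 1: "0 \<le> \<sigma>" "\<sigma> \<le> s" "0 \<le> \<tau>" "\<tau> \<le> s"
    "f (x + s *\<^sub>R a + s *\<^sub>R b) - f (x + s *\<^sub>R a) - f (x + s *\<^sub>R b) + f x
      = s * s * H a b (x + \<sigma> *\<^sub>R a + \<tau> *\<^sub>R b)"
    using second_difference[OF f s U] unfolding H_def by blast
  have U': "x + \<sigma> *\<^sub>R b + \<tau> *\<^sub>R a \<in> U"
    if "0 \<le> \<sigma>" "\<sigma> \<le> s" "0 \<le> \<tau>" "\<tau> \<le> s" for \<sigma> \<tau>
    using U[OF that(3,4,1,2)] by (simp add: algebra_simps)
  obtain \<sigma>' \<tau>' where 2: "0 \<le> \<sigma>'" "\<sigma>' \<le> s" "0 \<le> \<tau>'" "\<tau>' \<le> s"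
    "f (x + s *\<^sub>R b + s *\<^sub>R a) - f (x + s *\<^sub>R b) - f (x + s *\<^sub>R a) + f x
      = s * s * H b a (x + \<sigma>' *\<^sub>R b + \<tau>' *\<^sub>R a)"
    using second_difference[OF f s U'] unfolding H_def by blast
  have c1: "x + s *\<^sub>R b + s *\<^sub>R a = x + s *\<^sub>R a + s *\<^sub>R b"
    "x + \<sigma>' *\<^sub>R b + \<tau>' *\<^sub>R a = x + \<tau>' *\<^sub>R a + \<sigma>' *\<^sub>R b"
    by simp_all
  have "s * s * H a b (x + \<sigma> *\<^sub>R a + \<tau> *\<^sub>R b) = s * s * H b a (x + \<tau>' *\<^sub>R a + \<sigma>' *\<^sub>R b)"
    using 1(5) 2(5) unfolding c1 by linarith
  then have eq: "H a b (x + \<sigma> *\<^sub>R a + \<tau> *\<^sub>R b) = H b a (x + \<tau>' *\<^sub>R a + \<sigma>' *\<^sub>R b)"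
    using s by simp
  have "dist (H a b (x + \<sigma> *\<^sub>R a + \<tau> *\<^sub>R b)) (H a b x) < ?e"
    using near[OF 1(1-4)] by (intro d12) (simp add: d_def)
  moreover have "dist (H b a (x + \<tau>' *\<^sub>R a + \<sigma>' *\<^sub>R b)) (H b a x) < ?e"
    using near[OF 2(3,4,1,2)] by (intro d12) (simp add: d_def)
  ultimately show False
    unfolding eq dist_real_def by (smt (verit) field_sum_of_halves)
qed

lemma second_derivative_symmetric:
  fixes f :: "'e::euclidean_space \<Rightarrow> 'b::euclidean_space"
  assumes f: "smooth_on U f" and U: "open U" "x \<in> U"
  shows "frechet_derivative (\<lambda>y. frechet_derivative f (at y) a) (at x) b
       = frechet_derivative (\<lambda>y. frechet_derivative f (at y) b) (at x) a"
proof (rule euclidean_eqI)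
  fix i :: 'b assume "i \<in> Basis"
  have comp: "frechet_derivative (\<lambda>y. h y \<bullet> i) (at y) = (\<lambda>v. frechet_derivative h (at y) v \<bullet> i)"
    if "smooth_on U h" "y \<in> U" for h :: "'e \<Rightarrow> 'b" and y
    using frechet_derivative_at[OF has_derivative_inner_left[OF smooth_on_has_derivative[OF that]]]
    by simp
  have *: "frechet_derivative (\<lambda>y. frechet_derivative (\<lambda>y. f y \<bullet> i) (at y) a) (at x) b
      = frechet_derivative (\<lambda>y. frechet_derivative f (at y) a) (at x) b \<bullet> i" for a b
  proof -
    have "((\<lambda>y. frechet_derivative f (at y) a \<bullet> i) has_derivative
        (\<lambda>v. frechet_derivative (\<lambda>y. frechet_derivative f (at y) a) (at x) v \<bullet> i)) (at x)"
      by (rule has_derivative_inner_left[OF smooth_on_has_derivative[OF smooth_on_deriv[OF f] U(2)]])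
    then have "((\<lambda>y. frechet_derivative (\<lambda>y. f y \<bullet> i) (at y) a) has_derivative
        (\<lambda>v. frechet_derivative (\<lambda>y. frechet_derivative f (at y) a) (at x) v \<bullet> i)) (at x)"
      by (rule has_derivative_transform_within_open[OF _ U]) (simp add: comp[OF f])
    from frechet_derivative_at[OF this] show ?thesis by metis
  qed
  show "frechet_derivative (\<lambda>y. frechet_derivative f (at y) a) (at x) b \<bullet> i
      = frechet_derivative (\<lambda>y. frechet_derivative f (at y) b) (at x) a \<bullet> i"
    using second_derivative_symmetric_real[OF smooth_on_inner_const[OF U(1) f, of i] U] unfolding * .
qed

section \<open>Pullbacks of bilinear forms that vary with the point\<close>

lemma bilinear_basis_expansion:
  fixes P :: "'e::euclidean_space \<Rightarrow> 'e \<Rightarrow> real"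
  assumes "bilinear P"
  shows "P v w = (\<Sum>i\<in>Basis. \<Sum>j\<in>Basis. (v \<bullet> i) * (w \<bullet> j) * P i j)"
proof -
  have "P v w = (\<Sum>i\<in>Basis. (v \<bullet> i) *\<^sub>R P i w)"
    using assms by (intro linear_basis_expansion[of "\<lambda>v. P v w"]) (simp add: bilinear_def)
  also have "\<dots> = (\<Sum>i\<in>Basis. (v \<bullet> i) *\<^sub>R (\<Sum>j\<in>Basis. (w \<bullet> j) *\<^sub>R P i j))"
    using assms by (intro sum.cong refl arg_cong[where f = "(*\<^sub>R) _"] linear_basis_expansion)
      (simp add: bilinear_def)
  finally show ?thesis
    by (simp add: sum_distrib_left mult.assoc)
qed

text \<open>A product rule with three factors: base point, first argument, second argument. Since
  \<open>P\<close> is differentiated only for fixed arguments, both arguments are expanded in the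
  basis, which leaves ordinary products of real functions.\<close>

lemma has_derivative_bilinear_family:
  fixes P :: "'e::euclidean_space \<Rightarrow> 'e \<Rightarrow> 'e \<Rightarrow> real" and F f h :: "'f::real_normed_vector \<Rightarrow> 'e"
  assumes V: "open V" "F x \<in> V" and P: "\<And>y. y \<in> V \<Longrightarrow> bilinear (P y)"
    and D: "\<And>v w. ((\<lambda>y. P y v w) has_derivative (\<lambda>k. D k v w)) (at (F x))"
    and F: "(F has_derivative F') (at x)"
    and f: "(f has_derivative f') (at x)" and h: "(h has_derivative h') (at x)"
    and U: "open U" "x \<in> U" "F ` U \<subseteq> V"
  shows "((\<lambda>y. P (F y) (f y) (h y)) has_derivative
    (\<lambda>k. D (F' k) (f x) (h x) + P (F x) (f' k) (h x) + P (F x) (f x) (h' k))) (at x)"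
proof -
  \<comment> \<open>\<open>D k\<close> inherits bilinearity from the forms \<open>P y\<close> by
    uniqueness of the derivative of their basis expansion.\<close>
  have Dsum: "D k v w = (\<Sum>i\<in>Basis. \<Sum>j\<in>Basis. (v \<bullet> i) * (w \<bullet> j) * D k i j)" for k v w
  proof -
    have "((\<lambda>y. \<Sum>i\<in>Basis. \<Sum>j\<in>Basis. (v \<bullet> i) * (w \<bullet> j) * P y i j) has_derivative
        (\<lambda>k. \<Sum>i\<in>Basis. \<Sum>j\<in>Basis. (v \<bullet> i) * (w \<bullet> j) * D k i j)) (at (F x))"
      by (intro has_derivative_sum has_derivative_mult_right D)
    then have "((\<lambda>y. P y v w) has_derivative
        (\<lambda>k. \<Sum>i\<in>Basis. \<Sum>j\<in>Basis. (v \<bullet> i) * (w \<bullet> j) * D k i j)) (at (F x))"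
      by (rule has_derivative_transform_within_open[OF _ V])
         (rule bilinear_basis_expansion[OF P, symmetric])
    from has_derivative_unique[OF D this] show ?thesis by metis
  qed
  have DF: "((\<lambda>y. P (F y) i j) has_derivative (\<lambda>k. D (F' k) i j)) (at x)" for i j
    using has_derivative_compose[OF F D] .
  have trm: "((\<lambda>y. (f y \<bullet> i) * (h y \<bullet> j) * P (F y) i j) has_derivative
      (\<lambda>k. (f x \<bullet> i) * (h x \<bullet> j) * D (F' k) i j + (f' k \<bullet> i) * (h x \<bullet> j) * P (F x) i j
        + (f x \<bullet> i) * (h' k \<bullet> j) * P (F x) i j)) (at x)" for i j
    by (rule derivative_eq_intros DF f h refl)+ (simp add: algebra_simps fun_eq_iff)
  have "((\<lambda>y. \<Sum>i\<in>Basis. \<Sum>j\<in>Basis. (f y \<bullet> i) * (h y \<bullet> j) * P (F y) i j) has_derivative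
      (\<lambda>k. \<Sum>i\<in>Basis. \<Sum>j\<in>Basis. (f x \<bullet> i) * (h x \<bullet> j) * D (F' k) i j + (f' k \<bullet> i) * (h x \<bullet> j) * P (F x) i j
        + (f x \<bullet> i) * (h' k \<bullet> j) * P (F x) i j)) (at x)"
    by (intro has_derivative_sum trm)
  then have "((\<lambda>y. \<Sum>i\<in>Basis. \<Sum>j\<in>Basis. (f y \<bullet> i) * (h y \<bullet> j) * P (F y) i j) has_derivative
      (\<lambda>k. D (F' k) (f x) (h x) + P (F x) (f' k) (h x) + P (F x) (f x) (h' k))) (at x)"
    by (simp only: sum.distrib Dsum[of _ "f x" "h x", symmetric]
        bilinear_basis_expansion[OF P[OF V(2)], symmetric])
  then show ?thesis
    by (rule has_derivative_transform_within_open[OF _ U(1,2)])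
       (use U(3) in \<open>auto intro!: bilinear_basis_expansion[OF P, symmetric]\<close>)
qed

text \<open>This is the rule that the exterior derivative commutes with pullback, for closed 2-forms
  and in coordinates. The derivatives of \<open>P\<close> cancel by closedness, the second
  derivatives of \<open>F\<close> by their symmetry.\<close>

lemma pullback_closed:
  fixes P :: "'e::euclidean_space \<Rightarrow> 'e \<Rightarrow> 'e \<Rightarrow> real" and F :: "'f::euclidean_space \<Rightarrow> 'e"
  assumes V: "open V" and P: "\<And>y. y \<in> V \<Longrightarrow> bilinear (P y)" "\<And>u v. P (F x) u v = - P (F x) v u"
    and D: "\<And>v w. ((\<lambda>y. P y v w) has_derivative (\<lambda>k. D k v w)) (at (F x))"
    and closed: "\<And>u v w. D u v w - D v u w + D w u v = 0"
    and U: "open U" "x \<in> U" "F ` U \<subseteq> V" and F: "smooth_on U F"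
  defines "\<omega> \<equiv> \<lambda>y v w. P (F y) (frechet_derivative F (at y) v) (frechet_derivative F (at y) w)"
  shows "frechet_derivative (\<lambda>y. \<omega> y v w) (at x) u - frechet_derivative (\<lambda>y. \<omega> y u w) (at x) v
    + frechet_derivative (\<lambda>y. \<omega> y u v) (at x) w = 0"
proof -
  let ?F = "frechet_derivative F (at x)"
  define H where "H = (\<lambda>u v. frechet_derivative (\<lambda>y. frechet_derivative F (at y) v) (at x) u)"
  have H: "H u v = H v u" for u v
    unfolding H_def by (rule second_derivative_symmetric[OF F U(1,2)])
  have "((\<lambda>y. \<omega> y v w) has_derivative
      (\<lambda>k. D (?F k) (?F v) (?F w) + P (F x) (H k v) (?F w) + P (F x) (?F v) (H k w))) (at x)" for v w
    unfolding \<omega>_def H_def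
    by (rule has_derivative_bilinear_family[OF V _ P(1) D _ _ _ U])
       (use U in \<open>auto intro!: smooth_on_has_derivative[where S = U] F smooth_on_deriv\<close>)
  from frechet_derivative_at[OF this, symmetric]
  have "frechet_derivative (\<lambda>y. \<omega> y v w) (at x) u
      = D (?F u) (?F v) (?F w) + P (F x) (H u v) (?F w) + P (F x) (?F v) (H u w)" for u v w
    by simp
  \<comment> \<open>Six terms contain second derivatives of \<open>F\<close>. Two pairs cancel by
    symmetry of \<open>H\<close> alone; the pair involving \<open>H u w\<close> needs skewness of
    \<open>P (F x)\<close> as well.\<close>
  then show ?thesis
    using closed[of "?F u" "?F v" "?F w"] H[of u v] H[of u w] H[of v w]
      P(2)[of "?F v" "H u w"]
    by simp
qed

section \<open>The fundamental 2-form of a cosymplectic manifold\<close>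

locale almost_contact_metric = smooth_mfd N
  for N :: "('a, 'e::euclidean_space) manifold" and \<phi> :: "'a \<Rightarrow> 'e \<Rightarrow> 'e" and \<xi> :: "'a \<Rightarrow> 'e"
    and \<eta> :: "'a \<Rightarrow> 'e \<Rightarrow> real" and g :: "'a \<Rightarrow> 'e \<Rightarrow> 'e \<Rightarrow> real" +
  assumes almost_contact: "almost_contact_metric_manifold N \<phi> \<xi> \<eta> g"
begin

lemma metric:
  assumes "p \<in> points N"
  shows g_bilinear: "bilinear (g p)" and g_sym: "g p u v = g p v u" and g_pos: "v \<noteq> 0 \<Longrightarrow> g p v v > 0"
  using almost_contact assms unfolding almost_contact_metric_manifold_def riemannian_metric_def by auto

lemma structure_eqs:
  assumes "p \<in> points N"
  shows phi_linear: "linear (\<phi> p)" and eta_linear: "linear (\<eta> p)"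
    and phi_phi: "\<phi> p (\<phi> p v) = - v + \<eta> p v *\<^sub>R \<xi> p" and eta_xi: "\<eta> p (\<xi> p) = 1"
    and g_phi_phi: "g p (\<phi> p u) (\<phi> p v) = g p u v - \<eta> p u * \<eta> p v"
  using almost_contact assms unfolding almost_contact_metric_manifold_def by auto

section \<open>Algebra of an almost contact metric structure\<close>

lemma phi_xi:
  assumes p: "p \<in> points N"
  shows "\<phi> p (\<xi> p) = 0"
proof -
  have 0: "\<phi> p (\<phi> p (\<xi> p)) = 0"
    by (simp add: phi_phi[OF p] eta_xi[OF p])
  then have "\<phi> p (\<phi> p (\<phi> p (\<xi> p))) = 0"
    using linear_0[OF phi_linear[OF p]] by simp
  \<comment> \<open>Applying the formula for \<phi>^2 to \<phi> \<xi> makes \<phi> \<xi> a multiple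
    of \<xi>. A further application of \<phi> gives 0 as the same multiple of \<phi> \<xi>, so
    either the factor or \<phi> \<xi> vanishes, and both mean \<phi> \<xi> = 0.\<close>
  then have "- \<phi> p (\<xi> p) + \<eta> p (\<phi> p (\<xi> p)) *\<^sub>R \<xi> p = 0"
    using phi_phi[OF p, of "\<phi> p (\<xi> p)"] by metis
  then have 1: "\<phi> p (\<xi> p) = \<eta> p (\<phi> p (\<xi> p)) *\<^sub>R \<xi> p"
    by (simp only: add_eq_0_iff minus_minus)
  then have "\<phi> p (\<phi> p (\<xi> p)) = \<eta> p (\<phi> p (\<xi> p)) *\<^sub>R \<phi> p (\<xi> p)"
    using linear_scale[OF phi_linear[OF p]] by metis
  with 0 1 show ?thesis
    by (metis scaleR_eq_0_iff)
qed

text \<open>Evaluate \<phi>^3 in two ways, as \<phi> of \<phi>^2 v and as \<phi>^2 of \<phi> v. They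
  differ by a multiple of \<xi>, and \<xi> is nonzero because \<eta> takes the value 1 on
  it.\<close>

lemma eta_phi:
  assumes p: "p \<in> points N"
  shows "\<eta> p (\<phi> p v) = 0"
proof -
  have "\<phi> p (\<phi> p (\<phi> p v)) = - \<phi> p v"
    using phi_linear[OF p] phi_xi[OF p]
    by (simp add: phi_phi[OF p, of v] linear_diff linear_scale)
  then have "- \<phi> p v + \<eta> p (\<phi> p v) *\<^sub>R \<xi> p = - \<phi> p v"
    using phi_phi[OF p, of "\<phi> p v"] by metis
  then have "\<eta> p (\<phi> p v) *\<^sub>R \<xi> p = 0"
    by simp
  moreover have "\<xi> p \<noteq> 0"
    using eta_xi[OF p] linear_0[OF eta_linear[OF p]] by auto
  ultimately show ?thesis by simp
qed

text \<open>Compatibility moves one \<phi> onto each argument, and \<phi>^2 = - 1 up to a multiple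
  of \<xi>, which is orthogonal to the image of \<phi>. So the quantity equals its own
  negative.\<close>

lemma g_phi_self:
  assumes p: "p \<in> points N"
  shows "g p v (\<phi> p v) = 0"
proof -
  note b = g_bilinear[OF p]
  have "g p (\<phi> p v) (\<phi> p (\<xi> p)) = g p v (\<xi> p) - \<eta> p v"
    by (simp add: g_phi_phi[OF p] eta_xi[OF p])
  then have xi: "g p v (\<xi> p) = \<eta> p v" for v
    using phi_xi[OF p] eta_xi[OF p] bilinear_rzero[OF b] g_phi_phi[OF p, of v "\<xi> p"] by simp
  have "g p v (\<phi> p v) = g p (\<phi> p v) (\<phi> p (\<phi> p v))"
    by (simp add: g_phi_phi[OF p] eta_phi[OF p])
  also have "\<dots> = - g p v (\<phi> p v)"
    by (simp add: phi_phi[OF p, of v] bilinear_rsub[OF b] bilinear_rmul[OF b]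
        xi eta_phi[OF p] g_sym[OF p, of v])
  finally show ?thesis by simp
qed

lemma bilinear_g_phi:
  assumes "p \<in> points N"
  shows "bilinear (\<lambda>u v. g p u (\<phi> p v))"
  using g_bilinear[OF assms] phi_linear[OF assms] linear_compose[OF phi_linear[OF assms]]
  unfolding bilinear_def o_def by blast

lemma g_phi_skew:
  assumes p: "p \<in> points N"
  shows "g p u (\<phi> p v) = - g p v (\<phi> p u)"
proof -
  note b = bilinear_g_phi[OF p]
  have "g p (u + v) (\<phi> p (u + v)) = 0"
    by (rule g_phi_self[OF p])
  then show ?thesis
    using bilinear_ladd[OF b, of u v "u + v"] bilinear_radd[OF b, of _ u v] g_phi_self[OF p] by simp
qed

section \<open>The fundamental form in coordinates\<close>

definition fund_form :: "('a, 'e) chart \<Rightarrow> 'e \<Rightarrow> 'e \<Rightarrow> 'e \<Rightarrow> real" where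
  "fund_form c x v w = (let q = chart_inv c x in g q (tvec N c q v) (\<phi> q (tvec N c q w)))"

lemma bilinear_fund_form:
  assumes "c \<in> atlas N" "x \<in> chart_image c"
  shows "bilinear (fund_form c x)"
proof -
  have q: "chart_inv c x \<in> fst c"
    by (rule chart_inv_in[OF assms(2)])
  then have "chart_inv c x \<in> points N"
    using chart_domain_subset[OF assms(1)] by blast
  from bilinear_g_phi[OF this] linear_compose[OF linear_tvec[OF assms(1) q]]
  show ?thesis
    unfolding fund_form_def Let_def bilinear_def o_def by blast
qed

lemma phi_coords_smooth:
  "c \<in> atlas N \<Longrightarrow> smooth_on (chart_image c)
    (\<lambda>x. coords N c (chart_inv c x) (\<phi> (chart_inv c x) (tvec N c (chart_inv c x) v)))"
  using almost_contact unfolding almost_contact_metric_manifold_def Let_def by blast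

lemma metric_smooth:
  "c \<in> atlas N \<Longrightarrow> smooth_on (chart_image c)
    (\<lambda>x. g (chart_inv c x) (tvec N c (chart_inv c x) v) (tvec N c (chart_inv c x) w))"
  using almost_contact unfolding almost_contact_metric_manifold_def riemannian_metric_def Let_def
  by blast

text \<open>Smoothness of \<phi> and of \<open>g\<close> is given separately, on constant coordinate
  vectors. Expanding \<phi> of such a vector in the coordinate basis combines the two.\<close>

lemma fund_form_smooth:
  assumes c: "c \<in> atlas N"
  shows "smooth_on (chart_image c) (\<lambda>x. fund_form c x v w)"
proof -
  let ?t = "\<lambda>x. tvec N c (chart_inv c x)"
  let ?k = "\<lambda>x. coords N c (chart_inv c x) (\<phi> (chart_inv c x) (?t x w))"
  note o = open_chart_image[OF c]
  have "smooth_on (chart_image c) (\<lambda>x. \<Sum>i\<in>Basis. (?k x \<bullet> i) * g (chart_inv c x) (?t x v) (?t x i))"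
    by (intro smooth_on_sum smooth_on_mult o smooth_on_inner_const phi_coords_smooth metric_smooth c)
  then show ?thesis
  proof (rule smooth_on_cong[OF o, rotated])
    fix x assume x: "x \<in> chart_image c"
    let ?q = "chart_inv c x"
    note q = chart_inv_in[OF x]
    have p: "?q \<in> points N"
      using q chart_domain_subset[OF c] by blast
    have "linear (\<lambda>u. g ?q (?t x v) (?t x u))"
      using g_bilinear[OF p] linear_compose[OF linear_tvec[OF c q]] unfolding bilinear_def o_def by blast
    from linear_basis_expansion[OF this, of "?k x"]
    show "(\<Sum>i\<in>Basis. (?k x \<bullet> i) * g ?q (?t x v) (?t x i)) = fund_form c x v w"
      by (simp add: fund_form_def Let_def tvec_coords[OF c q])
  qed
qed

lemma phi_vector_field:
  assumes X: "X \<in> vector_fields N"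
  shows "(\<lambda>q. \<phi> q (X q)) \<in> vector_fields N"
  unfolding vector_fields_def
proof (intro CollectI ballI)
  fix c assume c: "c \<in> atlas N"
  let ?t = "\<lambda>x. tvec N c (chart_inv c x)" and ?X = "\<lambda>x. coords N c (chart_inv c x) (X (chart_inv c x))"
  note o = open_chart_image[OF c]
  have "smooth_on (chart_image c) ?X"
    using X c unfolding vector_fields_def by blast
  then have "smooth_on (chart_image c)
      (\<lambda>x. \<Sum>i\<in>Basis. (?X x \<bullet> i) *\<^sub>R coords N c (chart_inv c x) (\<phi> (chart_inv c x) (?t x i)))"
    by (intro smooth_on_sum smooth_on_scaleR o smooth_on_inner_const phi_coords_smooth c)
  then show "smooth_on (chart_image c) (\<lambda>x. coords N c (chart_inv c x) (\<phi> (chart_inv c x) (X (chart_inv c x))))"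
  proof (rule smooth_on_cong[OF o, rotated])
    fix x assume x: "x \<in> chart_image c"
    let ?q = "chart_inv c x"
    note q = chart_inv_in[OF x]
    have p: "?q \<in> points N"
      using q chart_domain_subset[OF c] by blast
    have "linear (coords N c ?q \<circ> (\<phi> ?q \<circ> ?t x))"
      by (intro linear_compose linear_tvec linear_coords phi_linear c q p)
    from linear_basis_expansion[OF this, of "?X x"]
    show "(\<Sum>i\<in>Basis. (?X x \<bullet> i) *\<^sub>R coords N c ?q (\<phi> ?q (?t x i))) = coords N c ?q (\<phi> ?q (X ?q))"
      by (simp add: tvec_coords[OF c q])
  qed
qed

text \<open>Differentiating \<open>g (X, \<phi> Y)\<close> along fields which are constant to first order at \<open>p\<close> in
  coordinates gives \<open>\<Phi> (\<nabla>\<^sub>u v, w) + \<Phi> (v, \<nabla>\<^sub>u w)\<close>; since \<open>\<nabla>\<^sub>u v\<close> is symmetric in \<open>u\<close> and \<open>v\<close>, the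
  alternating sum of these terms vanishes.\<close>

lemma fund_form_closed:
  assumes cos: "cosymplectic_manifold N \<phi> \<xi> \<eta> g" and p: "p \<in> points N"
  defines "c \<equiv> chart_at N p"
  defines "D \<equiv> \<lambda>u v w. frechet_derivative (\<lambda>x. fund_form c x v w) (at (snd c p)) u"
  shows "D u v w - D v u w + D w u v = 0"
proof -
  obtain nab where "levi_civita N g nab" and
    parallel: "\<forall>X\<in>vector_fields N. \<forall>Y\<in>vector_fields N. \<forall>p\<in>points N.
       nab X (\<lambda>q. \<phi> q (Y q)) p - \<phi> p (nab X Y p) = 0"
    using cos unfolding cosymplectic_manifold_def by blast
  then have torsion: "\<forall>X\<in>vector_fields N. \<forall>Y\<in>vector_fields N. \<forall>p\<in>points N.
        nab X Y p - nab Y X p = lie_bracket N X Y p"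
    and metr: "\<forall>X\<in>vector_fields N. \<forall>Y\<in>vector_fields N. \<forall>Z\<in>vector_fields N. \<forall>p\<in>points N.
        dir_deriv N (\<lambda>q. g q (Y q) (Z q)) p (X p)
          = g p (nab X Y p) (Z p) + g p (Y p) (nab X Z p)"
    unfolding levi_civita_def by blast+
  have c: "c \<in> atlas N" "p \<in> fst c"
    unfolding c_def by (rule chart_at[OF p])+
  note o = open_chart_image[OF c(1)] and xin = chart_in_image[OF c(2)]
  obtain b :: "'e \<Rightarrow> real" and K where b: "smooth_on UNIV b" "b (snd c p) = 1"
    "(b has_derivative (\<lambda>v. 0)) (at (snd c p))" "\<And>x. b x \<ge> 0"
    "compact K" "K \<subseteq> chart_image c" "\<And>x. x \<notin> K \<Longrightarrow> b x = 0" "open {x. b x > 0}"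
    using chart_bump_exists[OF c] by metis
  define X where "X = (\<lambda>v q. if q \<in> fst c then b (snd c q) *\<^sub>R tvec N c q v else 0)"
  have X: "X v \<in> vector_fields N" for v
    unfolding X_def by (rule vector_field_extension[OF c(1) b(1,5,6,7)])
  have Xp: "X v p = v" for v
    using tvec_chart_at[OF p] c b(2) by (simp add: X_def c_def)
  have rep: "((\<lambda>x. coords N c (chart_inv c x) (X v (chart_inv c x))) has_derivative (\<lambda>u. 0)) (at (snd c p))" for v
  proof -
    have "((\<lambda>x. b x *\<^sub>R v) has_derivative (\<lambda>u. 0)) (at (snd c p))"
      using has_derivative_scaleR_left[OF b(3)] by simp
    then show ?thesis
    proof (rule has_derivative_transform_within_open[OF _ o xin])
      fix x assume x: "x \<in> chart_image c"
      note q = chart_inv_in[OF x]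
      show "b x *\<^sub>R v = coords N c (chart_inv c x) (X v (chart_inv c x))"
        by (simp add: X_def q chart_of_inv[OF x] linear_scale[OF linear_coords[OF c(1) q]]
            coords_tvec[OF c(1,1) q q] tder_self[OF c(1) q])
    qed
  qed
  \<comment> \<open>Both fields have coordinates with zero derivative at \<open>p\<close>. Absence
    of torsion then makes \<Gamma> symmetric.\<close>
  have bracket: "lie_bracket N (X u) (X v) p = 0" for u v
    unfolding lie_bracket_def Let_def c_def[symmetric]
    by (simp add: frechet_derivative_at[OF rep, symmetric])
  define \<Gamma> where "\<Gamma> = (\<lambda>u v. nab (X u) (X v) p)"
  have \<Gamma>_sym: "\<Gamma> u v = \<Gamma> v u" for u v
    using torsion[rule_format, OF X[of u] X[of v] p] bracket by (simp add: \<Gamma>_def)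
  define \<Phi> where "\<Phi> = (\<lambda>u v. g p u (\<phi> p v))"
  have skew: "\<Phi> u v = - \<Phi> v u" for u v
    unfolding \<Phi>_def by (rule g_phi_skew[OF p])
  have D: "D u v w = \<Phi> (\<Gamma> u v) w + \<Phi> v (\<Gamma> u w)" for u v w
  proof -
    have "((\<lambda>x. fund_form c x v w) has_derivative frechet_derivative (\<lambda>x. fund_form c x v w) (at (snd c p))) (at (snd c p))"
      by (rule smooth_on_has_derivative[OF fund_form_smooth[OF c(1)] xin])
    \<comment> \<open>The square of the bump has value 1 and derivative 0 at \<open>p\<close>, so
      the cut-off fields yield the derivative of the uncut form.\<close>
    then have "((\<lambda>x. b x * b x * fund_form c x v w) has_derivative (\<lambda>u. D u v w)) (at (snd c p))"
      using b(2) by (auto intro!: derivative_eq_intros b(3) simp: D_def)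
    then have "(((\<lambda>q. g q (X v q) (\<phi> q (X w q))) \<circ> chart_inv c) has_derivative (\<lambda>u. D u v w)) (at (snd c p))"
    proof (rule has_derivative_transform_within_open[OF _ o xin])
      fix x assume x: "x \<in> chart_image c"
      note q = chart_inv_in[OF x]
      have pq: "chart_inv c x \<in> points N"
        using q chart_domain_subset[OF c(1)] by blast
      show "b x * b x * fund_form c x v w = ((\<lambda>q. g q (X v q) (\<phi> q (X w q))) \<circ> chart_inv c) x"
        by (simp add: X_def q chart_of_inv[OF x] fund_form_def Let_def linear_scale[OF phi_linear[OF pq]]
            bilinear_lmul[OF g_bilinear[OF pq]] bilinear_rmul[OF g_bilinear[OF pq]])
    qed
    from frechet_derivative_at[OF this]
    have "dir_deriv N (\<lambda>q. g q (X v q) (\<phi> q (X w q))) p (X u p) = D u v w"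
      unfolding dir_deriv_def c_def[symmetric] Xp by metis
    moreover have "nab (X u) (\<lambda>q. \<phi> q (X w q)) p = \<phi> p (\<Gamma> u w)"
      using parallel[rule_format, OF X[of u] X[of w] p] by (simp add: \<Gamma>_def)
    ultimately show ?thesis
      using metr[rule_format, OF X[of u] X[of v] phi_vector_field[OF X[of w]] p]
      by (simp add: Xp \<Phi>_def \<Gamma>_def)
  qed
  show ?thesis
    using \<Gamma>_sym[of u v] \<Gamma>_sym[of u w] \<Gamma>_sym[of v w] skew[of v "\<Gamma> w u"] skew[of u "\<Gamma> v w"]
    unfolding D by simp
qed

end

section \<open>Submanifolds and the slant form\<close>

text \<open>The Gram map \<open>L\<close>, sending \<open>z\<close> to the numbers
  \<open>h (\<iota> z) (\<iota> i)\<close>, is injective because \<open>h\<close> is positive, hence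
  surjective by dimension. A solution of the normal equations for \<open>v\<close> is the
  projection; positivity also gives the uniqueness demanded by \<open>THE\<close>.\<close>

lemma orth_proj_range:
  fixes h :: "'e::euclidean_space \<Rightarrow> 'e \<Rightarrow> real" and \<iota> :: "'f::euclidean_space \<Rightarrow> 'e"
  assumes h: "bilinear h" "\<And>u v. h u v = h v u" "\<And>v. v \<noteq> 0 \<Longrightarrow> h v v > 0"
    and \<iota>: "linear \<iota>" "inj \<iota>"
  shows "orth_proj h (range \<iota>) v \<in> range \<iota>"
    and "u \<in> range \<iota> \<Longrightarrow> h u (orth_proj h (range \<iota>) v) = h u v"
proof -
  define L where "L = (\<lambda>z. \<Sum>i\<in>Basis. h (\<iota> z) (\<iota> i) *\<^sub>R i :: 'f)"
  have hl: "linear (\<lambda>u. h u v)" "linear (h u)" for u v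
    using h(1) by (auto simp: bilinear_def)
  have h\<iota>: "linear (\<lambda>z. h (\<iota> z) w)" "linear (\<lambda>z. h w (\<iota> z))" for w
    using linear_compose[OF \<iota>(1) hl(1)] linear_compose[OF \<iota>(1) hl(2)] by (simp_all add: o_def)
  have "linear L"
    unfolding L_def
    by (rule linearI) (simp_all add: linear_add[OF h\<iota>(1)] linear_scale[OF h\<iota>(1)] scaleR_left.add
        algebra_simps sum.distrib scaleR_sum_right)
  moreover have "inj L"
  proof (subst linear_injective_0[OF \<open>linear L\<close>], intro allI impI)
    fix z assume "L z = 0"
    have "h (\<iota> z) (\<iota> i) = 0" if "i \<in> Basis" for i
    proof -
      have "L z \<bullet> i = h (\<iota> z) (\<iota> i)"
        using that unfolding L_def by (rule inner_sum_left_Basis)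
      then show ?thesis using \<open>L z = 0\<close> by simp
    qed
    then have "h (\<iota> z) (\<iota> z) = 0"
      using linear_basis_expansion[OF h\<iota>(2), of "\<iota> z" z] by simp
    then have "\<iota> z = 0" using h(3) by force
    then show "z = 0" using linear_injective_0[OF \<iota>(1)] \<iota>(2) by blast
  qed
  ultimately have "surj L"
    by (rule eucl.linear_inj_imp_surj)
  then obtain z where z: "L z = (\<Sum>i\<in>Basis. h v (\<iota> i) *\<^sub>R i)"
    by (metis surjE)
  have "h (v - \<iota> z) (\<iota> y) = 0" for y
  proof -
    have "h (\<iota> z) (\<iota> i) = h v (\<iota> i)" if "i \<in> Basis" for i
      using arg_cong[OF z, of "\<lambda>x. x \<bullet> i"] that unfolding L_def by (simp add: inner_sum_left_Basis)
    then have "h (v - \<iota> z) (\<iota> i) = 0" if "i \<in> Basis" for i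
      using that linear_diff[OF hl(1)] by simp
    then show ?thesis
      using linear_basis_expansion[OF h\<iota>(2), of "v - \<iota> z" y] by simp
  qed
  then have ex: "\<iota> z \<in> range \<iota> \<and> (\<forall>u\<in>range \<iota>. h (v - \<iota> z) u = 0)"
    by blast
  have uniq: "w = \<iota> z" if w: "w \<in> range \<iota> \<and> (\<forall>u\<in>range \<iota>. h (v - w) u = 0)" for w
  proof (rule ccontr)
    assume "w \<noteq> \<iota> z"
    obtain y where y: "w = \<iota> y" using w by blast
    have r: "w - \<iota> z \<in> range \<iota>"
      unfolding y linear_diff[OF \<iota>(1), symmetric] by blast
    have "h (w - \<iota> z) (w - \<iota> z) = h (v - \<iota> z) (w - \<iota> z) - h (v - w) (w - \<iota> z)"
      by (simp add: linear_diff[OF hl(1), symmetric])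
    moreover have "h (v - \<iota> z) (w - \<iota> z) = 0" "h (v - w) (w - \<iota> z) = 0"
      using ex w r by blast+
    ultimately show False using h(3)[of "w - \<iota> z"] \<open>w \<noteq> \<iota> z\<close> by simp
  qed
  have "orth_proj h (range \<iota>) v = \<iota> z"
    unfolding orth_proj_def by (rule the_equality) (rule ex, rule uniq)
  then show "orth_proj h (range \<iota>) v \<in> range \<iota>"
    and "u \<in> range \<iota> \<Longrightarrow> h u (orth_proj h (range \<iota>) v) = h u v"
    using ex linear_diff[OF hl(1), of v "\<iota> z" u] h(2)[of u] by auto
qed

section \<open>The inclusion of a submanifold in charts\<close>

locale submfd = smooth_mfd M + N: smooth_mfd N
  for M :: "('a, 'f::euclidean_space) manifold" and N :: "('a, 'e::euclidean_space) manifold" +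
  assumes submanifold: "submanifold M N"
begin

lemma points_subset: "points M \<subseteq> points N"
  and incl_continuous: "continuous_map (mtop M) (mtop N) (\<lambda>p. p)"
  and inj_tincl: "p \<in> points M \<Longrightarrow> inj (tincl M N p)"
  using submanifold unfolding submanifold_def smooth_map_def by auto

text \<open>Continuity of the inclusion makes ambient chart domains open in \<open>M\<close>, even
  where the topology of \<open>M\<close> is finer than the subspace topology.\<close>

lemma open_mixed_overlap:
  assumes "c \<in> atlas M" "d \<in> atlas N"
  shows "open (snd c ` (fst c \<inter> fst d))"
proof -
  have "openin (mtop M) (fst c \<inter> {p \<in> points M. p \<in> fst d})"
    by (intro openin_Int openin_chart_domain assms
        openin_continuous_map_preimage[OF incl_continuous] N.openin_chart_domain)
  moreover have "fst c \<inter> {p \<in> points M. p \<in> fst d} = fst c \<inter> fst d"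
    using chart_domain_subset[OF assms(1)] by blast
  ultimately show ?thesis
    using open_chart_of[OF assms(1)] by simp
qed

lemma incl_smooth:
  assumes "c \<in> atlas M" "d \<in> atlas N"
  shows "smooth_on (snd c ` (fst c \<inter> fst d)) (snd d \<circ> chart_inv c)"
proof -
  have "smooth_on (snd c ` (fst c \<inter> (\<lambda>p. p) -` fst d)) (snd d \<circ> (\<lambda>p. p) \<circ> chart_inv c)"
    using submanifold assms unfolding submanifold_def smooth_map_def by blast
  then show ?thesis by (simp add: o_def)
qed

lemma incl_has_derivative:
  assumes "c \<in> atlas M" "d \<in> atlas N" "p \<in> fst c" "p \<in> fst d"
  shows "(snd d \<circ> chart_inv c has_derivative tder c d p) (at (snd c p))"
  unfolding tder_def
  by (rule smooth_on_has_derivative[OF incl_smooth[OF assms(1,2)]]) (use assms in auto)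

lemma tincl_tder: "tincl M N p v = tder (chart_at M p) (chart_at N p) p v"
  by (simp add: tangent_map_def tder_def o_def)

lemma linear_tincl:
  assumes "p \<in> points M"
  shows "linear (tincl M N p)"
proof -
  have "p \<in> points N" using assms points_subset by blast
  then show ?thesis
    using has_derivative_linear[OF incl_has_derivative] chart_at[OF assms] N.chart_at
    by (simp add: tincl_tder[abs_def] eta_contract_eq)
qed

text \<open>\<open>tincl\<close> is defined through the preferred charts. By the chain rule both
  sides are the derivative of the inclusion read from \<open>c\<close> to the preferred ambient
  chart, so arbitrary charts may be used from here on.\<close>

lemma tincl_tvec:
  assumes c: "c \<in> atlas M" and d: "d \<in> atlas N" and p: "p \<in> fst c" "p \<in> fst d"
  shows "tincl M N p (tvec M c p w) = tvec N d p (tder c d p w)"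
proof -
  have pM: "p \<in> points M" and pN: "p \<in> points N"
    using p chart_domain_subset[OF c] N.chart_domain_subset[OF d] by blast+
  define e where "e = chart_at N p"
  have e: "e \<in> atlas N" "p \<in> fst e"
    unfolding e_def by (rule N.chart_at[OF pN])+
  have "tincl M N p (tvec M c p w) = tder c e p w"
    unfolding tincl_tder tvec_tder e_def[symmetric]
    by (rule tder_comp[OF c chart_at(1)[OF pM] p(1) chart_at(2)[OF pM]])
       (use incl_has_derivative[OF chart_at(1)[OF pM] e(1) chart_at(2)[OF pM] e(2)]
         in \<open>auto simp: differentiable_def\<close>)
  moreover have "tvec N d p (tder c d p w) = tder c e p w"
  proof -
    have "(snd d \<circ> chart_inv c) (snd c p) = snd d p"
      by (simp add: chart_inv_of[OF c p(1)])
    then have "(snd e \<circ> chart_inv d has_derivative tder d e p) (at ((snd d \<circ> chart_inv c) (snd c p)))"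
      using N.tder_has_derivative[OF d e(1) p(2) e(2)] by simp
    from has_derivative_compose[OF incl_has_derivative[OF c d p] this]
    have "(snd e \<circ> chart_inv c has_derivative (\<lambda>w. tder d e p (tder c d p w))) (at (snd c p))"
      by (rule has_derivative_transform_within_open[OF _ open_mixed_overlap[OF c d]])
         (use p in \<open>auto simp: chart_inv_of[OF c] N.chart_inv_of[OF d]\<close>)
    from frechet_derivative_at[OF this] show ?thesis
      unfolding tvec_tder e_def[symmetric] tder_def[of c e] by metis
  qed
  ultimately show ?thesis by simp
qed

end

section \<open>The slant form as a pullback of the fundamental form\<close>

locale contact_submfd = submfd M N + N: almost_contact_metric N \<phi> \<xi> \<eta> g
  for M :: "('a, 'f::euclidean_space) manifold" and N :: "('a, 'e::euclidean_space) manifold"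
    and \<phi> :: "'a \<Rightarrow> 'e \<Rightarrow> 'e" and \<xi> :: "'a \<Rightarrow> 'e" and \<eta> :: "'a \<Rightarrow> 'e \<Rightarrow> real"
    and g :: "'a \<Rightarrow> 'e \<Rightarrow> 'e \<Rightarrow> real"
begin

lemma tan_part_props:
  assumes p: "p \<in> points M"
  shows tan_part_in: "tan_part M N \<phi> g p u \<in> range (tincl M N p)"
    and g_tan_part: "g p (tincl M N p v) (tan_part M N \<phi> g p u) = g p (tincl M N p v) (\<phi> p u)"
proof -
  have pN: "p \<in> points N" using p points_subset by blast
  note * = orth_proj_range[OF N.g_bilinear[OF pN] N.g_sym[OF pN] N.g_pos[OF pN]
      linear_tincl[OF p] inj_tincl[OF p]]
  show "tan_part M N \<phi> g p u \<in> range (tincl M N p)"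
    and "g p (tincl M N p v) (tan_part M N \<phi> g p u) = g p (tincl M N p v) (\<phi> p u)"
    unfolding tan_part_def tangent_space_def by (auto intro!: *)
qed

text \<open>The normal part of \<phi> is orthogonal to tangent vectors. So the projection drops out,
  and smoothness of the form does not require studying how the projection varies with the
  point.\<close>

lemma slant_form_eq:
  assumes p: "p \<in> points M"
  shows "slant_form M N \<phi> g p [u, v] = g p (tincl M N p u) (\<phi> p (tincl M N p v))"
  using p by (simp add: slant_form_def g_tan_part)

lemma chart_slant_form:
  assumes c: "c \<in> atlas M" and d: "d \<in> atlas N" and x: "x \<in> snd c ` (fst c \<inter> fst d)"
  defines "F \<equiv> snd d \<circ> chart_inv c"
  shows "chart_form M c (slant_form M N \<phi> g) x [v, w]
    = N.fund_form d (F x) (frechet_derivative F (at x) v) (frechet_derivative F (at x) w)"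
proof -
  obtain q where q: "q \<in> fst c" "q \<in> fst d" "x = snd c q"
    using x by blast
  have "q \<in> points M" using q chart_domain_subset[OF c] by blast
  then show ?thesis
    unfolding chart_form_def F_def
    by (simp add: q(3) chart_inv_of[OF c q(1)] slant_form_eq tincl_tvec[OF c d q(1,2)]
        N.fund_form_def Let_def N.chart_inv_of[OF d q(2)] tder_def)
qed

lemma slant_form_smooth:
  assumes c: "c \<in> atlas M"
  shows "smooth_on (chart_image c) (\<lambda>x. chart_form M c (slant_form M N \<phi> g) x [v, w])"
proof (rule smooth_on_local)
  fix x assume x: "x \<in> chart_image c"
  note q = chart_inv_in[OF x]
  then have qN: "chart_inv c x \<in> points N"
    using chart_domain_subset[OF c] points_subset by blast
  \<comment> \<open>The domain of \<open>c\<close> need not fit into a single chart of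
    \<open>N\<close>, so smoothness is shown near each point separately.\<close>
  define d where "d = chart_at N (chart_inv c x)"
  have d: "d \<in> atlas N" "chart_inv c x \<in> fst d"
    unfolding d_def by (rule N.chart_at[OF qN])+
  let ?U = "snd c ` (fst c \<inter> fst d)"
  let ?F = "snd d \<circ> chart_inv c"
  let ?DF = "\<lambda>v x. frechet_derivative ?F (at x) v"
  note o = open_mixed_overlap[OF c d(1)] and F = incl_smooth[OF c d(1)]
  have im: "?F ` ?U \<subseteq> chart_image d"
    using chart_inv_of[OF c] by (auto intro: chart_in_image)
  have "smooth_on ?U (\<lambda>x. \<Sum>i\<in>Basis. \<Sum>j\<in>Basis. (?DF v x \<bullet> i) * (?DF w x \<bullet> j) * N.fund_form d (?F x) i j)"
    by (intro smooth_on_sum smooth_on_mult smooth_on_inner_const smooth_on_deriv o F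
        smooth_on_compose[OF o N.open_chart_image[OF d(1)] im F N.fund_form_smooth[OF d(1)]])
  then have "smooth_on ?U (\<lambda>x. chart_form M c (slant_form M N \<phi> g) x [v, w])"
  proof (rule smooth_on_cong[OF o, rotated])
    fix x assume x: "x \<in> ?U"
    have "?F x \<in> chart_image d" using im x by blast
    from bilinear_basis_expansion[OF N.bilinear_fund_form[OF d(1) this]]
    show "(\<Sum>i\<in>Basis. \<Sum>j\<in>Basis. (?DF v x \<bullet> i) * (?DF w x \<bullet> j) * N.fund_form d (?F x) i j)
        = chart_form M c (slant_form M N \<phi> g) x [v, w]"
      unfolding chart_slant_form[OF c d(1) x] by metis
  qed
  moreover have "x \<in> ?U"
    using q d(2) chart_of_inv[OF x] by (metis IntI imageI)
  ultimately show "\<exists>U. open U \<and> x \<in> U \<and> smooth_on U (\<lambda>x. chart_form M c (slant_form M N \<phi> g) x [v, w])"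
    using o by blast
qed

lemma slant_form_closed:
  assumes cos: "cosymplectic_manifold N \<phi> \<xi> \<eta> g" and c: "c \<in> atlas M" and x: "x \<in> chart_image c"
  defines "\<omega> \<equiv> \<lambda>y v w. chart_form M c (slant_form M N \<phi> g) y [v, w]"
  shows "frechet_derivative (\<lambda>y. \<omega> y v w) (at x) u - frechet_derivative (\<lambda>y. \<omega> y u w) (at x) v
    + frechet_derivative (\<lambda>y. \<omega> y u v) (at x) w = 0"
proof -
  note q = chart_inv_in[OF x]
  then have qN: "chart_inv c x \<in> points N"
    using chart_domain_subset[OF c] points_subset by blast
  \<comment> \<open>\<open>N.fund_form_closed\<close> speaks of the preferred chart at the point
    under consideration, which dictates this choice of \<open>d\<close>.\<close>
  define d where "d = chart_at N (chart_inv c x)"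
  have d: "d \<in> atlas N" "chart_inv c x \<in> fst d"
    unfolding d_def by (rule N.chart_at[OF qN])+
  let ?U = "snd c ` (fst c \<inter> fst d)"
  let ?F = "snd d \<circ> chart_inv c"
  note o = open_mixed_overlap[OF c d(1)] and F = incl_smooth[OF c d(1)]
  have im: "?F ` ?U \<subseteq> chart_image d"
    using chart_inv_of[OF c] by (auto intro: chart_in_image)
  have xU: "x \<in> ?U"
    using q d(2) chart_of_inv[OF x] by (metis IntI imageI)
  have skew: "N.fund_form d (?F x) u v = - N.fund_form d (?F x) v u" for u v
    unfolding N.fund_form_def Let_def o_def
    by (rule N.g_phi_skew) (simp add: N.chart_inv_of[OF d] qN)
  have D: "((\<lambda>y. N.fund_form d y v w) has_derivative
      (\<lambda>k. frechet_derivative (\<lambda>y. N.fund_form d y v w) (at (?F x)) k)) (at (?F x))" for v w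
    using smooth_on_has_derivative[OF N.fund_form_smooth[OF d(1)], of "?F x"] im xU by blast
  have closed: "frechet_derivative (\<lambda>y. N.fund_form d y v w) (at (?F x)) u
      - frechet_derivative (\<lambda>y. N.fund_form d y u w) (at (?F x)) v
      + frechet_derivative (\<lambda>y. N.fund_form d y u v) (at (?F x)) w = 0" for u v w
    using N.fund_form_closed[OF cos qN, of v w u] unfolding d_def o_def .
  have eq: "frechet_derivative (\<lambda>y. \<omega> y v w) (at x) = frechet_derivative (\<lambda>y. N.fund_form d (?F y)
      (frechet_derivative ?F (at y) v) (frechet_derivative ?F (at y) w)) (at x)" for v w
  proof -
    have "((\<lambda>y. \<omega> y v w) has_derivative frechet_derivative (\<lambda>y. \<omega> y v w) (at x)) (at x)"
      unfolding \<omega>_def by (rule smooth_on_has_derivative[OF slant_form_smooth[OF c] x])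
    then have "((\<lambda>y. N.fund_form d (?F y) (frechet_derivative ?F (at y) v) (frechet_derivative ?F (at y) w))
        has_derivative frechet_derivative (\<lambda>y. \<omega> y v w) (at x)) (at x)"
      by (rule has_derivative_transform_within_open[OF _ o xU])
         (simp add: \<omega>_def chart_slant_form[OF c d(1)])
    then show ?thesis by (rule frechet_derivative_at)
  qed
  show ?thesis
    unfolding eq
    by (rule pullback_closed[OF N.open_chart_image[OF d(1)] N.bilinear_fund_form[OF d(1)] skew D closed
          o xU im F])
qed

lemma slant_form_in_closed_forms:
  assumes cos: "cosymplectic_manifold N \<phi> \<xi> \<eta> g"
  shows "slant_form M N \<phi> g \<in> closed_forms M 2"
proof -
  have len2: "\<exists>a b. vs = [a, b]" if "length vs = 2" for vs :: "'f list"
    using that by (auto simp: length_Suc_conv numeral_2_eq_2)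
  have len3: "\<exists>a b c. vs = [a, b, c]" if "length vs = Suc 2" for vs :: "'f list"
    using that by (auto simp: length_Suc_conv numeral_2_eq_2)
  have less2: "i = 0 \<or> i = Suc 0" if "i < 2" for i :: nat
    using that by auto
  have "slant_form M N \<phi> g \<in> diff_forms M 2"
    unfolding diff_forms_def
  proof (intro CollectI conjI ballI allI impI)
    fix p and vs :: "'f list"
    assume "p \<notin> points M \<or> length vs \<noteq> 2"
    then show "slant_form M N \<phi> g p vs = 0" by (auto simp: slant_form_def)
  next
    fix p and vs :: "'f list" and i :: nat
    assume p: "p \<in> points M" and "length vs = 2" "i < 2"
    obtain a b where vs: "vs = [a, b]" using len2[OF \<open>length vs = 2\<close>] by blast
    have pN: "p \<in> points N" using p points_subset by blast
    have "linear (\<lambda>v. g p (tincl M N p v) (\<phi> p (tincl M N p b)))"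
      "linear (\<lambda>v. g p (tincl M N p a) (\<phi> p (tincl M N p v)))"
      using N.bilinear_g_phi[OF pN] linear_compose[OF linear_tincl[OF p]]
      unfolding bilinear_def o_def by blast+
    then show "linear (\<lambda>v. slant_form M N \<phi> g p (vs[i := v]))"
      using less2[OF \<open>i < 2\<close>] by (auto simp: vs slant_form_eq[OF p])
  next
    fix p and vs :: "'f list" and i j :: nat
    assume p: "p \<in> points M" and "length vs = 2" "i < 2" "j < 2" "i \<noteq> j \<and> vs ! i = vs ! j"
    obtain a b where vs: "vs = [a, b]" using len2[OF \<open>length vs = 2\<close>] by blast
    have pN: "p \<in> points N" using p points_subset by blast
    have "a = b"
      using less2[OF \<open>i < 2\<close>] less2[OF \<open>j < 2\<close>] \<open>i \<noteq> j \<and> vs ! i = vs ! j\<close> by (auto simp: vs)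
    then show "slant_form M N \<phi> g p vs = 0"
      by (simp add: vs slant_form_eq[OF p] N.g_phi_self[OF pN])
  next
    fix c and ws :: "'f list"
    assume c: "c \<in> atlas M" and "length ws = 2"
    then show "smooth_on (chart_image c) (\<lambda>x. chart_form M c (slant_form M N \<phi> g) x ws)"
      using len2 slant_form_smooth[OF c] by blast
  qed
  moreover have "is_ext_deriv M 2 (slant_form M N \<phi> g) zero_form"
    unfolding is_ext_deriv_def
  proof (intro ballI allI impI)
    fix c x and ws :: "'f list"
    assume c: "c \<in> atlas M" and x: "x \<in> chart_image c" and "length ws = Suc 2"
    then obtain u v w where ws: "ws = [u, v, w]" using len3 by blast
    show "chart_form M c zero_form x ws = (\<Sum>i\<le>2. (- 1) ^ i *
        frechet_derivative (\<lambda>y. chart_form M c (slant_form M N \<phi> g) y (take i ws @ drop (Suc i) ws)) (at x) (ws ! i))"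
      using slant_form_closed[OF cos c x, of v w u]
      by (simp add: ws chart_form_def[of _ _ zero_form] numeral_2_eq_2)
  qed
  ultimately show ?thesis by (simp add: closed_forms_def)
qed

text \<open>As \<xi> is normal, the space M_p is the full tangent space, so \<theta> measures the
  angle between \<phi> u and T u. With T u nonzero, the witness \<open>z\<close> is the vector whose
  inclusion is T u, and the form takes the value g(T u, T u).\<close>

lemma slant_form_nondegenerate:
  assumes slant: "proper_pointwise_slant_submanifold M N \<phi> \<xi> g" and normal: "normal_to M N g \<xi>"
    and p: "p \<in> points M" and u: "u \<noteq> 0"
  obtains z where "slant_form M N \<phi> g p [z, u] > 0"
proof -
  have pN: "p \<in> points N" using p points_subset by blast
  obtain \<theta> where \<theta>: "is_slant_function M N \<phi> \<xi> g \<theta>" "\<theta> p < pi / 2"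
    using slant p unfolding proper_pointwise_slant_submanifold_def by blast
  have sp: "xi_orth_space M N g \<xi> p = tangent_space M N p"
    using normal p unfolding xi_orth_space_def normal_to_def by blast
  let ?u = "tincl M N p u" and ?w = "tan_part M N \<phi> g p (tincl M N p u)"
  have "?u \<noteq> 0"
    using u inj_tincl[OF p] linear_injective_0[OF linear_tincl[OF p]] by blast
  moreover have "?u \<in> tangent_space M N p"
    by (simp add: tangent_space_def)
  ultimately have "angle_to_subspace (g p) (\<phi> p ?u) (tangent_space M N p) = \<theta> p"
    using \<theta>(1)[unfolded is_slant_function_def, rule_format, OF p, of ?u] by (simp add: sp)
  then have "arccos (sqrt (g p ?w ?w) / sqrt (g p (\<phi> p ?u) (\<phi> p ?u))) < pi / 2"
    using \<theta>(2) unfolding angle_to_subspace_def Let_def tan_part_def by simp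
  \<comment> \<open>If T u were 0, the quotient would be 0 and its \<open>arccos\<close> equal to
    \<open>pi / 2\<close>.\<close>
  then have "?w \<noteq> 0"
    using bilinear_lzero[OF N.g_bilinear[OF pN]] by auto
  then have "g p ?w ?w > 0" by (rule N.g_pos[OF pN])
  moreover obtain z where z: "?w = tincl M N p z"
    using tan_part_in[OF p] by blast
  ultimately have "slant_form M N \<phi> g p [z, u] > 0"
    using p by (simp add: slant_form_def)
  then show thesis by (rule that)
qed

end

section \<open>Integrals of compactly supported functions\<close>

lemma Ck_on_extend_zero_UNIV:
  assumes "open S" "Ck_on k S g" "compact K" "K \<subseteq> S" "\<And>x. x \<in> S \<Longrightarrow> x \<notin> K \<Longrightarrow> g x = 0"
  shows "Ck_on k UNIV (\<lambda>x. if x \<in> S then g x else 0)"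
proof (rule Ck_on_local)
  fix x :: 'a
  show "\<exists>U. open U \<and> x \<in> U \<and> Ck_on k U (\<lambda>x. if x \<in> S then g x else 0)"
  proof (cases "x \<in> S")
    case True
    then show ?thesis
      using assms(1) Ck_on_cong[OF assms(1) _ assms(2)] by (intro exI[of _ S]) simp
  next
    case False
    have "open (- K)"
      using assms(3) by (simp add: compact_imp_closed open_Compl)
    moreover have "Ck_on k (- K) (\<lambda>x. if x \<in> S then g x else 0)"
      by (rule Ck_on_cong[OF \<open>open (- K)\<close> _ Ck_on_const[OF \<open>open (- K)\<close>, of _ 0]]) (use assms(5) in auto)
    ultimately show ?thesis
      using False assms(4) by blast
  qed
qed

lemma integrable_continuous_compact_support:
  fixes f :: "'f::euclidean_space \<Rightarrow> real"
  assumes "continuous_on UNIV f" "compact K" "\<And>x. x \<notin> K \<Longrightarrow> f x = 0"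
  shows "integrable lborel f"
proof -
  have "integrable lborel (\<lambda>x. indicator K x *\<^sub>R f x)"
    using assms by (intro borel_integrable_compact) (auto intro: continuous_on_subset)
  moreover have "(\<lambda>x. indicator K x *\<^sub>R f x) = f"
    using assms(3) by (auto simp: fun_eq_iff indicator_def)
  ultimately show ?thesis by simp
qed

lemma lborel_integral_translation:
  fixes f :: "'f::euclidean_space \<Rightarrow> real"
  assumes "f \<in> borel_measurable borel"
  shows "integral\<^sup>L lborel (\<lambda>x. f (c + x)) = integral\<^sup>L lborel f"
    and "integrable lborel f \<Longrightarrow> integrable lborel (\<lambda>x. f (c + x))"
  using integral_distr[of "(+) c" lborel borel f] integrable_distr_eq[of "(+) c" lborel borel f] assms
  by (simp_all add: lborel_distr_plus)

text \<open>The difference quotients in direction \<open>e\<close> integrate to 0 since both terms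
  have the same integral. The mean value theorem turns them into values of the derivative nearby,
  which gives the bound for dominated convergence.\<close>

lemma integral_directional_derivative_eq_0:
  fixes h :: "'f::euclidean_space \<Rightarrow> real"
  assumes h: "\<And>x. (h has_derivative h' x) (at x)" and cont: "continuous_on UNIV (\<lambda>x. h' x e)"
    and K: "compact K" "\<And>x. x \<notin> K \<Longrightarrow> h x = 0"
  shows "integral\<^sup>L lborel (\<lambda>x. h' x e) = 0"
proof -
  have ch: "continuous_on UNIV h"
    using h by (meson continuous_at_imp_continuous_on has_derivative_continuous)
  have zero: "h' x e = 0" if "x \<notin> K" for x
  proof -
    have "open (- K)" using K by (simp add: compact_imp_closed open_Compl)
    then have "(h has_derivative (\<lambda>v. 0)) (at x)"
      by (rule has_derivative_transform_within_open[OF has_derivative_const[of 0]]) (use that K in auto)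
    from has_derivative_unique[OF h this] show ?thesis by simp
  qed
  obtain B where B: "\<And>x. \<bar>h' x e\<bar> \<le> B" "B \<ge> 0"
  proof -
    have "compact ((\<lambda>x. h' x e) ` K)"
      using cont K(1) by (meson compact_continuous_image continuous_on_subset subset_UNIV)
    from compact_imp_bounded[OF this] obtain B where "\<forall>y\<in>(\<lambda>x. h' x e) ` K. norm y \<le> B"
      unfolding bounded_iff by blast
    then have B: "\<bar>h' x e\<bar> \<le> B" if "x \<in> K" for x
      using that by simp
    have "\<bar>h' x e\<bar> \<le> max B 0" for x
      using B[of x] zero[of x] by (cases "x \<in> K") auto
    then show thesis using that[of "max B 0"] by simp
  qed
  define t where "t = (\<lambda>n. 1 / (real n + 1))"
  have t: "0 < t n" "t n \<le> 1" for n by (auto simp: t_def)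
  have t0: "t \<longlonglongrightarrow> 0"
    unfolding t_def by (rule LIMSEQ_inverse_real_of_nat[simplified inverse_eq_divide of_nat_Suc add.commute, unfolded add.commute[of 1]])
  define q where "q = (\<lambda>n x. (h (t n *\<^sub>R e + x) - h x) / t n)"
  \<comment> \<open>The steps \<open>t n\<close> are at most 1, so a quotient can be nonzero at
    \<open>x\<close> only if the segment from \<open>x\<close> to \<open>x + e\<close> meets
    \<open>K\<close>. This compact set therefore contains the supports of all quotients.\<close>
  define K' where "K' = (\<lambda>(k, s). k - s *\<^sub>R e) ` (K \<times> {0..1})"
  have "compact K'"
    unfolding K'_def by (intro compact_continuous_image compact_Times K(1) compact_Icc)
      (auto simp: case_prod_unfold intro!: continuous_intros)
  have int_h: "integrable lborel h"
    by (rule integrable_continuous_compact_support[OF ch K])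
  have meas_h: "h \<in> borel_measurable borel"
    by (rule borel_measurable_continuous_onI[OF ch])
  have "integral\<^sup>L lborel (q n) = 0" for n
    unfolding q_def using lborel_integral_translation[OF meas_h, of "t n *\<^sub>R e"] int_h
    by (simp add: Bochner_Integration.integral_diff)
  moreover have "(\<lambda>n. integral\<^sup>L lborel (q n)) \<longlonglongrightarrow> integral\<^sup>L lborel (\<lambda>x. h' x e)"
  proof (rule integral_dominated_convergence[where w = "\<lambda>x. B * indicator K' x"])
    show "(\<lambda>x. h' x e) \<in> borel_measurable lborel"
      using borel_measurable_continuous_onI[OF cont] by simp
    show "q n \<in> borel_measurable lborel" for n
    proof -
      have "continuous_on UNIV (\<lambda>x. h (t n *\<^sub>R e + x))"
        by (intro continuous_on_compose2[OF ch] continuous_intros) auto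
      then have "continuous_on UNIV (q n)"
        unfolding q_def divide_inverse by (intro continuous_intros ch)
      then show ?thesis
        using borel_measurable_continuous_onI by simp
    qed
    show "integrable lborel (\<lambda>x. B * indicator K' x)"
      using emeasure_compact_finite[OF \<open>compact K'\<close>] \<open>compact K'\<close>
      by (intro integrable_mult_right integrable_real_indicator) (auto simp: compact_imp_closed borel_closed)
    show "AE x in lborel. (\<lambda>n. q n x) \<longlonglongrightarrow> h' x e"
    proof (rule AE_I2)
      fix x
      have "((\<lambda>s. h (x + s *\<^sub>R e)) has_real_derivative h' x e) (at 0)"
        using has_real_derivative_along_line[of h "h' x" x 0 e] h[of x] by simp
      then have lim: "((\<lambda>s. (h (x + s *\<^sub>R e) - h x) / s) \<longlongrightarrow> h' x e) (at 0)"
        by (simp add: DERIV_def)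
      have "filterlim t (at 0) sequentially"
        using t0 t(1) by (auto simp: filterlim_at less_imp_neq[symmetric])
      from filterlim_compose[OF lim this]
      show "(\<lambda>n. q n x) \<longlonglongrightarrow> h' x e"
        unfolding q_def by (simp add: add.commute)
    qed
    show "AE x in lborel. norm (q n x) \<le> B * indicator K' x" for n
    proof (rule AE_I2)
      fix x
      have "((\<lambda>s. h (x + s *\<^sub>R e)) has_real_derivative h' (x + s *\<^sub>R e) e) (at s)" for s
        by (rule has_real_derivative_along_line[OF h])
      from MVT2[OF t(1)[of n] this]
      obtain s where s: "0 < s" "s < t n" "h (x + t n *\<^sub>R e) - h (x + 0 *\<^sub>R e) = (t n - 0) * h' (x + s *\<^sub>R e) e"
        by blast
      then have q: "q n x = h' (x + s *\<^sub>R e) e"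
        using t(1)[of n] unfolding q_def by (simp add: add.commute)
      show "norm (q n x) \<le> B * indicator K' x"
      proof (cases "x + s *\<^sub>R e \<in> K")
        case True
        then have "x \<in> K'"
          unfolding K'_def using s t(2)[of n] by (intro image_eqI[of _ _ "(x + s *\<^sub>R e, s)"]) auto
        then show ?thesis using B q by simp
      next
        case False
        then show ?thesis using q zero B(2) by simp
      qed
    qed
  qed
  ultimately show ?thesis
    by (simp add: LIMSEQ_const_iff)
qed

section \<open>Coordinates with respect to the standard basis\<close>

text \<open>The change of variables theorem of the library is stated for \<open>real ^ 'n\<close>, with an index type
  which is finite and well-ordered.\<close>

typedef (overloaded) ('f::euclidean_space) bidx = "Basis :: 'f set"
  using nonempty_Basis by blast

abbreviation bvec :: "'f::euclidean_space bidx \<Rightarrow> 'f" where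
  "bvec \<equiv> Rep_bidx"

lemma bvec_in: "bvec i \<in> Basis"
  by (rule Rep_bidx)

lemma bij_bvec: "bij_betw bvec (UNIV :: 'f::euclidean_space bidx set) Basis"
  by (rule bij_betwI[of _ _ _ Abs_bidx]) (auto simp: Rep_bidx Rep_bidx_inverse Abs_bidx_inverse)

instance bidx :: (euclidean_space) finite
  by standard (use bij_betw_finite[OF bij_bvec] in simp)

text \<open>An arbitrary enumeration, along which the order of the natural numbers is pulled
  back.\<close>

definition bidx_index :: "'f::euclidean_space bidx \<Rightarrow> nat" where
  "bidx_index = (SOME f. inj f)"

lemma inj_bidx_index: "inj (bidx_index :: 'f::euclidean_space bidx \<Rightarrow> nat)"
proof -
  obtain f :: "'f bidx \<Rightarrow> nat" where "inj_on f UNIV"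
    using finite_imp_inj_to_nat_seg[OF finite[of "UNIV :: 'f bidx set"]] by auto
  then have "\<exists>f :: 'f bidx \<Rightarrow> nat. inj f" by (rule exI[of _ f])
  then show ?thesis
    unfolding bidx_index_def by (rule someI_ex)
qed

instantiation bidx :: (euclidean_space) wellorder
begin

definition less_eq_bidx :: "'a bidx \<Rightarrow> 'a bidx \<Rightarrow> bool" where
  "less_eq_bidx i j \<longleftrightarrow> bidx_index i \<le> bidx_index j"

definition less_bidx :: "'a bidx \<Rightarrow> 'a bidx \<Rightarrow> bool" where
  "less_bidx i j \<longleftrightarrow> bidx_index i < bidx_index j"

instance
proof
  fix P :: "'a bidx \<Rightarrow> bool" and a
  assume step: "\<And>x. (\<And>y. y < x \<Longrightarrow> P y) \<Longrightarrow> P x"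
  show "P a"
    by (induction a rule: measure_induct_rule[of bidx_index]) (use step less_bidx_def in blast)
qed (use inj_bidx_index in \<open>auto simp: less_eq_bidx_def less_bidx_def dest: injD\<close>)

end

lemma card_bidx: "CARD('f::euclidean_space bidx) = DIM('f)"
  using bij_betw_same_card[OF bij_bvec] .

lemma bvec_inner: "bvec i \<bullet> bvec j = (if i = j then 1 else 0)"
  using inner_Basis[OF bvec_in bvec_in, of i j] Rep_bidx_inject by metis

lemma sum_bvec: "(\<Sum>i\<in>UNIV. f (bvec i)) = (\<Sum>b\<in>Basis. f b)"
  using sum.reindex_bij_betw[OF bij_bvec] .

definition of_vec :: "real ^ 'f::euclidean_space bidx \<Rightarrow> 'f" where
  "of_vec x = (\<Sum>i\<in>UNIV. x $ i *\<^sub>R bvec i)"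

definition to_vec :: "'f::euclidean_space \<Rightarrow> real ^ 'f bidx" where
  "to_vec v = (\<chi> i. v \<bullet> bvec i)"

lemma of_vec_inner: "of_vec x \<bullet> bvec i = x $ i"
  by (simp add: of_vec_def inner_sum_left bvec_inner if_distrib[of "(*) _"] cong: if_cong)

lemma to_of_vec [simp]: "to_vec (of_vec x) = x"
  by (simp add: to_vec_def vec_eq_iff of_vec_inner)

lemma of_to_vec [simp]: "of_vec (to_vec v) = v"
  using sum_bvec[of "\<lambda>b. (v \<bullet> b) *\<^sub>R b"] by (simp add: to_vec_def of_vec_def euclidean_representation)

lemma linear_of_vec: "linear of_vec"
  unfolding of_vec_def by (rule linearI) (simp_all add: algebra_simps sum.distrib scaleR_sum_right)

lemma linear_to_vec: "linear to_vec"
  unfolding to_vec_def by (rule linearI) (simp_all add: vec_eq_iff inner_add_left)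

lemma of_vec_axis: "of_vec (axis i 1) = bvec i"
  unfolding of_vec_def axis_def by (simp add: if_distrib[of "\<lambda>c. c *\<^sub>R _"] cong: if_cong)

lemma continuous_of_vec: "continuous_on S of_vec"
  using linear_of_vec linear_continuous_on linear_conv_bounded_linear by blast

text \<open>The standard basis is orthonormal, so boxes correspond to boxes with the same side
  lengths, and volumes of boxes determine \<open>lborel\<close>.\<close>

lemma lborel_distr_of_vec: "distr lborel borel of_vec = (lborel :: 'f::euclidean_space measure)"
proof (rule lborel_eqI[symmetric])
  fix l u :: 'f
  assume le: "\<And>b. b \<in> Basis \<Longrightarrow> l \<bullet> b \<le> u \<bullet> b"
  have meas: "of_vec \<in> borel_measurable borel"
    by (rule borel_measurable_continuous_onI[OF continuous_of_vec])
  have box: "of_vec -` box l u = box (to_vec l) (to_vec u)"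
  proof (intro set_eqI)
    fix x :: "real ^ 'f bidx"
    have "of_vec x \<in> box l u \<longleftrightarrow> (\<forall>i. l \<bullet> bvec i < of_vec x \<bullet> bvec i \<and> of_vec x \<bullet> bvec i < u \<bullet> bvec i)"
      unfolding mem_box bij_betw_imp_surj_on[OF bij_bvec, symmetric] by blast
    then show "x \<in> of_vec -` box l u \<longleftrightarrow> x \<in> box (to_vec l) (to_vec u)"
      by (simp add: mem_box_cart of_vec_inner to_vec_def)
  qed
  have "emeasure (distr lborel borel of_vec) (box l u) = emeasure lborel (box (to_vec l) (to_vec u))"
    using emeasure_distr[of of_vec lborel borel "box l u"] meas by (simp add: box)
  also have "\<dots> = (\<Prod>b\<in>Basis. (to_vec u - to_vec l) \<bullet> b)"
    by (rule emeasure_lborel_box) (auto simp: Basis_vec_def inner_axis to_vec_def le bvec_in)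
  also have "(\<Prod>b\<in>Basis. (to_vec u - to_vec l) \<bullet> b) = (\<Prod>i\<in>UNIV. (to_vec u - to_vec l) $ i)"
  proof -
    have B: "(Basis :: (real ^ 'f bidx) set) = (\<lambda>i. axis i 1) ` UNIV"
      by (auto simp: Basis_vec_def)
    show ?thesis
      unfolding B by (simp add: prod.reindex inj_on_def axis_eq_axis inner_axis)
  qed
  also have "\<dots> = (\<Prod>i\<in>UNIV. (u - l) \<bullet> bvec i)"
    by (simp add: to_vec_def inner_diff_left)
  also have "\<dots> = (\<Prod>b\<in>Basis. (u - l) \<bullet> b)"
    by (rule prod.reindex_bij_betw[OF bij_bvec])
  finally show "emeasure (distr lborel borel of_vec) (box l u) = (\<Prod>b\<in>Basis. (u - l) \<bullet> b)" .
qed simp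

lemma integral_of_vec:
  fixes f :: "'f::euclidean_space \<Rightarrow> real"
  assumes "integrable lborel f"
  shows "integrable lborel (\<lambda>x. f (of_vec x))" "integral UNIV (\<lambda>x. f (of_vec x)) = integral\<^sup>L lborel f"
proof -
  have meas: "of_vec \<in> measurable lborel borel" "f \<in> borel_measurable borel"
    using borel_measurable_continuous_onI[OF continuous_of_vec] borel_measurable_integrable[OF assms] by auto
  show int: "integrable lborel (\<lambda>x. f (of_vec x))"
    using integrable_distr_eq[OF meas] assms by (simp add: lborel_distr_of_vec)
  show "integral UNIV (\<lambda>x. f (of_vec x)) = integral\<^sup>L lborel f"
    using integral_distr[OF meas] integral_lborel[OF int] by (simp add: lborel_distr_of_vec)
qed

definition lmat :: "('f::euclidean_space \<Rightarrow> 'f) \<Rightarrow> real ^ 'f bidx ^ 'f bidx" where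
  "lmat L = (\<chi> i j. L (bvec j) \<bullet> bvec i)"

lemma matrix_lmat: "matrix (to_vec \<circ> L \<circ> of_vec) = lmat L"
  by (simp add: matrix_def lmat_def vec_eq_iff of_vec_axis to_vec_def)

text \<open>Both integrands live on the whole space and vanish off the domain and the image of
  \<open>k\<close>. This is the shape in which densities supported in two overlapping charts
  appear.\<close>

lemma change_of_variables:
  fixes k :: "'f::euclidean_space \<Rightarrow> 'f" and F :: "'f \<Rightarrow> real"
  assumes S: "open S" and k: "\<And>x. x \<in> S \<Longrightarrow> (k has_derivative k' x) (at x)" and inj: "inj_on k S"
    and F: "integrable lborel F" "\<And>y. y \<notin> k ` S \<Longrightarrow> F y = 0"
    and G: "integrable lborel G" "\<And>x. x \<notin> S \<Longrightarrow> G x = 0"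
      "\<And>x. x \<in> S \<Longrightarrow> G x = \<bar>det (lmat (k' x))\<bar> * F (k x)"
  shows "integral\<^sup>L lborel G = integral\<^sup>L lborel F"
proof -
  let ?S = "of_vec -` S" and ?k = "to_vec \<circ> k \<circ> of_vec" and ?k' = "\<lambda>x. to_vec \<circ> k' (of_vec x) \<circ> of_vec"
  \<comment> \<open>The integrand is wrapped as a vector with one component, the form expected by
    the theorem on absolute integrals applied below.\<close>
  let ?F = "\<lambda>x. vec (F (of_vec x)) :: real ^ 1"
  have oS: "open ?S"
    using S continuous_of_vec by (metis continuous_on_open_vimage open_UNIV Int_UNIV_right)
  have bl: "bounded_linear (of_vec :: real ^ 'f bidx \<Rightarrow> 'f)" "bounded_linear (to_vec :: 'f \<Rightarrow> _)"
    using linear_of_vec linear_to_vec linear_conv_bounded_linear by blast+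
  have d: "(?k has_derivative ?k' x) (at x within ?S)" if "x \<in> ?S" for x
  proof -
    have "(k has_derivative k' (of_vec x)) (at (of_vec x))" using that k by simp
    from has_derivative_compose[OF bounded_linear_imp_has_derivative[OF bl(1)] this]
    have "((\<lambda>x. k (of_vec x)) has_derivative (\<lambda>v. k' (of_vec x) (of_vec v))) (at x)" .
    from bounded_linear.has_derivative[OF bl(2) this]
    show ?thesis by (simp add: o_def has_derivative_at_withinI)
  qed
  have inj': "inj_on ?k ?S"
  proof (rule inj_onI)
    fix x y assume "x \<in> ?S" "y \<in> ?S" "?k x = ?k y"
    then have "k (of_vec x) = k (of_vec y)" by (metis comp_apply of_to_vec)
    then have "of_vec x = of_vec y" using inj \<open>x \<in> ?S\<close> \<open>y \<in> ?S\<close> by (simp add: inj_on_eq_iff)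
    then show "x = y" by (metis to_of_vec)
  qed
  have zeroF: "F (of_vec y) = 0" if "y \<notin> ?k ` ?S" for y
  proof (rule F(2))
    show "of_vec y \<notin> k ` S"
    proof
      assume "of_vec y \<in> k ` S"
      then obtain x where x: "x \<in> S" "of_vec y = k x" by blast
      have "y = ?k (to_vec x)" using x(2) by (metis comp_apply of_to_vec to_of_vec)
      moreover have "to_vec x \<in> ?S" using x(1) by simp
      ultimately show False using that by blast
    qed
  qed
  have ai: "(\<lambda>x. F (of_vec x)) absolutely_integrable_on UNIV"
    using integral_of_vec(1)[OF F(1)] by (simp add: set_integrable_def integrable_completion)
  have eqF: "(\<lambda>x. if x \<in> ?k ` ?S then F (of_vec x) else 0) = (\<lambda>x. F (of_vec x))"
    using zeroF by fastforce
  have "(\<lambda>x. F (of_vec x)) absolutely_integrable_on ?k ` ?S"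
    using ai absolutely_integrable_restrict_UNIV[of "?k ` ?S" "\<lambda>x. F (of_vec x)"] unfolding eqF by blast
  moreover have "integral (?k ` ?S) (\<lambda>x. F (of_vec x)) = integral\<^sup>L lborel F"
    using integral_restrict_UNIV[of "?k ` ?S" "\<lambda>x. F (of_vec x)"] integral_of_vec(2)[OF F(1)] unfolding eqF by simp
  ultimately have "?F absolutely_integrable_on ?k ` ?S \<and> integral (?k ` ?S) ?F = vec (integral\<^sup>L lborel F)"
    by (simp add: absolutely_integrable_on_1_iff integral_on_1_eq)
  moreover have "?S \<in> sets lebesgue"
    using borel_open[OF oS] by (simp add: sets_completionI_sets)
  ultimately have "integral ?S (\<lambda>x. \<bar>det (matrix (?k' x))\<bar> *\<^sub>R ?F (?k x)) = vec (integral\<^sup>L lborel F)"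
    using has_absolute_integral_change_of_variables[of ?S ?k ?k' ?F "vec (integral\<^sup>L lborel F)", OF _ d inj']
    by blast
  then have "integral ?S (\<lambda>x. \<bar>det (lmat (k' (of_vec x)))\<bar> * F (k (of_vec x))) = integral\<^sup>L lborel F"
    by (simp add: integral_on_1_eq matrix_lmat vec_eq_iff)
  moreover have "integral ?S (\<lambda>x. \<bar>det (lmat (k' (of_vec x)))\<bar> * F (k (of_vec x))) = integral ?S (\<lambda>x. G (of_vec x))"
    by (rule integral_cong) (simp add: G(3))
  moreover have "integral ?S (\<lambda>x. G (of_vec x)) = integral UNIV (\<lambda>x. if x \<in> ?S then G (of_vec x) else 0)"
    by (rule integral_restrict_UNIV[symmetric])
  moreover have "(\<lambda>x. if x \<in> ?S then G (of_vec x) else 0) = (\<lambda>x. G (of_vec x))"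
    using G(2) by fastforce
  ultimately show ?thesis
    using integral_of_vec(2)[OF G(1)] by simp
qed

section \<open>Jacobi's formula and the divergence of the Liouville field\<close>

text \<open>In the Leibniz formula at the identity matrix only the identity permutation survives:
  any other term still has an off-diagonal zero factor after one factor has been
  differentiated.\<close>

lemma has_derivative_det_at_mat_1:
  fixes C :: "'e::real_normed_vector \<Rightarrow> real ^ 'n ^ 'n"
  assumes C: "\<And>i j. ((\<lambda>y. C y $ i $ j) has_derivative C' i j) (at x)" and x: "C x = mat 1"
  shows "((\<lambda>y. det (C y)) has_derivative (\<lambda>h. \<Sum>i\<in>UNIV. C' i i h)) (at x)"
proof -
  let ?T = "\<lambda>p h. \<Sum>i\<in>UNIV. C' i (p i) h * (\<Prod>j\<in>UNIV - {i}. C x $ j $ p j)"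
  have "((\<lambda>y. det (C y)) has_derivative (\<lambda>h. \<Sum>p | p permutes UNIV. of_int (sign p) * ?T p h)) (at x)"
    unfolding det_def by (intro has_derivative_sum has_derivative_mult_right has_derivative_prod C)
  moreover have "(\<Sum>p | p permutes UNIV. of_int (sign p) * ?T p h) = (\<Sum>i\<in>UNIV. C' i i h)" for h
  proof -
    have "?T p h = 0" if p: "p permutes UNIV" "p \<noteq> id" for p
    proof (rule sum.neutral, intro ballI)
      fix i
      \<comment> \<open>A permutation that fixes every index but \<open>i\<close> fixes
        \<open>i\<close> as well.\<close>
      have "\<exists>j. j \<noteq> i \<and> p j \<noteq> j"
      proof (rule ccontr)
        assume "\<not> ?thesis"
        then have fixed: "p j = j" if "j \<noteq> i" for j using that by blast
        have "p i = i"
          using fixed[of "p i"] permutes_inj[OF p(1)] by (metis injD)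
        with fixed have "p = id" by (metis eq_id_iff)
        with p(2) show False by simp
      qed
      then obtain j where "j \<noteq> i" "p j \<noteq> j" by blast
      then have "(\<Prod>j\<in>UNIV - {i}. C x $ j $ p j) = 0"
        by (intro prod_zero) (auto simp: x mat_def intro!: bexI[of _ j])
      then show "C' i (p i) h * (\<Prod>j\<in>UNIV - {i}. C x $ j $ p j) = 0"
        by simp
    qed
    then have "(\<Sum>p\<in>{p. p permutes UNIV} - {id}. of_int (sign p) * ?T p h) = 0"
      by (intro sum.neutral) simp
    moreover have "?T id h = (\<Sum>i\<in>UNIV. C' i i h)"
      by (simp add: x mat_def)
    ultimately show ?thesis
      using sum.remove[of "{p. p permutes (UNIV :: 'n set)}" id "\<lambda>p. of_int (sign p) * ?T p h"]
      by (simp add: permutes_id sign_id)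
  qed
  ultimately show ?thesis by simp
qed

text \<open>Jacobi's formula. With \<open>B\<close> the inverse of \<open>A x\<close>, write
  \<open>det (A y)\<close> as \<open>det (A x) * det (B ** A y)\<close>; the second factor is
  differentiated at the identity matrix.\<close>

lemma has_derivative_det:
  fixes A :: "'e::real_normed_vector \<Rightarrow> real ^ 'n ^ 'n"
  assumes A: "\<And>i j. ((\<lambda>y. A y $ i $ j) has_derivative A' i j) (at x)" and B: "B ** A x = mat 1"
  shows "((\<lambda>y. det (A y)) has_derivative
    (\<lambda>h. det (A x) * (\<Sum>i\<in>UNIV. \<Sum>j\<in>UNIV. B $ i $ j * A' j i h))) (at x)"
proof -
  have "((\<lambda>y. (B ** A y) $ i $ k) has_derivative (\<lambda>h. \<Sum>j\<in>UNIV. B $ i $ j * A' j k h)) (at x)" for i k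
    unfolding matrix_matrix_mult_def by (simp, intro has_derivative_sum has_derivative_mult_right A)
  from has_derivative_mult_right[OF has_derivative_det_at_mat_1[of "\<lambda>y. B ** A y", OF this B], of "det (A x)"]
  have "((\<lambda>y. det (A x) * det (B ** A y)) has_derivative
    (\<lambda>h. det (A x) * (\<Sum>i\<in>UNIV. \<Sum>j\<in>UNIV. B $ i $ j * A' j i h))) (at x)" .
  moreover have "det (A x) * det (B ** A y) = det (A y)" for y
  proof -
    have "det B * det (A x) = 1"
      by (metis B det_I det_mul)
    then have "det (A x) * det B = 1" by (simp add: mult.commute)
    then show ?thesis by (simp add: det_mul mult.assoc[symmetric])
  qed
  ultimately show ?thesis by simp
qed

text \<open>If \<open>T\<close> is the logarithmic derivative of \<open>D\<close>, then
  \<open>T / 2\<close> is that of the square root of \<open>\<bar>D\<bar>\<close>. The nested square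
  roots reproduce the expression that defines \<open>rho\<close>.\<close>

lemma has_derivative_root4_square:
  fixes D :: "'e::real_normed_vector \<Rightarrow> real"
  assumes D: "(D has_derivative (\<lambda>h. D x * T h)) (at x)" and nz: "D x \<noteq> 0"
  shows "((\<lambda>y. sqrt (sqrt ((D y)\<^sup>2))) has_derivative (\<lambda>h. sqrt (sqrt ((D x)\<^sup>2)) * (T h / 2))) (at x)"
proof -
  have "((\<lambda>y. (D y)\<^sup>2) has_derivative (\<lambda>h. 2 * (D x)\<^sup>2 * T h)) (at x)"
    using has_derivative_mult[OF D D] by (simp add: power2_eq_square algebra_simps)
  from DERIV_compose_FDERIV[OF DERIV_real_sqrt this] nz
  have d: "((\<lambda>y. \<bar>D y\<bar>) has_derivative (\<lambda>h. 2 * (D x)\<^sup>2 * T h * (inverse \<bar>D x\<bar> / 2))) (at x)"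
    by simp
  have "2 * (D x)\<^sup>2 * t * (inverse \<bar>D x\<bar> / 2) = \<bar>D x\<bar> * t" for t
    using nz by (simp add: field_simps power2_eq_square)
  with d have "((\<lambda>y. \<bar>D y\<bar>) has_derivative (\<lambda>h. \<bar>D x\<bar> * T h)) (at x)"
    by (simp only:)
  from DERIV_compose_FDERIV[OF DERIV_real_sqrt this] nz
  have d: "((\<lambda>y. sqrt \<bar>D y\<bar>) has_derivative (\<lambda>h. \<bar>D x\<bar> * T h * (inverse (sqrt \<bar>D x\<bar>) / 2))) (at x)"
    by simp
  have "\<bar>D x\<bar> * t * (inverse (sqrt \<bar>D x\<bar>) / 2) = sqrt \<bar>D x\<bar> * (t / 2)" for t
  proof -
    have "\<bar>D x\<bar> = sqrt \<bar>D x\<bar> * sqrt \<bar>D x\<bar>" by simp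
    then show ?thesis using nz by (simp add: field_simps)
  qed
  with d have "((\<lambda>y. sqrt \<bar>D y\<bar>) has_derivative (\<lambda>h. sqrt \<bar>D x\<bar> * (T h / 2))) (at x)"
    by (simp only:)
  then show ?thesis by simp
qed

text \<open>Coordinates of the identity \<open>div V = n / 2\<close> for \<open>i\<^sub>V \<omega> = \<alpha>\<close> and \<open>d\<alpha> = \<omega>\<close>, the divergence being taken with
  respect to the density \<open>\<bar>det \<omega>\<bar>\<^bsup>1/2\<^esup>\<close>: here \<open>B\<close> is the inverse of \<open>A = (\<omega>\<^sub>i\<^sub>j)\<close>, \<open>dA i j k = \<partial>\<^sub>i \<omega>\<^sub>j\<^sub>k\<close>,
  \<open>dV i k = \<partial>\<^sub>i V\<^sub>k\<close> and \<open>da i k = \<partial>\<^sub>i \<alpha>\<^sub>k\<close>.\<close>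

lemma liouville_divergence:
  fixes A B :: "'n::finite \<Rightarrow> 'n \<Rightarrow> real" and dA :: "'n \<Rightarrow> 'n \<Rightarrow> 'n \<Rightarrow> real"
  assumes B_skew: "\<And>i j. B i j = - B j i"
    and AB: "\<And>i j. (\<Sum>k\<in>UNIV. A i k * B k j) = (if i = j then 1 else 0)"
    and dA_skew: "\<And>i j k. dA i j k = - dA i k j"
    and closed: "\<And>i j k. dA i j k = - dA j k i - dA k i j"
    and product: "\<And>j k. da j k = (\<Sum>i\<in>UNIV. dV j i * A i k) + (\<Sum>i\<in>UNIV. V i * dA j i k)"
    and exact: "\<And>j k. da j k - da k j = A j k"
  shows "(\<Sum>i\<in>UNIV. dV i i) + (\<Sum>i\<in>UNIV. V i * (\<Sum>k\<in>UNIV. \<Sum>j\<in>UNIV. B k j * dA i j k)) / 2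
    = real CARD('n) / 2"
proof -
  define S where "S = (\<Sum>k\<in>UNIV. \<Sum>j\<in>UNIV. B k j * (\<Sum>i\<in>UNIV. V i * dA j i k))"
  \<comment> \<open>Closedness writes \<open>dA i j k\<close> as the part of \<open>dA j i k\<close>
    skew in \<open>j\<close> and \<open>k\<close>, without a factor 1/2. Contraction with the skew
    \<open>B\<close> counts each half equally, whence the 2, which cancels the exponent 1/2 of the
    density.\<close>
  have half: "(\<Sum>k\<in>UNIV. \<Sum>j\<in>UNIV. B k j * dA i j k) = 2 * (\<Sum>k\<in>UNIV. \<Sum>j\<in>UNIV. B k j * dA j i k)" for i
  proof -
    have "(\<Sum>k\<in>UNIV. \<Sum>j\<in>UNIV. B k j * dA k i j) = (\<Sum>j\<in>UNIV. \<Sum>k\<in>UNIV. B k j * dA k i j)"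
      by (rule sum.swap)
    also have "\<dots> = (\<Sum>k\<in>UNIV. \<Sum>j\<in>UNIV. - (B k j * dA j i k))"
      by (intro sum.cong refl) (metis B_skew mult_minus_left)
    finally have "(\<Sum>k\<in>UNIV. \<Sum>j\<in>UNIV. B k j * dA k i j) = - (\<Sum>k\<in>UNIV. \<Sum>j\<in>UNIV. B k j * dA j i k)"
      by (simp add: sum_negf)
    moreover have "B k j * dA i j k = B k j * dA j i k - B k j * dA k i j" for k j
    proof -
      have "dA i j k = dA j i k - dA k i j"
        using closed[of i j k] dA_skew[of j k i] by simp
      then show ?thesis by (simp add: right_diff_distrib)
    qed
    ultimately show ?thesis by (simp add: sum_subtractf)
  qed
  have "(\<Sum>i\<in>UNIV. V i * (\<Sum>k\<in>UNIV. \<Sum>j\<in>UNIV. B k j * dA i j k)) / 2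
      = (\<Sum>i\<in>UNIV. V i * (\<Sum>k\<in>UNIV. \<Sum>j\<in>UNIV. B k j * dA j i k))"
    unfolding half by (simp add: sum_divide_distrib)
  also have "\<dots> = S"
  proof -
    have "S = (\<Sum>k\<in>UNIV. \<Sum>j\<in>UNIV. \<Sum>i\<in>UNIV. V i * (B k j * dA j i k))"
      unfolding S_def by (simp add: sum_distrib_left mult.left_commute)
    also have "\<dots> = (\<Sum>k\<in>UNIV. \<Sum>i\<in>UNIV. \<Sum>j\<in>UNIV. V i * (B k j * dA j i k))"
      by (intro sum.cong refl sum.swap)
    also have "\<dots> = (\<Sum>i\<in>UNIV. \<Sum>k\<in>UNIV. \<Sum>j\<in>UNIV. V i * (B k j * dA j i k))"
      by (rule sum.swap)
    finally show ?thesis by (simp add: sum_distrib_left)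
  qed
  \<comment> \<open>The product rule for \<alpha> trades the derivative of \<omega> for those of
    \<alpha> and \<open>V\<close>; since \<open>B\<close> inverts \<open>A\<close>, the latter
    contracts to the trace of \<open>dV\<close>, which cancels in the final sum.\<close>
  also have "S = (\<Sum>k\<in>UNIV. \<Sum>j\<in>UNIV. B k j * da j k) - (\<Sum>i\<in>UNIV. dV i i)"
  proof -
    have "S = (\<Sum>k\<in>UNIV. \<Sum>j\<in>UNIV. B k j * da j k) - (\<Sum>k\<in>UNIV. \<Sum>j\<in>UNIV. B k j * (\<Sum>i\<in>UNIV. dV j i * A i k))"
      unfolding S_def product by (simp add: distrib_left sum.distrib)
    moreover have "(\<Sum>k\<in>UNIV. \<Sum>j\<in>UNIV. B k j * (\<Sum>i\<in>UNIV. dV j i * A i k)) = (\<Sum>i\<in>UNIV. dV i i)"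
    proof -
      have "(\<Sum>k\<in>UNIV. \<Sum>j\<in>UNIV. B k j * (\<Sum>i\<in>UNIV. dV j i * A i k))
          = (\<Sum>j\<in>UNIV. \<Sum>k\<in>UNIV. \<Sum>i\<in>UNIV. dV j i * (A i k * B k j))"
        by (subst sum.swap) (simp add: sum_distrib_left mult_ac)
      also have "\<dots> = (\<Sum>j\<in>UNIV. \<Sum>i\<in>UNIV. \<Sum>k\<in>UNIV. dV j i * (A i k * B k j))"
        by (intro sum.cong refl sum.swap)
      also have "\<dots> = (\<Sum>j\<in>UNIV. \<Sum>i\<in>UNIV. dV j i * (if i = j then 1 else 0))"
        by (simp only: sum_distrib_left[symmetric] AB)
      finally show ?thesis by (simp add: if_distrib[of "(*) _"] cong: if_cong)
    qed
    ultimately show ?thesis by simp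
  qed
  \<comment> \<open>The skew \<open>B\<close> sees only the skew part of \<open>da\<close>, which is
    \<open>A / 2\<close> because d\<alpha> = \<omega>. The trace of the identity matrix then gives
    the constant.\<close>
  also have "(\<Sum>k\<in>UNIV. \<Sum>j\<in>UNIV. B k j * da j k) = real CARD('n) / 2"
  proof -
    have "(\<Sum>k\<in>UNIV. \<Sum>j\<in>UNIV. B k j * da k j) = (\<Sum>j\<in>UNIV. \<Sum>k\<in>UNIV. B k j * da k j)"
      by (rule sum.swap)
    also have "\<dots> = (\<Sum>k\<in>UNIV. \<Sum>j\<in>UNIV. - (B k j * da j k))"
      by (intro sum.cong refl) (metis B_skew mult_minus_left)
    finally have "(\<Sum>k\<in>UNIV. \<Sum>j\<in>UNIV. B k j * da k j) = - (\<Sum>k\<in>UNIV. \<Sum>j\<in>UNIV. B k j * da j k)"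
      by (simp add: sum_negf)
    moreover have "(\<Sum>k\<in>UNIV. \<Sum>j\<in>UNIV. B k j * da j k) - (\<Sum>k\<in>UNIV. \<Sum>j\<in>UNIV. B k j * da k j)
        = (\<Sum>k\<in>UNIV. \<Sum>j\<in>UNIV. A j k * B k j)"
      unfolding sum_subtractf[symmetric] by (simp add: exact[symmetric] algebra_simps)
    moreover have "(\<Sum>k\<in>UNIV. \<Sum>j\<in>UNIV. A j k * B k j) = real CARD('n)"
      by (subst sum.swap) (simp add: AB)
    ultimately show ?thesis by simp
  qed
  finally show ?thesis by linarith
qed

section \<open>Exact nondegenerate 2-forms on compact manifolds\<close>

lemma Ck_on_1_has_derivative:
  "Ck_on 1 S f \<Longrightarrow> x \<in> S \<Longrightarrow> (f has_derivative frechet_derivative f (at x)) (at x)"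
  using Ck_on_SucD[of 0 S f x] by simp

lemma Ck_on_det:
  fixes A :: "'e::euclidean_space \<Rightarrow> real ^ 'n ^ 'n"
  assumes "open S" "\<And>i j. Ck_on k S (\<lambda>x. A x $ i $ j)"
  shows "Ck_on k S (\<lambda>x. det (A x))"
  unfolding det_def by (intro Ck_on_sum Ck_on_mult Ck_on_const Ck_on_prod assms)

lemma diff_formsD:
  assumes "\<omega> \<in> diff_forms M k"
  shows diff_forms_linear: "p \<in> points M \<Longrightarrow> length vs = k \<Longrightarrow> i < k \<Longrightarrow> linear (\<lambda>v. \<omega> p (vs[i := v]))"
    and diff_forms_alternating: "p \<in> points M \<Longrightarrow> length vs = k \<Longrightarrow> i < k \<Longrightarrow> j < k \<Longrightarrow> i \<noteq> j \<Longrightarrow>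
      vs ! i = vs ! j \<Longrightarrow> \<omega> p vs = 0"
    and diff_forms_smooth: "c \<in> atlas M \<Longrightarrow> length vs = k \<Longrightarrow> smooth_on (chart_image c) (\<lambda>x. chart_form M c \<omega> x vs)"
  using assms[unfolded diff_forms_def, THEN CollectD] by blast+

text \<open>An exact symplectic form, detached from slant geometry. The locale collects what the
  assumption of a vanishing class provides, and it ends in the failure of compactness.\<close>

locale exact_nondegenerate = smooth_mfd M
  for M :: "('a, 'f::euclidean_space) manifold" +
  fixes \<omega> \<alpha> :: "('a, 'f) form"
  assumes closed: "\<omega> \<in> closed_forms M 2" and \<alpha>: "\<alpha> \<in> diff_forms M 1"
    and exact: "is_ext_deriv M 1 \<alpha> \<omega>"
    and nondegenerate: "\<And>p u. p \<in> points M \<Longrightarrow> u \<noteq> 0 \<Longrightarrow> \<exists>z. \<omega> p [u, z] \<noteq> 0"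
begin

lemma \<omega>: "\<omega> \<in> diff_forms M 2" and d\<omega>: "is_ext_deriv M 2 \<omega> zero_form"
  using closed by (auto simp: closed_forms_def)

lemma bilinear_\<omega>:
  assumes "p \<in> points M"
  shows "bilinear (\<lambda>u v. \<omega> p [u, v])"
  using diff_forms_linear[OF \<omega> assms, of "[a, b]" 0 for a b] diff_forms_linear[OF \<omega> assms, of "[a, b]" 1 for a b]
  by (simp add: bilinear_def)

lemma \<omega>_self:
  assumes "p \<in> points M"
  shows "\<omega> p [v, v] = 0"
  by (rule diff_forms_alternating[OF \<omega> assms, of _ 0 1]) simp_all

lemma \<omega>_skew:
  assumes p: "p \<in> points M"
  shows "\<omega> p [u, v] = - \<omega> p [v, u]"
  using bilinear_ladd[OF bilinear_\<omega>[OF p], of u v "u + v"] bilinear_radd[OF bilinear_\<omega>[OF p], of _ u v]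
    \<omega>_self[OF p] by simp

lemma linear_\<alpha>:
  assumes "p \<in> points M"
  shows "linear (\<lambda>v. \<alpha> p [v])"
  using diff_forms_linear[OF \<alpha> assms, of "[a]" 0 for a] by simp

section \<open>The Liouville field and its divergence\<close>

definition V :: "'a \<Rightarrow> 'f" where
  "V p = (SOME v. \<forall>w. \<omega> p [v, w] = \<alpha> p [w])"

text \<open>Nondegeneracy makes the map from \<open>v\<close> to the functional \<omega>(v, .)
  injective, hence bijective by dimension. The pointwise choice says nothing about smoothness, which
  Cramer's rule supplies later.\<close>

lemma V:
  assumes p: "p \<in> points M"
  shows "\<omega> p [V p, w] = \<alpha> p [w]"
proof -
  note b = bilinear_\<omega>[OF p]
  define L where "L = (\<lambda>v. \<Sum>i\<in>Basis. \<omega> p [v, i] *\<^sub>R i :: 'f)"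
  have L: "linear L"
    unfolding L_def by (rule linearI)
      (simp_all add: bilinear_ladd[OF b] bilinear_lmul[OF b] algebra_simps sum.distrib scaleR_sum_right)
  have Li: "L v \<bullet> i = \<omega> p [v, i]" if "i \<in> Basis" for v i
    using that unfolding L_def by (rule inner_sum_left_Basis)
  have lin: "linear (\<lambda>w. \<omega> p [v, w])" for v
    using b by (simp add: bilinear_def)
  have "inj L"
  proof (subst linear_injective_0[OF L], intro allI impI, rule ccontr)
    fix v assume "L v = 0" "v \<noteq> 0"
    then have "\<omega> p [v, i] = 0" if "i \<in> Basis" for i
      using Li[OF that, of v] by simp
    then have "\<omega> p [v, z] = 0" for z
      using linear_basis_expansion[OF lin, of v z] by simp
    then show False using nondegenerate[OF p \<open>v \<noteq> 0\<close>] by blast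
  qed
  then have "surj L"
    by (rule eucl.linear_inj_imp_surj[OF L])
  then obtain v where v: "L v = (\<Sum>i\<in>Basis. \<alpha> p [i] *\<^sub>R i)"
    by (metis surjE)
  have "\<omega> p [v, i] = \<alpha> p [i]" if "i \<in> Basis" for i
    using Li[OF that, of v] that by (simp add: v inner_sum_left_Basis)
  then have "\<omega> p [v, w] = \<alpha> p [w]" for w
    using linear_basis_expansion[OF lin, of v w] linear_basis_expansion[OF linear_\<alpha>[OF p], of w] by simp
  then have "\<exists>v. \<forall>w. \<omega> p [v, w] = \<alpha> p [w]" by blast
  then have "\<forall>w. \<omega> p [V p, w] = \<alpha> p [w]"
    unfolding V_def by (rule someI_ex)
  then show ?thesis by blast
qed

abbreviation \<omega>c :: "('a, 'f) chart \<Rightarrow> 'f \<Rightarrow> 'f \<Rightarrow> 'f \<Rightarrow> real" where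
  "\<omega>c c x u v \<equiv> chart_form M c \<omega> x [u, v]"

abbreviation \<alpha>c :: "('a, 'f) chart \<Rightarrow> 'f \<Rightarrow> 'f \<Rightarrow> real" where
  "\<alpha>c c x u \<equiv> chart_form M c \<alpha> x [u]"

definition Vc :: "('a, 'f) chart \<Rightarrow> 'f \<Rightarrow> 'f" where
  "Vc c x = coords M c (chart_inv c x) (V (chart_inv c x))"

definition A :: "('a, 'f) chart \<Rightarrow> 'f \<Rightarrow> real ^ 'f bidx ^ 'f bidx" where
  "A c x = (\<chi> i j. \<omega>c c x (bvec i) (bvec j))"

text \<open>The density \<open>\<bar>det A\<bar>\<^bsup>1/2\<^esup>\<close>, written so that it is visibly smooth where \<open>det A \<noteq> 0\<close>.\<close>

definition rho :: "('a, 'f) chart \<Rightarrow> 'f \<Rightarrow> real" where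
  "rho c x = sqrt (sqrt ((det (A c x))\<^sup>2))"

context
  fixes c assumes c: "c \<in> atlas M"
begin

lemma point_of_chart: "x \<in> chart_image c \<Longrightarrow> chart_inv c x \<in> points M"
  using chart_inv_in[of x c] chart_domain_subset[OF c] by blast

lemma smooth_\<omega>c: "smooth_on (chart_image c) (\<lambda>x. \<omega>c c x u v)"
  by (rule diff_forms_smooth[OF \<omega> c]) simp

lemma smooth_\<alpha>c: "smooth_on (chart_image c) (\<lambda>x. \<alpha>c c x u)"
  by (rule diff_forms_smooth[OF \<alpha> c]) simp

lemma bilinear_\<omega>c:
  assumes x: "x \<in> chart_image c"
  shows "bilinear (\<omega>c c x)"
proof -
  let ?q = "chart_inv c x"
  note t = linear_tvec[OF c chart_inv_in[OF x]]
  have "linear (\<lambda>v. \<omega> ?q [u, v])" "linear (\<lambda>v. \<omega> ?q [v, u])" for u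
    using bilinear_\<omega>[OF point_of_chart[OF x]] by (simp_all add: bilinear_def)
  from linear_compose[OF t this(1)] linear_compose[OF t this(2)] show ?thesis
    by (simp add: bilinear_def chart_form_def o_def)
qed

lemma \<omega>c_skew: "x \<in> chart_image c \<Longrightarrow> \<omega>c c x u v = - \<omega>c c x v u"
  unfolding chart_form_def list.map by (rule \<omega>_skew[OF point_of_chart])

lemma Vc: "x \<in> chart_image c \<Longrightarrow> \<omega>c c x (Vc c x) w = \<alpha>c c x w"
  by (simp add: chart_form_def Vc_def tvec_coords[OF c chart_inv_in] V[OF point_of_chart])

lemma \<omega>c_nondegenerate:
  assumes x: "x \<in> chart_image c" and u: "u \<noteq> 0"
  obtains z where "\<omega>c c x u z \<noteq> 0"
proof -
  note q = chart_inv_in[OF x]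
  have "tvec M c (chart_inv c x) u \<noteq> 0"
  proof
    assume "tvec M c (chart_inv c x) u = 0"
    then have "u = 0"
      using coords_tvec[OF c c q q, of u] tder_self[OF c q] linear_0[OF linear_coords[OF c q]] by simp
    with u show False by simp
  qed
  then obtain z where "\<omega> (chart_inv c x) [tvec M c (chart_inv c x) u, z] \<noteq> 0"
    using nondegenerate[OF point_of_chart[OF x]] by blast
  then have "\<omega>c c x u (coords M c (chart_inv c x) z) \<noteq> 0"
    by (simp add: chart_form_def tvec_coords[OF c q])
  then show thesis by (rule that)
qed

lemma sum_\<omega>c:
  assumes x: "x \<in> chart_image c"
  shows "(\<Sum>i\<in>UNIV. (u \<bullet> bvec i) * \<omega>c c x (bvec i) w) = \<omega>c c x u w"
proof -
  have "linear (\<lambda>u. \<omega>c c x u w)"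
    using bilinear_\<omega>c[OF x] by (simp add: bilinear_def)
  from linear_basis_expansion[OF this, of u] show ?thesis
    using sum_bvec[of "\<lambda>b. (u \<bullet> b) * \<omega>c c x b w"] by simp
qed

text \<open>A kernel vector of the transposed matrix is a vector whose contraction with \<omega>
  vanishes on the basis, hence everywhere.\<close>

lemma det_A_nonzero:
  assumes x: "x \<in> chart_image c"
  shows "det (A c x) \<noteq> 0"
proof -
  have "u = 0" if "transpose (A c x) *v u = 0" for u
  proof (rule ccontr)
    assume "u \<noteq> 0"
    then have "of_vec u \<noteq> 0"
      by (metis linear_0[OF linear_to_vec] to_of_vec)
    then obtain z where z: "\<omega>c c x (of_vec u) z \<noteq> 0"
      by (rule \<omega>c_nondegenerate[OF x])
    have "\<omega>c c x (of_vec u) (bvec j) = 0" for j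
    proof -
      have "\<omega>c c x (of_vec u) (bvec j) = (transpose (A c x) *v u) $ j"
        by (simp add: sum_\<omega>c[OF x, of "of_vec u" "bvec j", symmetric] of_vec_inner matrix_vector_mult_def transpose_def A_def mult.commute)
      then show ?thesis using that by simp
    qed
    then have "\<omega>c c x b (of_vec u) = 0" if "b \<in> Basis" for b
      using that \<omega>c_skew[OF x, of b "of_vec u"] bij_betw_imp_surj_on[OF bij_bvec] by (metis imageE neg_equal_0_iff_equal)
    moreover have "linear (\<lambda>b. \<omega>c c x b (of_vec u))"
      using bilinear_\<omega>c[OF x] by (simp add: bilinear_def)
    ultimately have "\<omega>c c x z (of_vec u) = 0"
      using linear_basis_expansion[of "\<lambda>b. \<omega>c c x b (of_vec u)" z] by simp
    with z \<omega>c_skew[OF x, of z "of_vec u"] show False by simp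
  qed
  then have "invertible (transpose (A c x))"
    using matrix_left_invertible_ker invertible_left_inverse by blast
  then show ?thesis
    by (simp add: invertible_det_nz det_transpose)
qed

lemma rho_pos: "x \<in> chart_image c \<Longrightarrow> rho c x > 0"
  using det_A_nonzero by (simp add: rho_def)

lemma Ck_A: "Ck_on k (chart_image c) (\<lambda>x. A c x $ i $ j)"
  using smooth_\<omega>c unfolding smooth_on_def A_def by simp

lemma Ck_det_A: "Ck_on k (chart_image c) (\<lambda>x. det (A c x))"
  by (intro Ck_on_det open_chart_image Ck_A c)

lemma Ck_rho: "Ck_on k (chart_image c) (rho c)"
proof -
  have pos: "0 < det (A c x) * det (A c x)" if "x \<in> chart_image c" for x
    using det_A_nonzero[OF that] not_real_square_gt_zero by blast
  show ?thesis
    unfolding rho_def power2_eq_square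
    by (intro Ck_on_sqrt Ck_on_mult open_chart_image c Ck_det_A) (simp_all add: pos det_A_nonzero)
qed

text \<open>In coordinates the defining equation of \<open>V\<close> is linear with matrix
  \<open>transpose (A c x)\<close> and right-hand side \<alpha>. Cramer's rule presents its solution
  as a quotient of determinants with smooth entries.\<close>

lemma Ck_Vc: "Ck_on k (chart_image c) (\<lambda>x. Vc c x \<bullet> bvec i)"
proof -
  let ?a = "\<lambda>x. \<chi> j. \<alpha>c c x (bvec j)"
  let ?M = "\<lambda>x. (\<chi> l j. if j = i then ?a x $ l else transpose (A c x) $ l $ j) :: real ^ 'f bidx ^ 'f bidx"
  note o = open_chart_image[OF c]
  have "Ck_on k (chart_image c) (\<lambda>x. ?M x $ l $ j)" for l j
  proof (cases "j = i")
    case True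
    then show ?thesis using smooth_\<alpha>c unfolding smooth_on_def by simp
  next
    case False
    then show ?thesis using Ck_A by (simp add: transpose_def)
  qed
  then have "Ck_on k (chart_image c) (\<lambda>x. det (?M x) * inverse (det (A c x)))"
    by (intro Ck_on_mult Ck_on_inverse Ck_on_det Ck_det_A o det_A_nonzero)
  then show ?thesis
  proof (rule Ck_on_cong[OF o, rotated])
    fix x assume x: "x \<in> chart_image c"
    have "transpose (A c x) *v to_vec (Vc c x) = ?a x"
      by (simp add: vec_eq_iff matrix_vector_mult_def transpose_def to_vec_def A_def mult.commute
          sum_\<omega>c[OF x] Vc[OF x])
    then have "to_vec (Vc c x) = (\<chi> k. det (\<chi> l j. if j = k then ?a x $ l else transpose (A c x) $ l $ j) / det (transpose (A c x)))"
      using cramer[of "transpose (A c x)"] det_A_nonzero[OF x] by (simp add: det_transpose)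
    from arg_cong[OF this, of "\<lambda>v. v $ i"]
    show "det (?M x) * inverse (det (A c x)) = Vc c x \<bullet> bvec i"
      by (simp add: to_vec_def det_transpose divide_inverse)
  qed
qed

text \<open>Jacobi's formula gives the logarithmic derivative of \<open>rho\<close> as half the
  trace of \<open>B\<close> times the derivative of \<open>A\<close>. What remains is the index
  computation \<open>liouville_divergence\<close>.\<close>

lemma divergence_V:
  assumes x: "x \<in> chart_image c"
  shows "(\<Sum>i\<in>UNIV. frechet_derivative (\<lambda>y. rho c y * (Vc c y \<bullet> bvec i)) (at x) (bvec i)) = real DIM('f) / 2 * rho c x"
proof -
  note o = open_chart_image[OF c]
  obtain B where B: "B ** A c x = mat 1" "A c x ** B = mat 1"
    using det_A_nonzero[OF x] unfolding invertible_det_nz[symmetric] invertible_def by blast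
  define dA where "dA = (\<lambda>h j k. frechet_derivative (\<lambda>y. A c y $ j $ k) (at x) h)"
  define dV where "dV = (\<lambda>h k. frechet_derivative (\<lambda>y. Vc c y \<bullet> bvec k) (at x) h)"
  define da where "da = (\<lambda>h k. frechet_derivative (\<lambda>y. \<alpha>c c y (bvec k)) (at x) h)"
  have hA: "((\<lambda>y. A c y $ j $ k) has_derivative (\<lambda>h. dA h j k)) (at x)" for j k
    unfolding dA_def by (rule Ck_on_1_has_derivative[OF Ck_A x])
  have hV: "((\<lambda>y. Vc c y \<bullet> bvec k) has_derivative (\<lambda>h. dV h k)) (at x)" for k
    unfolding dV_def by (rule Ck_on_1_has_derivative[OF Ck_Vc x])
  have ha: "((\<lambda>y. \<alpha>c c y (bvec k)) has_derivative (\<lambda>h. da h k)) (at x)" for k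
    unfolding da_def by (rule smooth_on_has_derivative[OF smooth_\<alpha>c x])
  define tr where "tr = (\<lambda>h. \<Sum>i\<in>UNIV. \<Sum>j\<in>UNIV. B $ i $ j * dA h j i)"
  have hrho: "(rho c has_derivative (\<lambda>h. rho c x * (tr h / 2))) (at x)"
    unfolding rho_def tr_def
    by (rule has_derivative_root4_square[OF has_derivative_det[OF hA B(1)] det_A_nonzero[OF x]])
  have A_skew: "transpose (A c x) = - A c x"
    unfolding vec_eq_iff by (simp add: transpose_def A_def, intro allI, rule \<omega>c_skew[OF x])
  \<comment> \<open>\<open>A\<close> is skew, so \<open>- transpose B\<close> is another left
    inverse of \<open>A\<close>; equality of inverses makes \<open>B\<close> skew.\<close>
  have "(- transpose B) ** A c x = mat 1"
  proof -
    have "(- transpose B) ** A c x = transpose B ** transpose (A c x)"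
      by (simp add: A_skew matrix_matrix_mult_def vec_eq_iff sum_negf)
    also have "\<dots> = mat 1"
      by (simp add: matrix_transpose_mul[symmetric] B transpose_mat)
    finally show ?thesis .
  qed
  then have BB: "- transpose B = B"
    by (metis B(2) matrix_mul_assoc matrix_mul_lid matrix_mul_rid)
  have B_skew: "B $ i $ j = - B $ j $ i" for i j
    using arg_cong[OF BB, of "\<lambda>M. M $ i $ j", symmetric] by (simp only: transpose_def vec_lambda_beta vector_uminus_component)
  have AB: "(\<Sum>k\<in>UNIV. A c x $ i $ k * B $ k $ j) = (if i = j then 1 else 0)" for i j
    using arg_cong[OF B(2), of "\<lambda>M. M $ i $ j"] by (simp add: matrix_matrix_mult_def mat_def)
  have dA_skew: "dA h j k = - dA h k j" for h j k
  proof -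
    have "((\<lambda>y. - A c y $ k $ j) has_derivative (\<lambda>h. - dA h k j)) (at x)"
      by (rule has_derivative_minus[OF hA])
    then have "((\<lambda>y. A c y $ j $ k) has_derivative (\<lambda>h. - dA h k j)) (at x)"
      by (rule has_derivative_transform_within_open[OF _ o x])
         (unfold A_def vec_lambda_beta, rule \<omega>c_skew[symmetric])
    from has_derivative_unique[OF hA this] show ?thesis by metis
  qed
  have closed: "dA (bvec i) j k = - dA (bvec j) k i - dA (bvec k) i j" for i j k
  proof -
    have "chart_form M c zero_form x [bvec i, bvec j, bvec k] = (\<Sum>l\<le>2. (- 1) ^ l *
        frechet_derivative (\<lambda>y. chart_form M c \<omega> y (take l [bvec i, bvec j, bvec k] @
          drop (Suc l) [bvec i, bvec j, bvec k])) (at x) ([bvec i, bvec j, bvec k] ! l))"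
      using d\<omega> c x unfolding is_ext_deriv_def by simp
    then have "0 = dA (bvec i) j k - dA (bvec j) i k + dA (bvec k) i j"
      by (simp add: numeral_2_eq_2 chart_form_def[of _ _ zero_form] dA_def A_def)
    then show ?thesis using dA_skew[of "bvec j" i k] by simp
  qed
  have exact: "da (bvec j) k - da (bvec k) j = A c x $ j $ k" for j k
  proof -
    have "\<omega>c c x (bvec j) (bvec k) = (\<Sum>l\<le>1. (- 1) ^ l *
        frechet_derivative (\<lambda>y. chart_form M c \<alpha> y (take l [bvec j, bvec k] @
          drop (Suc l) [bvec j, bvec k])) (at x) ([bvec j, bvec k] ! l))"
      using exact c x unfolding is_ext_deriv_def by simp
    then show ?thesis by (simp add: da_def A_def)
  qed
  \<comment> \<open>The equation that defines \<open>V\<close> is differentiated in direction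
    \<open>h\<close>.\<close>
  have product: "da h k = (\<Sum>i\<in>UNIV. dV h i * A c x $ i $ k) + (\<Sum>i\<in>UNIV. (Vc c x \<bullet> bvec i) * dA h i k)" for h k
  proof -
    have "((\<lambda>y. \<Sum>i\<in>UNIV. (Vc c y \<bullet> bvec i) * A c y $ i $ k) has_derivative
        (\<lambda>h. \<Sum>i\<in>UNIV. (Vc c x \<bullet> bvec i) * dA h i k + dV h i * A c x $ i $ k)) (at x)"
      by (intro has_derivative_sum has_derivative_mult hV hA)
    then have "((\<lambda>y. \<alpha>c c y (bvec k)) has_derivative
        (\<lambda>h. \<Sum>i\<in>UNIV. (Vc c x \<bullet> bvec i) * dA h i k + dV h i * A c x $ i $ k)) (at x)"
      by (rule has_derivative_transform_within_open[OF _ o x]) (simp add: A_def sum_\<omega>c Vc)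
    from has_derivative_unique[OF ha this] show ?thesis
      by (simp add: fun_eq_iff sum.distrib add.commute)
  qed
  have "frechet_derivative (\<lambda>y. rho c y * (Vc c y \<bullet> bvec i)) (at x) h
      = rho c x * dV h i + rho c x * (tr h / 2) * (Vc c x \<bullet> bvec i)" for i h
    by (rule fun_cong[OF frechet_derivative_at[OF has_derivative_mult[OF hrho hV], symmetric]])
  then have "(\<Sum>i\<in>UNIV. frechet_derivative (\<lambda>y. rho c y * (Vc c y \<bullet> bvec i)) (at x) (bvec i))
      = rho c x * ((\<Sum>i\<in>UNIV. dV (bvec i) i) + (\<Sum>i\<in>UNIV. (Vc c x \<bullet> bvec i) * tr (bvec i)) / 2)"
    by (simp add: sum.distrib sum_distrib_left sum_divide_distrib algebra_simps)
  also have "(\<Sum>i\<in>UNIV. dV (bvec i) i) + (\<Sum>i\<in>UNIV. (Vc c x \<bullet> bvec i) * tr (bvec i)) / 2 = real CARD('f bidx) / 2"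
    unfolding tr_def
    by (rule liouville_divergence[where A = "\<lambda>i j. A c x $ i $ j" and da = "\<lambda>j k. da (bvec j) k"])
       (fact B_skew AB dA_skew closed product exact)+
  finally show ?thesis by (simp add: card_bidx)
qed

end

text \<open>The matrices of \<omega> are related by congruence with the Jacobian, so their
  determinants differ by its squared determinant. The square root leaves precisely the factor of the
  change of variables formula.\<close>

lemma rho_change:
  assumes c: "c \<in> atlas M" and d: "d \<in> atlas M" and p: "p \<in> fst c" "p \<in> fst d"
  shows "rho c (snd c p) = \<bar>det (lmat (tder c d p))\<bar> * rho d (snd d p)"
proof -
  let ?J = "tder c d p"
  note x = chart_in_image[OF p(2)]
  have \<omega>: "\<omega>c c (snd c p) u v = \<omega>c d (snd d p) (?J u) (?J v)" for u v
    by (simp add: chart_form_def chart_inv_of[OF c p(1)] chart_inv_of[OF d p(2)] tvec_change[OF c d p])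
  have "A c (snd c p) $ i $ j = (transpose (lmat ?J) ** A d (snd d p) ** lmat ?J) $ i $ j" for i j
  proof -
    have "(\<Sum>l\<in>UNIV. (?J (bvec j) \<bullet> bvec l) * \<omega>c d (snd d p) (?J (bvec i)) (bvec l)) = \<omega>c d (snd d p) (?J (bvec i)) (?J (bvec j))"
      using sum_\<omega>c[OF d x, of "?J (bvec j)" "?J (bvec i)"] \<omega>c_skew[OF d x, of "?J (bvec i)"] by (simp add: sum_negf)
    then show ?thesis
      by (simp add: A_def \<omega> matrix_matrix_mult_def transpose_def lmat_def sum_\<omega>c[OF d x] mult.commute)
  qed
  then have "A c (snd c p) = transpose (lmat ?J) ** A d (snd d p) ** lmat ?J"
    by (simp add: vec_eq_iff)
  then have E: "(det (A c (snd c p)))\<^sup>2 = ((det (lmat ?J))\<^sup>2)\<^sup>2 * (det (A d (snd d p)))\<^sup>2"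
    by (simp add: det_mul det_transpose power2_eq_square)
  show ?thesis
    unfolding rho_def E real_sqrt_mult real_sqrt_abs by (simp add: real_sqrt_mult)
qed

section \<open>Integration against the density in charts\<close>

definition cont :: "('a \<Rightarrow> real) \<Rightarrow> bool" where
  "cont f \<longleftrightarrow> (\<forall>c\<in>atlas M. continuous_on (chart_image c) (\<lambda>x. f (chart_inv c x)))"

definition C1 :: "('a \<Rightarrow> real) \<Rightarrow> bool" where
  "C1 f \<longleftrightarrow> (\<forall>c\<in>atlas M. Ck_on 1 (chart_image c) (\<lambda>x. f (chart_inv c x)))"

text \<open>\<open>K\<close> is taken in coordinates: it serves as a compact set for integrals there
  and, through \<open>chart_inv\<close>, as a closed set in \<open>M\<close>.\<close>

definition supp_in :: "('a, 'f) chart \<Rightarrow> ('a \<Rightarrow> real) \<Rightarrow> bool" where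
  "supp_in c f \<longleftrightarrow> (\<exists>K. compact K \<and> K \<subseteq> chart_image c \<and> (\<forall>q\<in>points M. q \<notin> chart_inv c ` K \<longrightarrow> f q = 0))"

text \<open>For \<open>f\<close> supported in the chart, the Lebesgue integral of this function
  plays the part of the integral of \<open>f\<close> over \<open>M\<close>.\<close>

definition chart_density :: "('a, 'f) chart \<Rightarrow> ('a \<Rightarrow> real) \<Rightarrow> 'f \<Rightarrow> real" where
  "chart_density c f x = (if x \<in> chart_image c then f (chart_inv c x) * rho c x else 0)"

definition vder :: "('a \<Rightarrow> real) \<Rightarrow> 'a \<Rightarrow> real" where
  "vder f q = dir_deriv M f q (V q)"

lemma C1_imp_cont: "C1 f \<Longrightarrow> cont f"
  unfolding C1_def cont_def using Ck_on_imp_continuous_on by blast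

lemma chart_inv_in_image_iff:
  assumes "c \<in> atlas M" "x \<in> chart_image c" "K \<subseteq> chart_image c"
  shows "chart_inv c x \<in> chart_inv c ` K \<longleftrightarrow> x \<in> K"
  using assms by (simp add: chart_inv_image_eq chart_inv_in chart_of_inv)

lemma density_integrable:
  assumes c: "c \<in> atlas M" and f: "cont f" "supp_in c f"
  shows density_continuous: "continuous_on UNIV (chart_density c f)"
    and "integrable lborel (chart_density c f)"
proof -
  obtain K where K: "compact K" "K \<subseteq> chart_image c" "\<forall>q\<in>points M. q \<notin> chart_inv c ` K \<longrightarrow> f q = 0"
    using f(2) unfolding supp_in_def by blast
  have zero: "f (chart_inv c x) = 0" if "x \<in> chart_image c" "x \<notin> K" for x
    using K(3) point_of_chart[OF c that(1)] chart_inv_in_image_iff[OF c that(1) K(2)] that(2) by blast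
  have "continuous_on (chart_image c) (\<lambda>x. f (chart_inv c x) * rho c x)"
    using f(1) c Ck_on_imp_continuous_on[OF Ck_rho[OF c, of 0]]
    unfolding cont_def by (intro continuous_on_mult) blast+
  then have "Ck_on 0 UNIV (\<lambda>x. if x \<in> chart_image c then f (chart_inv c x) * rho c x else 0)"
    by (intro Ck_on_extend_zero_UNIV[OF open_chart_image[OF c] _ K(1,2)]) (auto simp: zero)
  then show cont: "continuous_on UNIV (chart_density c f)"
    by (simp add: chart_density_def[abs_def])
  show "integrable lborel (chart_density c f)"
    by (rule integrable_continuous_compact_support[OF cont K(1)]) (auto simp: chart_density_def zero)
qed

text \<open>Support in both charts makes both densities vanish off the overlap, where
  \<open>rho_change\<close> supplies the Jacobian factor. So the value does not depend on the chart
  used.\<close>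

lemma integral_density_change:
  assumes c: "c \<in> atlas M" and d: "d \<in> atlas M" and f: "cont f" "supp_in c f" "supp_in d f"
  shows "integral\<^sup>L lborel (chart_density c f) = integral\<^sup>L lborel (chart_density d f)"
proof (rule change_of_variables)
  let ?S = "snd c ` (fst c \<inter> fst d)" and ?k = "snd d \<circ> chart_inv c"
  show "open ?S" by (rule open_overlap[OF c d])
  show "(?k has_derivative tder c d (chart_inv c x)) (at x)" if "x \<in> ?S" for x
    using that tder_has_derivative[OF c d] by (auto simp: chart_inv_of[OF c])
  show "inj_on ?k ?S"
  proof (rule inj_onI)
    fix x y assume "x \<in> ?S" "y \<in> ?S" and eq: "?k x = ?k y"
    then obtain p q where "p \<in> fst c" "p \<in> fst d" "x = snd c p" "q \<in> fst c" "q \<in> fst d" "y = snd c q"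
      by blast
    with eq show "x = y" using chart_inv_of[OF c] chart_inv_of[OF d] by (metis comp_apply)
  qed
  have zero: "f q = 0" if "e \<in> atlas M" "supp_in e f" "q \<in> points M" "q \<notin> fst e" for e q
    using that chart_inv_image_eq[OF that(1)] unfolding supp_in_def by blast
  show "integrable lborel (chart_density c f)" "integrable lborel (chart_density d f)"
    by (rule density_integrable; fact)+
  show "chart_density d f y = 0" if "y \<notin> ?k ` ?S" for y
  proof (cases "y \<in> chart_image d")
    case True
    have "chart_inv d y \<notin> fst c"
    proof
      assume q: "chart_inv d y \<in> fst c"
      then have "?k (snd c (chart_inv d y)) = y"
        by (simp add: chart_inv_of[OF c] chart_of_inv[OF True])
      moreover have "snd c (chart_inv d y) \<in> ?S"
        using q chart_inv_in[OF True] by blast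
      ultimately show False using that by (metis imageI)
    qed
    then show ?thesis
      using zero[OF c f(2) point_of_chart[OF d True]] by (simp add: chart_density_def)
  qed (simp add: chart_density_def)
  show "chart_density c f x = 0" if "x \<notin> ?S" for x
  proof (cases "x \<in> chart_image c")
    case True
    have "chart_inv c x \<notin> fst d"
      using that chart_inv_in[OF True] chart_of_inv[OF True] by (metis IntI imageI)
    then show ?thesis
      using zero[OF d f(3) point_of_chart[OF c True]] by (simp add: chart_density_def)
  qed (simp add: chart_density_def)
  show "chart_density c f x = \<bar>det (lmat (tder c d (chart_inv c x)))\<bar> * chart_density d f (?k x)" if x: "x \<in> ?S" for x
  proof -
    obtain q where q: "q \<in> fst c" "q \<in> fst d" "x = snd c q" using x by blast
    then show ?thesis
      by (simp add: chart_density_def chart_in_image chart_inv_of[OF c] chart_inv_of[OF d] rho_change[OF c d])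
  qed
qed

lemma vder_chart:
  assumes c: "c \<in> atlas M" and q: "q \<in> fst c"
    and f: "((\<lambda>x. f (chart_inv c x)) has_derivative f') (at (snd c q))"
  shows "vder f q = f' (Vc c (snd c q))"
proof -
  have p: "q \<in> points M" using q chart_domain_subset[OF c] by blast
  note d = chart_at[OF p]
  have "(f \<circ> chart_inv (chart_at M q) has_derivative (\<lambda>v. f' (tder (chart_at M q) c q v))) (at (snd (chart_at M q) q))"
    using has_derivative_in_chart[OF d(1) c d(2) q f] by (simp add: o_def)
  from frechet_derivative_at[OF this, symmetric] show ?thesis
    by (simp add: vder_def dir_deriv_def Vc_def chart_inv_of[OF c q] coords_tder)
qed

lemma C1_has_derivative:
  assumes "C1 f" "c \<in> atlas M" "x \<in> chart_image c"
  shows "((\<lambda>x. f (chart_inv c x)) has_derivative frechet_derivative (\<lambda>x. f (chart_inv c x)) (at x)) (at x)"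
  using assms unfolding C1_def by (intro Ck_on_1_has_derivative[of "chart_image c"]) auto

lemma vder_sum:
  assumes f: "C1 f" and c: "c \<in> atlas M" and x: "x \<in> chart_image c"
  shows "vder f (chart_inv c x) = (\<Sum>i\<in>UNIV. (Vc c x \<bullet> bvec i) * frechet_derivative (\<lambda>x. f (chart_inv c x)) (at x) (bvec i))"
proof -
  note d = C1_has_derivative[OF f c x]
  have "vder f (chart_inv c x) = frechet_derivative (\<lambda>x. f (chart_inv c x)) (at x) (Vc c x)"
    using vder_chart[OF c chart_inv_in[OF x], of f] d by (simp add: chart_of_inv[OF x])
  also have "\<dots> = (\<Sum>b\<in>Basis. (Vc c x \<bullet> b) *\<^sub>R frechet_derivative (\<lambda>x. f (chart_inv c x)) (at x) b)"
    by (rule linear_basis_expansion[OF has_derivative_linear[OF d]])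
  finally show ?thesis by (simp add: sum_bvec[symmetric])
qed

lemma cont_vder:
  assumes f: "C1 f"
  shows "cont (vder f)"
  unfolding cont_def
proof
  fix c assume c: "c \<in> atlas M"
  note o = open_chart_image[OF c]
  have "Ck_on 0 (chart_image c) (\<lambda>x. frechet_derivative (\<lambda>x. f (chart_inv c x)) (at x) v)" for v
    using f c unfolding C1_def by simp
  then have "Ck_on 0 (chart_image c) (\<lambda>x. \<Sum>i\<in>UNIV. (Vc c x \<bullet> bvec i) * frechet_derivative (\<lambda>x. f (chart_inv c x)) (at x) (bvec i))"
    by (intro Ck_on_sum Ck_on_mult Ck_Vc o c)
  then have "Ck_on 0 (chart_image c) (\<lambda>x. vder f (chart_inv c x))"
    by (rule Ck_on_cong[OF o, rotated]) (simp add: vder_sum[OF f c])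
  then show "continuous_on (chart_image c) (\<lambda>x. vder f (chart_inv c x))" by simp
qed

lemma supp_in_vder:
  assumes c: "c \<in> atlas M" and f: "supp_in c f"
  shows "supp_in c (vder f)"
proof -
  obtain K where K: "compact K" "K \<subseteq> chart_image c" "\<forall>q\<in>points M. q \<notin> chart_inv c ` K \<longrightarrow> f q = 0"
    using f unfolding supp_in_def by blast
  have "vder f q = 0" if q: "q \<in> points M" "q \<notin> chart_inv c ` K" for q
  proof -
    define d where "d = chart_at M q"
    have d: "d \<in> atlas M" "q \<in> fst d" unfolding d_def by (rule chart_at[OF q(1)])+
    let ?V = "fst d - chart_inv c ` K"
    have "openin (mtop M) ?V"
      by (intro openin_diff openin_chart_domain closedin_chart_inv_compact c d K)
    then have o: "open (snd d ` ?V)"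
      by (intro open_chart_of d) auto
    have "((\<lambda>x. f (chart_inv d x)) has_derivative (\<lambda>v. 0)) (at (snd d q))"
    proof (rule has_derivative_transform_within_open[OF has_derivative_const[of 0] o])
      show "snd d q \<in> snd d ` ?V" using q d by blast
      fix x assume "x \<in> snd d ` ?V"
      then obtain p where "p \<in> fst d" "p \<notin> chart_inv c ` K" "x = snd d p" by blast
      then show "0 = f (chart_inv d x)"
        using K(3) chart_domain_subset[OF d(1)] by (auto simp: chart_inv_of[OF d(1)])
    qed
    from vder_chart[OF d this] show ?thesis by simp
  qed
  with K show ?thesis unfolding supp_in_def by blast
qed

text \<open>The integrand is the divergence of \<open>f V\<close>, by the Leibniz rule and the
  constant divergence of \<open>V\<close>. Times \<open>rho\<close>, it is a sum of partial
  derivatives of compactly supported functions.\<close>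

lemma integral_divergence:
  assumes c: "c \<in> atlas M" and f: "C1 f" "supp_in c f"
  shows "integral\<^sup>L lborel (chart_density c (\<lambda>q. real DIM('f) / 2 * f q + vder f q)) = 0"
proof -
  obtain K where K: "compact K" "K \<subseteq> chart_image c" "\<forall>q\<in>points M. q \<notin> chart_inv c ` K \<longrightarrow> f q = 0"
    using f(2) unfolding supp_in_def by blast
  note o = open_chart_image[OF c]
  have zero: "f (chart_inv c x) = 0" if "x \<in> chart_image c" "x \<notin> K" for x
    using K(3) point_of_chart[OF c that(1)] chart_inv_in_image_iff[OF c that(1) K(2)] that(2) by blast
  define u where "u = (\<lambda>i x. rho c x * (Vc c x \<bullet> bvec i))"
  define h where "h = (\<lambda>i x. if x \<in> chart_image c then f (chart_inv c x) * u i x else 0)"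
  have Ck_f: "Ck_on 1 (chart_image c) (\<lambda>x. f (chart_inv c x))"
    using f(1) c unfolding C1_def by blast
  have Ck_u: "Ck_on 1 (chart_image c) (u i)" for i
    unfolding u_def by (intro Ck_on_mult o Ck_rho Ck_Vc c)
  have Ck_h: "Ck_on 1 UNIV (h i)" for i
    unfolding h_def by (intro Ck_on_extend_zero_UNIV[OF o _ K(1,2)] Ck_on_mult o Ck_f Ck_u) (simp add: zero)
  have h0: "h i x = 0" if "x \<notin> K" for i x
    using zero that by (simp add: h_def)
  let ?D = "\<lambda>i x. frechet_derivative (h i) (at x) (bvec i)"
  have hd: "(h i has_derivative frechet_derivative (h i) (at x)) (at x)" for i x
    by (rule Ck_on_1_has_derivative[OF Ck_h]) simp
  have cD: "continuous_on UNIV (?D i)" for i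
    using Ck_h[of i] by simp
  have D0: "?D i x = 0" if "x \<notin> K" for i x
  proof -
    have "open (- K)" using K by (simp add: compact_imp_closed open_Compl)
    then have "(h i has_derivative (\<lambda>v. 0)) (at x)"
      by (rule has_derivative_transform_within_open[OF has_derivative_const[of 0]]) (use that h0 in auto)
    from frechet_derivative_at[OF this] show ?thesis by metis
  qed
  have pt: "chart_density c (\<lambda>q. real DIM('f) / 2 * f q + vder f q) x = (\<Sum>i\<in>UNIV. ?D i x)" for x
  proof (cases "x \<in> chart_image c")
    case True
    have "?D i x = f (chart_inv c x) * frechet_derivative (u i) (at x) (bvec i)
        + frechet_derivative (\<lambda>x. f (chart_inv c x)) (at x) (bvec i) * u i x" for i
    proof -
      have "((\<lambda>x. f (chart_inv c x) * u i x) has_derivative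
          (\<lambda>v. f (chart_inv c x) * frechet_derivative (u i) (at x) v
            + frechet_derivative (\<lambda>x. f (chart_inv c x)) (at x) v * u i x)) (at x)"
        by (intro has_derivative_mult Ck_on_1_has_derivative[OF Ck_f True] Ck_on_1_has_derivative[OF Ck_u True])
      then have "(h i has_derivative
          (\<lambda>v. f (chart_inv c x) * frechet_derivative (u i) (at x) v
            + frechet_derivative (\<lambda>x. f (chart_inv c x)) (at x) v * u i x)) (at x)"
        by (rule has_derivative_transform_within_open[OF _ o True]) (simp add: h_def)
      from fun_cong[OF frechet_derivative_at[OF this, symmetric]] show ?thesis .
    qed
    then have "(\<Sum>i\<in>UNIV. ?D i x) = f (chart_inv c x) * (\<Sum>i\<in>UNIV. frechet_derivative (u i) (at x) (bvec i))
        + rho c x * vder f (chart_inv c x)"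
      by (simp add: sum.distrib vder_sum[OF f(1) c True] u_def sum_distrib_left algebra_simps)
    then show ?thesis
      using divergence_V[OF c True] True by (simp add: chart_density_def u_def algebra_simps)
  next
    case False
    then have "x \<notin> K" using K(2) by blast
    then show ?thesis using False D0 by (simp add: chart_density_def)
  qed
  have "chart_density c (\<lambda>q. real DIM('f) / 2 * f q + vder f q) = (\<lambda>x. \<Sum>i\<in>UNIV. ?D i x)"
    by (rule ext) (rule pt)
  moreover have "integral\<^sup>L lborel (\<lambda>x. \<Sum>i\<in>UNIV. ?D i x) = (\<Sum>i\<in>UNIV. integral\<^sup>L lborel (?D i))"
    by (intro Bochner_Integration.integral_sum integrable_continuous_compact_support[OF cD K(1) D0])
  moreover have "integral\<^sup>L lborel (?D i) = 0" for i
    by (rule integral_directional_derivative_eq_0[OF hd cD K(1) h0])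
  ultimately show ?thesis by (simp only: sum.neutral_const)
qed

lemma density_nonneg: "c \<in> atlas M \<Longrightarrow> (\<And>q. q \<in> points M \<Longrightarrow> f q \<ge> 0) \<Longrightarrow> chart_density c f x \<ge> 0"
  unfolding chart_density_def using point_of_chart[of c x] less_imp_le[OF rho_pos[of c x]]
  by (auto intro!: mult_nonneg_nonneg)

text \<open>A nonnegative function with zero integral vanishes almost everywhere, but by continuity
  the set where this one is nonzero is open, and it contains the point of \<open>p\<close>.\<close>

lemma integral_density_pos:
  assumes c: "c \<in> atlas M" and f: "cont f" "supp_in c f" "\<And>q. q \<in> points M \<Longrightarrow> f q \<ge> 0"
    and p: "p \<in> fst c" "f p > 0"
  shows "integral\<^sup>L lborel (chart_density c f) > 0"
proof (rule ccontr)
  note int = density_integrable(2)[OF c f(1,2)]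
  have nn: "chart_density c f x \<ge> 0" for x
    by (rule density_nonneg[OF c f(3)])
  assume "\<not> ?thesis"
  moreover have "integral\<^sup>L lborel (chart_density c f) \<ge> 0"
    by (rule Bochner_Integration.integral_nonneg) (rule nn)
  ultimately have "integral\<^sup>L lborel (chart_density c f) = 0"
    by linarith
  then have "AE x in lborel. chart_density c f x = 0"
    using integral_nonneg_eq_0_iff_AE[OF int] nn by simp
  moreover have o: "open {x. chart_density c f x \<noteq> 0}"
    by (intro open_Collect_neq density_continuous[OF c f(1,2)] continuous_on_const)
  ultimately have "{x. chart_density c f x \<noteq> 0} \<in> null_sets lborel"
    using AE_iff_null[of lborel "\<lambda>x. chart_density c f x = 0"] by simp
  then have "negligible {x. chart_density c f x \<noteq> 0}"
    by (simp add: negligible_iff_null_sets null_sets_completionI)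
  moreover have "chart_density c f (snd c p) \<noteq> 0"
    using p rho_pos[OF c chart_in_image[OF p(1)]] by (simp add: chart_density_def chart_in_image chart_inv_of[OF c])
  ultimately show False
    using open_not_negligible[OF o] by blast
qed

text \<open>With a partition of unity \<psi>, let \<open>h p\<close> be the divergence of
  \<open>\<psi> p\<close> times V and add the integrals of \<open>\<psi> r * h p\<close> over all
  \<open>p\<close> and \<open>r\<close>. Summing over \<open>r\<close> in the chart of
  \<open>p\<close> leaves the integral of a divergence, which is 0; summing over \<open>p\<close> in
  the chart of \<open>r\<close> leaves a positive multiple of the integral of
  \<open>\<psi> r\<close>.\<close>

theorem not_compact: "\<not> compact_space (mtop M)"
proof
  assume compact: "compact_space (mtop M)"
  let ?c = "chart_at M"
  have "\<forall>p\<in>points M. \<exists>b K. smooth_on UNIV b \<and> b (snd (?c p) p) = (1::real) \<and> (\<forall>x. b x \<ge> 0) \<and>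
      compact K \<and> K \<subseteq> chart_image (?c p) \<and> (\<forall>x. x \<notin> K \<longrightarrow> b x = 0) \<and> open {x. b x > 0}"
    using chart_bump_exists[OF chart_at] by metis
  from bchoice[OF this] obtain b where "\<forall>p\<in>points M. \<exists>K. smooth_on UNIV (b p) \<and> b p (snd (?c p) p) = (1::real) \<and> (\<forall>x. b p x \<ge> 0) \<and>
      compact K \<and> K \<subseteq> chart_image (?c p) \<and> (\<forall>x. x \<notin> K \<longrightarrow> b p x = 0) \<and> open {x. b p x > 0}" ..
  from bchoice[OF this] obtain K where bK: "\<forall>p\<in>points M. smooth_on UNIV (b p) \<and> b p (snd (?c p) p) = (1::real) \<and> (\<forall>x. b p x \<ge> 0) \<and>
      compact (K p) \<and> K p \<subseteq> chart_image (?c p) \<and> (\<forall>x. x \<notin> K p \<longrightarrow> b p x = 0) \<and> open {x. b p x > 0}" ..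
  define U where "U = (\<lambda>p. chart_inv (?c p) ` {x. b p x > 0})"
  have pos_sub: "{x. b p x > 0} \<subseteq> chart_image (?c p)" if "p \<in> points M" for p
    using bK that by force
  have U_eq: "U p = {q \<in> fst (?c p). b p (snd (?c p) q) > 0}" if "p \<in> points M" for p
    unfolding U_def using chart_inv_image_eq[OF chart_at(1)[OF that] pos_sub[OF that]] by simp
  have "openin (mtop M) (U p)" if "p \<in> points M" for p
    unfolding U_def using bK that by (intro openin_chart_inv_image chart_at pos_sub) auto
  moreover have "p \<in> U p" if "p \<in> points M" for p
    using bK that chart_at(2)[OF that] by (simp add: U_eq)
  ultimately have "\<exists>\<F>. finite \<F> \<and> \<F> \<subseteq> U ` points M \<and> points M \<subseteq> \<Union>\<F>"
    using compact unfolding compact_space_def by (intro compactinD) auto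
  then obtain \<F> where \<F>: "finite \<F>" "\<F> \<subseteq> U ` points M" "points M \<subseteq> \<Union>\<F>"
    by blast
  obtain I where "I \<subseteq> points M" "finite I" "\<F> = U ` I"
    using finite_subset_image[OF \<F>(1,2)] by blast
  with \<F>(3) have I: "finite I" "I \<subseteq> points M" "points M \<subseteq> (\<Union>p\<in>I. U p)"
    by auto
  note at = chart_at[OF subsetD[OF I(2)]]
  \<comment> \<open>The bumps carried over to \<open>M\<close>. Their sum \<open>S\<close> is
    positive at every point because the sets \<open>U p\<close> cover \<open>M\<close>, so it can be
    divided out.\<close>
  define \<beta> where "\<beta> = (\<lambda>p q. if q \<in> fst (?c p) then b p (snd (?c p) q) else 0)"
  define S where "S = (\<lambda>q. \<Sum>p\<in>I. \<beta> p q)"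
  define \<psi> where "\<psi> = (\<lambda>p q. \<beta> p q * inverse (S q))"
  have \<beta>_nonneg: "\<beta> p q \<ge> 0" if "p \<in> I" for p q
    using bK that I(2) by (auto simp: \<beta>_def)
  have S_pos: "S q > 0" if q: "q \<in> points M" for q
  proof -
    obtain p where "p \<in> I" "q \<in> U p" using I(3) q by blast
    then have "\<beta> p q > 0" using U_eq I(2) by (auto simp: \<beta>_def)
    then show ?thesis
      unfolding S_def using \<open>p \<in> I\<close> \<beta>_nonneg I(1) by (intro sum_pos2[of I p]) auto
  qed
  have \<psi>_nonneg: "\<psi> p q \<ge> 0" if "p \<in> I" "q \<in> points M" for p q
    using \<beta>_nonneg[OF that(1)] S_pos[OF that(2)] by (simp add: \<psi>_def)
  have sum_\<psi>: "(\<Sum>p\<in>I. \<psi> p q) = 1" if "q \<in> points M" for q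
    using S_pos[OF that] by (simp add: \<psi>_def sum_distrib_right[symmetric] S_def)
  have \<beta>_zero: "\<beta> p q = 0" if "p \<in> I" "q \<notin> chart_inv (?c p) ` K p" for p q
  proof -
    have "q \<notin> fst (?c p) \<or> snd (?c p) q \<notin> K p"
      using that bK I(2) chart_inv_image_eq[OF at(1)[OF that(1)]] by blast
    then show ?thesis using bK that(1) I(2) by (auto simp: \<beta>_def)
  qed
  have supp: "supp_in (?c p) (\<psi> p)" if "p \<in> I" for p
    unfolding supp_in_def using bK that I(2) \<beta>_zero[OF that] by (intro exI[of _ "K p"]) (auto simp: \<psi>_def)
  have Ck_\<beta>: "Ck_on k (chart_image d) (\<lambda>x. \<beta> p (chart_inv d x))" if p: "p \<in> I" and d: "d \<in> atlas M" for p d k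
  proof (rule Ck_on_extend_zero[OF at(1)[OF p] d])
    show "compact (K p)" "K p \<subseteq> chart_image (?c p)" using bK p I(2) by auto
    have "Ck_on k (snd d ` (fst d \<inter> fst (?c p))) (\<lambda>y. b p (snd (?c p) (chart_inv d y)))"
      using smooth_on_bump_chart[OF at(1)[OF p] d, of "b p"] bK p I(2) unfolding smooth_on_def by blast
    then show "Ck_on k (snd d ` (fst d \<inter> fst (?c p))) (\<lambda>x. \<beta> p (chart_inv d x))"
      by (rule Ck_on_cong[OF open_overlap[OF d at(1)[OF p]], rotated]) (auto simp: \<beta>_def chart_inv_of[OF d])
  qed (rule \<beta>_zero[OF p])
  have C1: "C1 (\<psi> p)" if p: "p \<in> I" for p
    unfolding C1_def \<psi>_def
  proof
    fix d assume d: "d \<in> atlas M"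
    have S: "Ck_on 1 (chart_image d) (\<lambda>x. S (chart_inv d x))"
      unfolding S_def by (intro Ck_on_sum open_chart_image d Ck_\<beta>)
    show "Ck_on 1 (chart_image d) (\<lambda>x. \<beta> p (chart_inv d x) * inverse (S (chart_inv d x)))"
      using S_pos[OF point_of_chart[OF d]]
      by (intro Ck_on_mult Ck_on_inverse open_chart_image d Ck_\<beta> p S) (simp add: less_imp_neq[symmetric])
  qed
  define \<mu> where "\<mu> = real DIM('f) / 2"
  have \<mu>: "\<mu> > 0" by (simp add: \<mu>_def)
  define h where "h = (\<lambda>p q. \<mu> * \<psi> p q + vder (\<psi> p) q)"
  \<comment> \<open>The functions \<open>\<psi> p\<close> add up to 1, so their derivatives along V
    cancel and only the constant divergence of V remains.\<close>
  have sum_h: "(\<Sum>p\<in>I. h p q) = \<mu>" if q: "q \<in> points M" for q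
  proof -
    note c = chart_at[OF q]
    note x = chart_in_image[OF c(2)]
    let ?D = "\<lambda>p. frechet_derivative (\<lambda>x. \<psi> p (chart_inv (?c q) x)) (at (snd (?c q) q))"
    note hd = C1_has_derivative[OF C1 c(1) x]
    have "((\<lambda>x. \<Sum>p\<in>I. \<psi> p (chart_inv (?c q) x)) has_derivative (\<lambda>v. \<Sum>p\<in>I. ?D p v)) (at (snd (?c q) q))"
      by (intro has_derivative_sum hd)
    then have "((\<lambda>x. 1) has_derivative (\<lambda>v. \<Sum>p\<in>I. ?D p v)) (at (snd (?c q) q))"
      by (rule has_derivative_transform_within_open[OF _ open_chart_image[OF c(1)] x])
         (rule sum_\<psi>[OF point_of_chart[OF c(1)]])
    from has_derivative_unique[OF this has_derivative_const]
    have "(\<Sum>p\<in>I. ?D p v) = 0" for v by meson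
    moreover have "vder (\<psi> p) q = ?D p (Vc (?c q) (snd (?c q) q))" if "p \<in> I" for p
      by (rule vder_chart[OF c hd[OF that]])
    ultimately have "(\<Sum>p\<in>I. vder (\<psi> p) q) = 0" by simp
    then show ?thesis
      by (simp add: h_def sum.distrib sum_distrib_left[symmetric] sum_\<psi>[OF q])
  qed
  have cont_h: "cont (\<lambda>q. \<psi> r q * h p q)" if "p \<in> I" "r \<in> I" for p r
    unfolding cont_def
  proof
    fix d assume d: "d \<in> atlas M"
    have "continuous_on (chart_image d) (\<lambda>x. \<psi> s (chart_inv d x))" if "s \<in> I" for s
      using C1_imp_cont[OF C1[OF that]] d by (simp add: cont_def)
    moreover have "continuous_on (chart_image d) (\<lambda>x. vder (\<psi> p) (chart_inv d x))"
      using cont_vder[OF C1[OF that(1)]] d by (simp add: cont_def)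
    ultimately show "continuous_on (chart_image d) (\<lambda>x. \<psi> r (chart_inv d x) * h p (chart_inv d x))"
      unfolding h_def using that by (intro continuous_intros) auto
  qed
  have supp_mult: "supp_in c (\<lambda>q. f q * g q)" "supp_in c (\<lambda>q. g q * f q)" if "supp_in c f" for c and f g :: "'a \<Rightarrow> real"
    using that unfolding supp_in_def by (metis mult_zero_left, metis mult_zero_right)
  have supp_h: "supp_in (?c p) (h p)" if p: "p \<in> I" for p
  proof -
    obtain K1 where K1: "compact K1" "K1 \<subseteq> chart_image (?c p)" "\<forall>q\<in>points M. q \<notin> chart_inv (?c p) ` K1 \<longrightarrow> \<psi> p q = 0"
      using supp[OF p] unfolding supp_in_def by blast
    obtain K2 where K2: "compact K2" "K2 \<subseteq> chart_image (?c p)" "\<forall>q\<in>points M. q \<notin> chart_inv (?c p) ` K2 \<longrightarrow> vder (\<psi> p) q = 0"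
      using supp_in_vder[OF at(1)[OF p] supp[OF p]] unfolding supp_in_def by blast
    show ?thesis
      unfolding supp_in_def h_def using K1 K2 by (intro exI[of _ "K1 \<union> K2"]) (auto simp: image_Un)
  qed
  let ?I = "\<lambda>p r s. integral\<^sup>L lborel (chart_density (?c s) (\<lambda>q. \<psi> r q * h p q))"
  have "(\<Sum>r\<in>I. ?I p r r) = 0" if p: "p \<in> I" for p
  proof -
    \<comment> \<open>The product is supported in the chart of \<open>r\<close> through
      \<open>\<psi> r\<close> and in that of \<open>p\<close> through \<open>h p\<close>, so either
      chart may compute its integral.\<close>
    have "?I p r r = ?I p r p" if r: "r \<in> I" for r
      by (intro integral_density_change at p r cont_h supp_mult(1)[OF supp] supp_mult(2)[OF supp_h])
    then have "(\<Sum>r\<in>I. ?I p r r) = (\<Sum>r\<in>I. ?I p r p)"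
      by simp
    also have "\<dots> = integral\<^sup>L lborel (\<lambda>x. \<Sum>r\<in>I. chart_density (?c p) (\<lambda>q. \<psi> r q * h p q) x)"
      by (intro Bochner_Integration.integral_sum[symmetric] density_integrable at p cont_h supp_mult(2)[OF supp_h])
    also have "(\<lambda>x. \<Sum>r\<in>I. chart_density (?c p) (\<lambda>q. \<psi> r q * h p q) x) = chart_density (?c p) (h p)"
      using sum_\<psi>[OF point_of_chart[OF at(1)[OF p]]]
      by (auto simp: fun_eq_iff chart_density_def sum_distrib_right[symmetric])
    also have "integral\<^sup>L lborel (chart_density (?c p) (h p)) = 0"
      using integral_divergence[OF at(1)[OF p] C1[OF p] supp[OF p]] by (simp add: h_def[abs_def] \<mu>_def)
    finally show ?thesis .
  qed
  then have "0 = (\<Sum>p\<in>I. \<Sum>r\<in>I. ?I p r r)" by simp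
  also have "\<dots> = (\<Sum>r\<in>I. \<Sum>p\<in>I. ?I p r r)" by (rule sum.swap)
  also have "\<dots> = (\<Sum>r\<in>I. integral\<^sup>L lborel (chart_density (?c r) (\<lambda>q. \<mu> * \<psi> r q)))"
  proof (rule sum.cong[OF refl])
    fix r assume r: "r \<in> I"
    have "(\<Sum>p\<in>I. ?I p r r) = integral\<^sup>L lborel (\<lambda>x. \<Sum>p\<in>I. chart_density (?c r) (\<lambda>q. \<psi> r q * h p q) x)"
      by (intro Bochner_Integration.integral_sum[symmetric] density_integrable at r cont_h supp_mult(1)[OF supp])
    also have "(\<lambda>x. \<Sum>p\<in>I. chart_density (?c r) (\<lambda>q. \<psi> r q * h p q) x) = chart_density (?c r) (\<lambda>q. \<mu> * \<psi> r q)"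
      using sum_h[OF point_of_chart[OF at(1)[OF r]]]
      by (auto simp: fun_eq_iff chart_density_def sum_distrib_right[symmetric] sum_distrib_left[symmetric])
    finally show "(\<Sum>p\<in>I. ?I p r r) = integral\<^sup>L lborel (chart_density (?c r) (\<lambda>q. \<mu> * \<psi> r q))" .
  qed
  also have "\<dots> > 0"
  proof (rule sum_pos)
    show "finite I" by (rule I(1))
    \<comment> \<open>Manifolds are nonempty by definition, so a cover cannot be empty and the sum
      has a positive term.\<close>
    show "I \<noteq> {}" using I(3) smooth_manifold by (auto simp: smooth_manifold_def)
    fix r assume r: "r \<in> I"
    then have rM: "r \<in> points M" using I(2) by blast
    have "\<psi> r r > 0"
      using bK rM at[OF r] S_pos[OF rM] by (simp add: \<psi>_def \<beta>_def)
    moreover have "cont (\<lambda>q. \<mu> * \<psi> r q)"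
      using C1_imp_cont[OF C1[OF r]] unfolding cont_def by (auto intro: continuous_intros)
    ultimately show "integral\<^sup>L lborel (chart_density (?c r) (\<lambda>q. \<mu> * \<psi> r q)) > 0"
      using \<mu> \<psi>_nonneg[OF r]
      by (intro integral_density_pos[OF at(1)[OF r] _ supp_mult(2)[OF supp[OF r]] _ at(2)[OF r]]) auto
  qed
  finally show False by simp
qed

end

section \<open>From differential forms to the cohomology class\<close>

lemma (in smooth_mfd) zero_form_in_diff_forms: "zero_form \<in> diff_forms M k"
  unfolding diff_forms_def chart_form_def
  by (auto intro!: linearI smooth_on_const open_chart_image)

lemma is_ext_deriv_zero_form: "is_ext_deriv M k zero_form zero_form"
  unfolding is_ext_deriv_def chart_form_def
  by (simp add: frechet_derivative_const)

theorem theorem5p3: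
  fixes M :: "('a, 'f::euclidean_space) manifold"
    and N :: "('a, 'e::euclidean_space) manifold"
    and \<phi> :: "'a \<Rightarrow> 'e \<Rightarrow> 'e"
    and \<xi> :: "'a \<Rightarrow> 'e"
    and \<eta> :: "'a \<Rightarrow> 'e \<Rightarrow> real"
    and g :: "'a \<Rightarrow> 'e \<Rightarrow> 'e \<Rightarrow> real"
    and m n :: nat
  assumes "m \<ge> 1"
    and "DIM('f) = 2 * m"
    and "DIM('e) = 2 * n + 1"
    and "cosymplectic_manifold N \<phi> \<xi> \<eta> g"
    and "proper_pointwise_slant_submanifold M N \<phi> \<xi> g"
    and "compact_space (mtop M)"
    and "normal_to M N g \<xi>"
  shows "deRham_class M 2 (slant_form M N \<phi> g) \<in> deRham_cohomology M 2 \<and>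
         deRham_class M 2 (slant_form M N \<phi> g) \<noteq> deRham_class M 2 zero_form"
proof -
  let ?\<Omega> = "slant_form M N \<phi> g"
  have sub: "submanifold M N"
    using assms(5) by (simp add: proper_pointwise_slant_submanifold_def)
  have "almost_contact_metric_manifold N \<phi> \<xi> \<eta> g"
    using assms(4) by (simp add: cosymplectic_manifold_def)
  then interpret contact_submfd M N \<phi> \<xi> \<eta> g
    using sub by unfold_locales (auto simp: submanifold_def)
  have \<Omega>: "?\<Omega> \<in> closed_forms M 2"
    by (rule slant_form_in_closed_forms[OF assms(4)])
  have zero: "zero_form \<in> exact_forms M 2" "zero_form \<in> closed_forms M 2"
    using zero_form_in_diff_forms is_ext_deriv_zero_form
    by (auto simp: exact_forms_def closed_forms_def numeral_2_eq_2)
  have "deRham_class M 2 ?\<Omega> \<noteq> deRham_class M 2 zero_form"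
  proof
    assume eq: "deRham_class M 2 ?\<Omega> = deRham_class M 2 zero_form"
    \<comment> \<open>Equal classes would share this representative, and being cohomologous to 0
      means being exact.\<close>
    have "zero_form \<in> deRham_class M 2 zero_form"
      using zero by (simp add: deRham_class_def cohomologous_def)
    then have "?\<Omega> \<in> exact_forms M 2"
      unfolding eq[symmetric] by (simp add: deRham_class_def cohomologous_def)
    then obtain \<alpha> where "\<alpha> \<in> diff_forms M 1" "is_ext_deriv M 1 \<alpha> ?\<Omega>"
      by (auto simp: exact_forms_def numeral_2_eq_2)
    \<comment> \<open>The slant condition yields nondegeneracy in the second slot; skewness carries
      it to the first.\<close>
    moreover have "\<exists>z. ?\<Omega> p [u, z] \<noteq> 0" if p: "p \<in> points M" and "u \<noteq> 0" for p u
    proof -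
      obtain z where z: "?\<Omega> p [z, u] > 0"
        by (rule slant_form_nondegenerate[OF assms(5,7) p \<open>u \<noteq> 0\<close>])
      have "?\<Omega> p [u, z] = - ?\<Omega> p [z, u]"
        unfolding slant_form_eq[OF p] using p points_subset by (intro N.g_phi_skew) blast
      with z show ?thesis by (intro exI[of _ z]) simp
    qed
    ultimately interpret exact_nondegenerate M ?\<Omega> \<alpha>
      using \<Omega> by unfold_locales
    show False
      using not_compact assms(6) by blast
  qed
  moreover have "deRham_class M 2 ?\<Omega> \<in> deRham_cohomology M 2"
    using \<Omega> by (simp add: deRham_class_def deRham_cohomology_def quotientI)
  ultimately show ?thesis by blast
qed

end
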